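(* Let $n\geq 2$, let $m\geq 1$ be an integer, and let $0<\alpha<2$. Let $f=f(x,u,Du,\cdots)\leq 0$ be a nonpositive nonlinearity (possibly depending on $x$, $u$ and derivatives of $u$) which is continuous with respect to $x\in\mathbb{R}^n$. Suppose that $u$ is a nonnegative classical solution of $$(-\Delta)^{m+\frac{\alpha}{2}}u(x)=f(x,u,Du,\cdots),\qquad x\in\mathbb{R}^n,$$ that is, $u\in C^{2m+[\alpha],\{\alpha\}+\epsilon}_{loc}(\mathbb{R}^n)\cap\mathcal{L}_\alpha(\mathbb{R}^n)$ for some arbitrarily small $\epsilon>0$, $u\geq 0$ in $\mathbb{R}^n$, and the equation holds pointwise in $\mathbb{R}^n$. Then, for every $i=0,1,\dots,m-1$, $$(-\Delta)^{i+\frac{\alpha}{2}}u(x)\leq 0\qquad\text{for all } x\in\mathbb{R}^n.$$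
   Context: $[\alpha]$ is the integer part of $\alpha$ and $\{\alpha\}=\alpha-[\alpha]$. $\mathcal{L}_\alpha(\mathbb{R}^n)=\{u:\mathbb{R}^n\to\mathbb{R} : \int_{\mathbb{R}^n}\frac{|u(x)|}{1+|x|^{n+\alpha}}dx<\infty\}$. For $0<\alpha<2$ and $u\in C^{[\alpha],\{\alpha\}+\epsilon}_{loc}(\mathbb{R}^n)\cap\mathcal{L}_\alpha(\mathbb{R}^n)$, the fractional Laplacian is $(-\Delta)^{\frac{\alpha}{2}}u(x)=C_{n,\alpha}\lim_{\varepsilon\to0}\int_{|y-x|\geq\varepsilon}\frac{u(x)-u(y)}{|x-y|^{n+\alpha}}dy$, where $C_{n,\alpha}>0$ is the usual normalization constant (Fourier multiplier $|\xi|^\alpha$). For $u\in C^{2m+[\alpha],\{\alpha\}+\epsilon}_{loc}(\mathbb{R}^n)\cap\mathcal{L}_\alpha(\mathbb{R}^n)$ one has $(-\Delta)^{\frac{\alpha}{2}}u\in C^{2m}(\mathbb{R}^n)$, and for integers $0\leq i\leq m$ one defines $(-\Delta)^{i+\frac{\alpha}{2}}u:=(-\Delta)^i\big((-\Delta)^{\frac{\alpha}{2}}u\big)$, with $-\Delta$ the usual Laplacian. In the equation, the right-hand side is the continuous function $x\mapsto f(x,u(x),Du(x),\cdots)$ on $\mathbb{R}^n$. *)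

theory Defs
  imports "HOL-Analysis.Analysis"
begin

definition partial_deriv :: "'n \<Rightarrow> (real^'n \<Rightarrow> real) \<Rightarrow> real^'n \<Rightarrow> real" where
  "partial_deriv i g x = deriv (\<lambda>t. g (x + t *\<^sub>R axis i 1)) 0"

text \<open>Multi-indices are lists of coordinates: the list of \<open>i\<^sub>1, \<dots>, i\<^sub>r\<close> stands for
  \<open>\<partial>\<^bsub>i\<^sub>1\<^esub> \<dots> \<partial>\<^bsub>i\<^sub>r\<^esub>\<close>, with the last entry applied first; the order of the derivative is the
  length of the list.\<close>

definition partial_derivs :: "'n list \<Rightarrow> (real^'n \<Rightarrow> real) \<Rightarrow> real^'n \<Rightarrow> real" where
  "partial_derivs js g = foldr partial_deriv js g"

text \<open>Since \<^const>\<open>deriv\<close> is total, existence of the derivatives has to be required separately.\<close>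

definition C_k :: "nat \<Rightarrow> (real^'n \<Rightarrow> real) set" where
  "C_k k = {g. (\<forall>js i x. length js < k \<longrightarrow>
                  (\<lambda>t. partial_derivs js g (x + t *\<^sub>R axis i 1)) differentiable (at 0)) \<and>
               (\<forall>js. length js \<le> k \<longrightarrow> continuous_on UNIV (partial_derivs js g))}"

definition C_k_holder_loc :: "nat \<Rightarrow> real \<Rightarrow> (real^'n \<Rightarrow> real) set" where
  "C_k_holder_loc k \<gamma> = {g \<in> C_k k. \<forall>js K. length js = k \<longrightarrow> compact K \<longrightarrow>
     (\<exists>C. \<forall>x\<in>K. \<forall>y\<in>K.
        \<bar>partial_derivs js g x - partial_derivs js g y\<bar> \<le> C * norm (x - y) powr \<gamma>)}"

definition L_frac :: "real \<Rightarrow> (real^'n \<Rightarrow> real) set" where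
  "L_frac \<alpha> = {u \<in> borel_measurable lebesgue.
     integrable lebesgue (\<lambda>x. \<bar>u x\<bar> / (1 + norm x powr (real CARD('n) + \<alpha>)))}"

text \<open>The closed form of the constant for which \<open>(-\<Delta>)\<^bsup>\<alpha>/2\<^esup>\<close> has Fourier symbol \<open>|\<xi>|\<^bsup>\<alpha>\<^esup>\<close>
  on \<open>\<real>\<^sup>n\<close>, \<open>0 < \<alpha> < 2\<close>.\<close>

definition frac_laplacian_const :: "nat \<Rightarrow> real \<Rightarrow> real" where
  "frac_laplacian_const n \<alpha> =
     2 powr \<alpha> * Gamma ((real n + \<alpha>) / 2) / (pi powr (real n / 2) * \<bar>Gamma (- \<alpha> / 2)\<bar>)"

definition frac_laplacian :: "real \<Rightarrow> (real^'n \<Rightarrow> real) \<Rightarrow> real^'n \<Rightarrow> real" where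
  "frac_laplacian \<alpha> u x = frac_laplacian_const CARD('n) \<alpha> *
     Lim (at_right 0) (\<lambda>\<epsilon>. LINT y:{y. norm (y - x) \<ge> \<epsilon>}|lebesgue.
        (u x - u y) / norm (x - y) powr (real CARD('n) + \<alpha>))"

definition neg_laplacian :: "(real^'n \<Rightarrow> real) \<Rightarrow> real^'n \<Rightarrow> real" where
  "neg_laplacian g x = - (\<Sum>i\<in>UNIV. partial_deriv i (partial_deriv i g) x)"

text \<open>\<open>higher_frac_laplacian i \<alpha>\<close> is \<open>(-\<Delta>)\<^bsup>i+\<alpha>/2\<^esup>\<close>.\<close>

definition higher_frac_laplacian :: "nat \<Rightarrow> real \<Rightarrow> (real^'n \<Rightarrow> real) \<Rightarrow> real^'n \<Rightarrow> real" where
  "higher_frac_laplacian i \<alpha> u = (neg_laplacian ^^ i) (frac_laplacian \<alpha> u)"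

text \<open>All partial derivatives of \<open>u\<close> at \<open>x\<close> up to order \<open>k\<close>; the empty list carries the value
  \<open>u x\<close>. A nonlinearity \<open>f(x, u, Du, \<dots>)\<close> is a function of \<open>x\<close> and of such a jet.\<close>

definition jet :: "nat \<Rightarrow> (real^'n \<Rightarrow> real) \<Rightarrow> real^'n \<Rightarrow> 'n list \<Rightarrow> real" where
  "jet k u x = (\<lambda>js. if length js \<le> k then partial_derivs js u x else 0)"

end

theory Submission
  imports Defs
begin

text \<open>
  Write \<open>v\<^sub>i\<close> for \<open>(-\<Delta>)\<^bsup>i+\<alpha>/2\<^esup> u\<close> and let \<open>\<phi>\<^sub>N(x) = (1 - |x|\<^sup>2)\<^sub>+\<^sup>N\<close>. For \<open>g\<close> of class \<open>C\<^sup>2\<close> the average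
  \<open>A\<^sub>N(R) = \<integral> g(z + R x) \<phi>\<^sub>N(x) dx\<close> has derivative \<open>- R / (2 (N + 1))\<close> times the average of
  \<open>-\<Delta> g\<close> against \<open>\<phi>\<^bsub>N+1\<^esub>\<close>. Suppose \<open>v\<^bsub>i+1\<^esub> \<le> 0\<close> but \<open>v\<^sub>i(z) > 0\<close>. Then the averages of \<open>v\<^sub>i\<close> about
  \<open>z\<close> stay above a positive constant, so those of \<open>v\<^bsub>i-1\<^esub>\<close> tend to minus infinity, those of
  \<open>v\<^bsub>i-2\<^esub>\<close> to plus infinity, and so on: the averages of \<open>v\<^sub>0\<close> stay away from \<open>0\<close>. On the other hand,
  moving the fractional Laplacian to the test function bounds the averages of \<open>v\<^sub>0\<close> by a multiple of
  \<open>\<integral> |u(y)| (R\<^sup>2 + |y - z|\<^sup>2)\<^bsup>-(n+\<alpha>)/2\<^esup> dy\<close>, which tends to \<open>0\<close> by dominated convergence.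

  That \<open>v\<^sub>0\<close> is of class \<open>C\<^bsup>2m\<^esup>\<close> follows by splitting the kernel \<open>|y|\<^bsup>-n-\<alpha>\<^esup>\<close>: the part near the
  origin acts on second differences, so derivatives fall on \<open>u\<close>; the rest is a convolution with a
  function all of whose derivatives of the required orders decay like \<open>|y|\<^bsup>-n-\<alpha>\<^esup>\<close>.
\<close>

text \<open>The weights \<open>bump N\<close> replace spherical means because they serve both halves
  of the argument. They are closed under differentiation in R: \<open>x $ i * bump N x\<close> is,
  up to a constant, a partial derivative of \<open>bump (Suc N)\<close>, so passing from one level
  to the next is one integration by parts between compactly supported functions, at the price of
  raising N by one. And for N >= 3 they are of class C^2, smooth enough to carry the fractional
  Laplacian for every \<alpha> < 2. To arrive at level 0 with a fixed exponent N, the descent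
  therefore enters level i with exponent N + i.

  The decay rate n + \<alpha> of the fractional Laplacian of such a bump is the rate of the weight
  in \<open>L_frac\<close>, so integrability of u against that weight is all that the limit of the
  averages requires.

  Principal values are removed early by symmetrising. The second difference cancels the first-order
  term at the singularity, so every later integral converges absolutely and Fubini applies. The
  conclusion is reached by downward induction from level m, where the equation supplies the
  sign.\<close>

subsection \<open>Partial derivatives\<close>

text \<open>A relation rather than a function: it asserts existence at every point together with the
  value, so the calculus rules compose without differentiability side conditions.\<close>

definition has_pd :: "'n \<Rightarrow> (real^'n \<Rightarrow> real) \<Rightarrow> (real^'n \<Rightarrow> real) \<Rightarrow> bool" where
  "has_pd i g g' \<longleftrightarrow> (\<forall>x. ((\<lambda>t. g (x + t *\<^sub>R axis i 1)) has_real_derivative g' x) (at 0))"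

text \<open>The base point in \<open>has_pd\<close> is arbitrary, so the derivative at parameter s
  is the one at parameter 0 from the shifted base point.\<close>

lemma has_pd_at:
  assumes "has_pd i g g'"
  shows "((\<lambda>t. g (x + t *\<^sub>R axis i 1)) has_real_derivative g' (x + s *\<^sub>R axis i 1)) (at s)"
proof -
  have "((\<lambda>t. g ((x + s *\<^sub>R axis i 1) + t *\<^sub>R axis i 1)) has_real_derivative g' (x + s *\<^sub>R axis i 1)) (at 0)"
    using assms by (simp add: has_pd_def)
  then show ?thesis
    using DERIV_shift[of "\<lambda>t. g (x + t *\<^sub>R axis i 1)" "g' (x + s *\<^sub>R axis i 1)" 0 s]
    by (simp add: algebra_simps)
qed

lemma has_pd_partial_deriv: "has_pd i g g' \<Longrightarrow> partial_deriv i g = g'"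
  unfolding has_pd_def partial_deriv_def by (auto intro!: ext DERIV_imp_deriv)

lemma has_pd_const: "has_pd i (\<lambda>x. c) (\<lambda>x. 0)"
  by (simp add: has_pd_def)

lemma has_pd_coord: "has_pd i (\<lambda>x. x $ j) (\<lambda>x. if i = j then 1 else 0)"
  by (auto simp: has_pd_def axis_def intro!: derivative_eq_intros)

lemma has_pd_add: "has_pd i f f' \<Longrightarrow> has_pd i g g' \<Longrightarrow> has_pd i (\<lambda>x. f x + g x) (\<lambda>x. f' x + g' x)"
  by (auto simp: has_pd_def intro!: DERIV_add)

lemma has_pd_cmult: "has_pd i g g' \<Longrightarrow> has_pd i (\<lambda>x. c * g x) (\<lambda>x. c * g' x)"
  by (auto simp: has_pd_def intro!: DERIV_cmult)

lemma has_pd_mult: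
  assumes "has_pd i f f'" "has_pd i g g'"
  shows "has_pd i (\<lambda>x. f x * g x) (\<lambda>x. f' x * g x + f x * g' x)"
  unfolding has_pd_def
proof
  fix x
  have "((\<lambda>t. f (x + t *\<^sub>R axis i 1)) has_real_derivative f' x) (at 0)"
       "((\<lambda>t. g (x + t *\<^sub>R axis i 1)) has_real_derivative g' x) (at 0)"
    using assms by (auto simp: has_pd_def)
  from DERIV_mult[OF this]
  show "((\<lambda>t. f (x + t *\<^sub>R axis i 1) * g (x + t *\<^sub>R axis i 1)) has_real_derivative
        f' x * g x + f x * g' x) (at 0)"
    by (simp add: algebra_simps)
qed

lemma has_pd_comp:
  assumes "has_pd i g g'" "\<And>s. (h has_real_derivative h' s) (at s)"
  shows "has_pd i (\<lambda>x. h (g x)) (\<lambda>x. h' (g x) * g' x)"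
  unfolding has_pd_def
proof
  fix x
  have "((\<lambda>t. g (x + t *\<^sub>R axis i 1)) has_real_derivative g' x) (at 0)"
    using assms by (auto simp: has_pd_def)
  from DERIV_chain2[OF _ this, of h] assms(2)
  show "((\<lambda>t. h (g (x + t *\<^sub>R axis i 1))) has_real_derivative h' (g x) * g' x) (at 0)"
    by simp
qed

lemma has_pd_shift:
  assumes "has_pd i g g'" shows "has_pd i (\<lambda>x. g (x + y)) (\<lambda>x. g' (x + y))"
  unfolding has_pd_def
proof
  fix x show "((\<lambda>t. g (x + t *\<^sub>R axis i 1 + y)) has_real_derivative g' (x + y)) (at 0)"
    using assms[unfolded has_pd_def, rule_format, of "x + y"] by (simp add: algebra_simps)
qed

lemma has_pd_scale:
  assumes "has_pd i g g'" shows "has_pd i (\<lambda>x. g (z + R *\<^sub>R x)) (\<lambda>x. R * g' (z + R *\<^sub>R x))"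
  unfolding has_pd_def
proof
  fix x
  let ?G = "\<lambda>t. g (z + R *\<^sub>R x + t *\<^sub>R axis i 1)"
  have *: "(?G has_real_derivative g' (z + R *\<^sub>R x)) (at (R * 0))"
    using assms by (simp add: has_pd_def)
  have "((\<lambda>t. R * t) has_real_derivative R) (at 0)"
    by (auto intro!: derivative_eq_intros)
  from DERIV_chain2[of ?G "g' (z + R *\<^sub>R x)" "\<lambda>t. R * t", OF * this]
  show "((\<lambda>t. g (z + R *\<^sub>R (x + t *\<^sub>R axis i 1))) has_real_derivative R * g' (z + R *\<^sub>R x)) (at 0)"
    by (simp add: algebra_simps)
qed

lemma has_pd_norm_square: "has_pd i (\<lambda>x::real^'n. (norm x)\<^sup>2) (\<lambda>x. 2 * x $ i)"
proof -
  have "((\<lambda>t. (norm x)\<^sup>2 + 2 * t * x $ i + t\<^sup>2) has_real_derivative 2 * x $ i) (at 0)" for x :: "real^'n"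
    by (auto intro!: derivative_eq_intros)
  moreover have "(norm (x + t *\<^sub>R axis i 1))\<^sup>2 = (norm x)\<^sup>2 + 2 * t * x $ i + t\<^sup>2" for x :: "real^'n" and t
    by (simp add: power2_norm_eq_inner inner_add_left inner_add_right inner_axis inner_axis' inner_commute[of "axis i 1" x] algebra_simps flip: power2_eq_square)
  ultimately show ?thesis by (simp add: has_pd_def)
qed

text \<open>The increment is built up one coordinate at a time. Each change of a coordinate is a
  one-variable mean value step whose intermediate point stays close to x, where continuity of the
  partials controls the error.\<close>

lemma has_derivative_partials:
  fixes g :: "real^'n \<Rightarrow> real"
  assumes pd: "\<And>i. has_pd i g (g' i)" and cont: "\<And>i. continuous_on UNIV (g' i)"
  shows "(g has_derivative (\<lambda>h. \<Sum>i\<in>UNIV. h $ i * g' i x)) (at x)"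
  unfolding has_derivative_at_alt
proof (intro conjI allI impI)
  show "bounded_linear (\<lambda>h::real^'n. \<Sum>i\<in>UNIV. h $ i * g' i x)"
    by (intro bounded_linear_sum bounded_linear_mult_left bounded_linear_compose[OF bounded_linear_mult_left]
       bounded_linear_vec_nth)
next
  fix e :: real assume "e > 0"
  define N where "N = real CARD('n)"
  have N: "N > 0" by (simp add: N_def)
  \<comment> \<open>Each of the n coordinate steps may contribute an error of at most
    \<open>e' * norm h\<close>, and these have to add up to \<open>e * norm h\<close>.\<close>
  define e' where "e' = e / N"
  have e': "e' > 0" using \<open>e > 0\<close> N by (simp add: e'_def)
  have "\<forall>i. \<exists>d>0. \<forall>y. dist y x < d \<longrightarrow> dist (g' i y) (g' i x) < e'"
    using cont e' unfolding continuous_on_iff by (metis UNIV_I)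
  then obtain d where d: "\<And>i. d i > 0" "\<And>i y. dist y x < d i \<Longrightarrow> \<bar>g' i y - g' i x\<bar> < e'"
    unfolding dist_real_def by metis
  define D where "D = Min (range d)"
  have D: "D > 0" "\<And>i. D \<le> d i" using d(1) by (auto simp: D_def)
  \<comment> \<open>S is the set of coordinates already moved from x to x + h; the induction adds
    one coordinate.\<close>
  have key: "\<bar>g (x + (\<chi> i. if i \<in> S then h $ i else 0)) - g x - (\<Sum>i\<in>S. h $ i * g' i x)\<bar> \<le> (\<Sum>i\<in>S. \<bar>h $ i\<bar> * e')"
    if h: "norm h < D" for h S
  proof (induction S rule: infinite_finite_induct)
    case (insert j S)
    define p where "p = x + (\<chi> i. if i \<in> S then h $ i else 0)"
    have pq: "x + (\<chi> i. if i \<in> insert j S then h $ i else 0) = p + (h $ j) *\<^sub>R axis j 1"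
      using insert.hyps by (auto simp: p_def vec_eq_iff axis_def)
    have near: "\<bar>g' j (p + s *\<^sub>R axis j 1) - g' j x\<bar> \<le> e'" if "\<bar>s\<bar> \<le> \<bar>h $ j\<bar>" for s
    proof -
      \<comment> \<open>Componentwise, the intermediate point differs from x by no more than h
        does.\<close>
      have "norm (p + s *\<^sub>R axis j 1 - x) \<le> norm h"
        by (rule norm_le_componentwise_cart) (use that insert.hyps in \<open>auto simp: p_def axis_def\<close>)
      then have "dist (p + s *\<^sub>R axis j 1) x < d j" using h D(2)[of j] by (simp add: dist_norm)
      from d(2)[OF this] show ?thesis by simp
    qed
    have "\<exists>s. \<bar>s\<bar> \<le> \<bar>h $ j\<bar> \<and> g (p + (h $ j) *\<^sub>R axis j 1) - g p = h $ j * g' j (p + s *\<^sub>R axis j 1)"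
    proof -
      let ?f = "\<lambda>t. g (p + t *\<^sub>R axis j 1)" let ?f' = "\<lambda>t. g' j (p + t *\<^sub>R axis j 1)"
      consider "h $ j = 0" | "h $ j > 0" | "h $ j < 0" by linarith
      then show ?thesis
      proof cases
        case 2
        from MVT2[OF this, of ?f ?f'] has_pd_at[OF pd[of j]] obtain z where "0 < z" "z < h $ j" "?f (h $ j) - ?f 0 = (h $ j - 0) * ?f' z" by blast
        then show ?thesis by (intro exI[of _ z]) auto
      next
        case 3
        from MVT2[OF this, of ?f ?f'] has_pd_at[OF pd[of j]] obtain z where "h $ j < z" "z < 0" "?f 0 - ?f (h $ j) = (0 - h $ j) * ?f' z" by blast
        then show ?thesis by (intro exI[of _ z]) auto
      qed auto
    qed
    then obtain s where s: "\<bar>s\<bar> \<le> \<bar>h $ j\<bar>" "g (p + (h $ j) *\<^sub>R axis j 1) - g p = h $ j * g' j (p + s *\<^sub>R axis j 1)" by blast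
    have "\<bar>g (p + (h $ j) *\<^sub>R axis j 1) - g p - h $ j * g' j x\<bar> = \<bar>h $ j\<bar> * \<bar>g' j (p + s *\<^sub>R axis j 1) - g' j x\<bar>"
      by (simp add: s(2) abs_mult[symmetric] algebra_simps)
    also have "\<dots> \<le> \<bar>h $ j\<bar> * e'" by (intro mult_left_mono near s) auto
    finally show ?case using insert.IH insert.hyps unfolding pq p_def[symmetric] by simp
  qed (auto simp: zero_vec_def[symmetric])
  show "\<exists>d>0. \<forall>y. norm (y - x) < d \<longrightarrow>
          norm (g y - g x - (\<Sum>i\<in>UNIV. (y - x) $ i * g' i x)) \<le> e * norm (y - x)"
  proof (intro exI[of _ D] conjI allI impI D)
    fix y assume y: "norm (y - x) < D"
    have "(\<chi> i. if i \<in> UNIV then (y - x) $ i else 0) = y - x" by (simp add: vec_eq_iff)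
    with key[OF y, of UNIV] have "\<bar>g y - g x - (\<Sum>i\<in>UNIV. (y - x) $ i * g' i x)\<bar> \<le> (\<Sum>i\<in>UNIV. \<bar>(y - x) $ i\<bar> * e')"
      by (simp add: algebra_simps)
    also have "\<dots> \<le> (\<Sum>i\<in>(UNIV::'n set). norm (y - x) * e')"
      using e' by (intro sum_mono mult_right_mono component_le_norm_cart) auto
    also have "\<dots> = e * norm (y - x)" using N by (simp add: e'_def N_def)
    finally show "norm (g y - g x - (\<Sum>i\<in>UNIV. (y - x) $ i * g' i x)) \<le> e * norm (y - x)" by simp
  qed
qed

lemma has_real_derivative_along_line:
  fixes g :: "real^'n \<Rightarrow> real"
  assumes pd: "\<And>i. has_pd i g (g' i)" and cont: "\<And>i. continuous_on UNIV (g' i)"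
  shows "((\<lambda>t. g (x + t *\<^sub>R v)) has_real_derivative (\<Sum>i\<in>UNIV. v $ i * g' i (x + s *\<^sub>R v))) (at s)"
proof -
  have 1: "((\<lambda>t. x + t *\<^sub>R v) has_derivative (\<lambda>t. t *\<^sub>R v)) (at s)"
    by (auto intro!: derivative_eq_intros)
  from has_derivative_compose[OF 1 has_derivative_partials[OF pd cont]]
  have "((\<lambda>t. g (x + t *\<^sub>R v)) has_derivative (\<lambda>t. \<Sum>i\<in>UNIV. (t *\<^sub>R v) $ i * g' i (x + s *\<^sub>R v))) (at s)" .
  then show ?thesis
    unfolding has_field_derivative_def
    by (rule has_derivative_eq_rhs) (auto simp: sum_distrib_left sum_distrib_right mult_ac intro!: ext)
qed

section \<open>Recursive form of the classes of C^k and locally Hoelder functions\<close>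

lemma partial_derivs_snoc: "partial_derivs (js @ [i]) g = partial_derivs js (partial_deriv i g)"
  by (simp add: partial_derivs_def)

lemma partial_derivs_Nil [simp]: "partial_derivs [] g = g"
  by (simp add: partial_derivs_def)

lemma all_list_snoc: "(\<forall>js. P js) \<longleftrightarrow> P [] \<and> (\<forall>js i. P (js @ [i]))"
  by (metis rev_exhaust)

lemma C_k_0_iff: "g \<in> C_k 0 \<longleftrightarrow> continuous_on UNIV g"
  by (simp add: C_k_def)

lemma has_pd_partial_deriv_iff:
  "has_pd i g (partial_deriv i g) \<longleftrightarrow> (\<forall>x. (\<lambda>t. g (x + t *\<^sub>R axis i 1)) differentiable (at 0))"
  unfolding has_pd_def partial_deriv_def by (metis DERIV_deriv_iff_real_differentiable)

text \<open>The last list entry is the derivative taken first, so lists are split at their end. The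
  recursion obtained this way replaces multi-indices in all later inductions on the order.\<close>

lemma C_k_Suc_iff:
  "g \<in> C_k (Suc k) \<longleftrightarrow>
     continuous_on UNIV g \<and> (\<forall>i. has_pd i g (partial_deriv i g) \<and> partial_deriv i g \<in> C_k k)"
proof -
  have split1: "(\<forall>js. length js < Suc k \<longrightarrow> P js) \<longleftrightarrow> P [] \<and> (\<forall>js i. length js < k \<longrightarrow> P (js @ [i]))"
    for P :: "'a list \<Rightarrow> bool"
    by (subst all_list_snoc) simp
  have split2: "(\<forall>js. length js \<le> Suc k \<longrightarrow> P js) \<longleftrightarrow> P [] \<and> (\<forall>js i. length js \<le> k \<longrightarrow> P (js @ [i]))"
    for P :: "'a list \<Rightarrow> bool"
    by (subst all_list_snoc) simp
  have "g \<in> C_k (Suc k) \<longleftrightarrow>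
      (\<forall>js. length js < Suc k \<longrightarrow> (\<forall>i x. (\<lambda>t. partial_derivs js g (x + t *\<^sub>R axis i 1)) differentiable (at 0))) \<and>
      (\<forall>js. length js \<le> Suc k \<longrightarrow> continuous_on UNIV (partial_derivs js g))"
    unfolding C_k_def by blast
  also have "\<dots> \<longleftrightarrow> continuous_on UNIV g \<and> (\<forall>i. has_pd i g (partial_deriv i g) \<and> partial_deriv i g \<in> C_k k)"
    unfolding split1 split2 partial_derivs_snoc partial_derivs_Nil has_pd_partial_deriv_iff C_k_def mem_Collect_eq
    by blast
  finally show ?thesis .
qed

lemma C_k_SucI:
  "continuous_on UNIV g \<Longrightarrow> (\<And>i. has_pd i g (g' i)) \<Longrightarrow> (\<And>i. g' i \<in> C_k k) \<Longrightarrow> g \<in> C_k (Suc k)"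
  unfolding C_k_Suc_iff by (metis has_pd_partial_deriv)

lemma C_k_SucD:
  assumes "g \<in> C_k (Suc k)"
  shows "continuous_on UNIV g" "\<And>i. has_pd i g (partial_deriv i g)" "\<And>i. partial_deriv i g \<in> C_k k"
  using assms unfolding C_k_Suc_iff by blast+

lemma C_k_continuous: "g \<in> C_k k \<Longrightarrow> continuous_on UNIV g"
  by (cases k) (auto simp: C_k_Suc_iff C_k_0_iff)

lemma C_k_Suc_subset: "g \<in> C_k (Suc k) \<Longrightarrow> g \<in> C_k k"
  by (auto simp: C_k_def)

lemma C_k_mono: "g \<in> C_k k \<Longrightarrow> l \<le> k \<Longrightarrow> g \<in> C_k l"
  by (auto simp: C_k_def)

lemma C_k_const: "(\<lambda>x. c) \<in> C_k k"
  by (induction k arbitrary: c) (auto simp: C_k_0_iff intro: C_k_SucI[OF _ has_pd_const])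

lemma C_k_add: "f \<in> C_k k \<Longrightarrow> g \<in> C_k k \<Longrightarrow> (\<lambda>x. f x + g x) \<in> C_k k"
proof (induction k arbitrary: f g)
  case (Suc k)
  note f = C_k_SucD[OF Suc.prems(1)] and g = C_k_SucD[OF Suc.prems(2)]
  show ?case
    by (rule C_k_SucI[OF _ has_pd_add[OF f(2) g(2)]]) (use f g Suc.IH in \<open>auto intro!: continuous_intros\<close>)
qed (auto simp: C_k_0_iff intro!: continuous_intros)

lemma C_k_mult: "f \<in> C_k k \<Longrightarrow> g \<in> C_k k \<Longrightarrow> (\<lambda>x. f x * g x) \<in> C_k k"
proof (induction k arbitrary: f g)
  case (Suc k)
  note f = C_k_SucD[OF Suc.prems(1)] and g = C_k_SucD[OF Suc.prems(2)]
  show ?case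
    by (rule C_k_SucI[OF _ has_pd_mult[OF f(2) g(2)]])
      (use f g Suc.IH Suc.prems[THEN C_k_Suc_subset] in \<open>auto intro!: continuous_intros C_k_add\<close>)
qed (auto simp: C_k_0_iff intro!: continuous_intros)

lemma C_k_cmult: "g \<in> C_k k \<Longrightarrow> (\<lambda>x. c * g x) \<in> C_k k"
  by (intro C_k_mult C_k_const)

lemma C_k_sum: "finite A \<Longrightarrow> (\<And>a. a \<in> A \<Longrightarrow> g a \<in> C_k k) \<Longrightarrow> (\<lambda>x. \<Sum>a\<in>A. g a x) \<in> C_k k"
  by (induction A rule: finite_induct) (auto intro: C_k_const C_k_add)

lemma C_k_coord: "(\<lambda>x. x $ i) \<in> C_k k"
  by (cases k) (auto simp: C_k_0_iff intro!: continuous_intros C_k_SucI[OF _ has_pd_coord] C_k_const)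

lemma neg_laplacian_C_k:
  assumes "g \<in> C_k (Suc (Suc k))" shows "neg_laplacian g \<in> C_k k"
proof -
  have "partial_deriv i (partial_deriv i g) \<in> C_k k" for i
    using assms unfolding C_k_Suc_iff by blast
  then have "(\<lambda>x. (-1) * (\<Sum>i\<in>UNIV. partial_deriv i (partial_deriv i g) x)) \<in> C_k k"
    by (intro C_k_cmult C_k_sum) auto
  then show ?thesis by (simp add: neg_laplacian_def[abs_def])
qed

lemma iterate_neg_laplacian_C_k:
  "g \<in> C_k (2 * i + k) \<Longrightarrow> (neg_laplacian ^^ i) g \<in> C_k k"
  by (induction i arbitrary: k) (auto intro!: neg_laplacian_C_k)

lemma C_k_holder_loc_0_iff:
  "g \<in> C_k_holder_loc 0 \<gamma> \<longleftrightarrow> continuous_on UNIV g \<and>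
     (\<forall>K. compact K \<longrightarrow> (\<exists>C. \<forall>x\<in>K. \<forall>y\<in>K. \<bar>g x - g y\<bar> \<le> C * norm (x - y) powr \<gamma>))"
  by (simp add: C_k_holder_loc_def C_k_0_iff)

lemma C_k_holder_loc_Suc_iff:
  "g \<in> C_k_holder_loc (Suc k) \<gamma> \<longleftrightarrow> continuous_on UNIV g \<and>
     (\<forall>i. has_pd i g (partial_deriv i g) \<and> partial_deriv i g \<in> C_k_holder_loc k \<gamma>)"
  unfolding C_k_holder_loc_def mem_Collect_eq C_k_Suc_iff
  apply (subst all_list_snoc)
  apply (simp add: partial_derivs_snoc)
  by blast

lemma C_k_holder_loc_C_k: "g \<in> C_k_holder_loc k \<gamma> \<Longrightarrow> g \<in> C_k k"
  by (simp add: C_k_holder_loc_def)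

text \<open>The partials are bounded on the compact ball, and the ball is convex, so the mean value
  inequality applies along segments.\<close>

lemma C_1_locally_lipschitz:
  fixes g :: "real^'n \<Rightarrow> real"
  assumes "g \<in> C_k (Suc 0)"
  obtains L where "L \<ge> 0" "\<And>x y. norm x \<le> r \<Longrightarrow> norm y \<le> r \<Longrightarrow> \<bar>g x - g y\<bar> \<le> L * norm (x - y)"
proof -
  define g' where "g' i = partial_deriv i g" for i
  have g: "\<And>i. has_pd i g (g' i)" "\<And>i. continuous_on UNIV (g' i)"
    using C_k_SucD[OF assms] by (auto simp: g'_def C_k_0_iff)
  have "\<forall>i. \<exists>B. \<forall>x\<in>cball 0 r. \<bar>g' i x\<bar> \<le> B"
  proof
    fix i
    have "compact (g' i ` cball 0 r)"
      by (intro compact_continuous_image continuous_on_subset[OF g(2)]) auto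
    then show "\<exists>B. \<forall>x\<in>cball 0 r. \<bar>g' i x\<bar> \<le> B"
      using compact_imp_bounded bounded_iff by (metis imageI real_norm_def)
  qed
  then obtain B where B: "\<And>i x. norm x \<le> r \<Longrightarrow> \<bar>g' i x\<bar> \<le> B i" by (metis mem_cball_0)
  define L where "L = (\<Sum>i\<in>UNIV. \<bar>B i\<bar>)"
  have "\<bar>g x - g y\<bar> \<le> L * norm (x - y)" if "norm x \<le> r" "norm y \<le> r" for x y
  proof -
    have "norm (g x - g y) \<le> L * norm (x - y)"
    proof (rule differentiable_bound)
      show "convex (cball (0::real^'n) r)" by simp
      show "(g has_derivative (\<lambda>h. \<Sum>i\<in>UNIV. h $ i * g' i z)) (at z within cball 0 r)" for z
        by (rule has_derivative_at_withinI[OF has_derivative_partials[OF g]])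
      show "onorm (\<lambda>h. \<Sum>i\<in>UNIV. h $ i * g' i z) \<le> L" if z: "z \<in> cball 0 r" for z
      proof (rule onorm_bound)
        fix h :: "real^'n"
        have "norm (\<Sum>i\<in>UNIV. h $ i * g' i z) \<le> (\<Sum>i\<in>UNIV. norm h * \<bar>B i\<bar>)"
          by (intro norm_sum[THEN order_trans] sum_mono)
            (use z in \<open>auto simp: abs_mult intro!: mult_mono component_le_norm_cart order_trans[OF B abs_ge_self]\<close>)
        then show "norm (\<Sum>i\<in>UNIV. h $ i * g' i z) \<le> L * norm h"
          by (simp add: L_def sum_distrib_left mult.commute)
      qed (simp add: L_def sum_nonneg)
    qed (use that in auto)
    then show ?thesis by simp
  qed
  moreover have "L \<ge> 0" by (simp add: L_def sum_nonneg)
  ultimately show thesis using that by blast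
qed

text \<open>Write d as d^(1-\<gamma>) d^\<gamma> and bound the first factor. This turns Lipschitz
  bounds on bounded sets into Hoelder bounds.\<close>

lemma le_powr_of_le:
  fixes d \<gamma> r :: real
  assumes "0 \<le> d" "d \<le> r" "0 < \<gamma>" "\<gamma> \<le> 1"
  shows "d \<le> r powr (1 - \<gamma>) * d powr \<gamma>"
proof (cases "d = 0")
  case False
  then have "d = d powr (1 - \<gamma>) * d powr \<gamma>" using assms by (simp add: powr_add[symmetric])
  also have "\<dots> \<le> r powr (1 - \<gamma>) * d powr \<gamma>" using assms by (intro mult_right_mono powr_mono2) auto
  finally show ?thesis .
qed auto

lemma C_k_Suc_imp_holder:
  assumes "0 < \<gamma>" "\<gamma> \<le> 1"
  shows "g \<in> C_k (Suc k) \<Longrightarrow> g \<in> C_k_holder_loc k \<gamma>"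
proof (induction k arbitrary: g)
  case 0
  show ?case unfolding C_k_holder_loc_0_iff
  proof (intro conjI allI impI)
    show "continuous_on UNIV g" using 0 by (rule C_k_continuous)
    fix K :: "(real^'a) set" assume "compact K"
    then obtain r where r: "\<And>x. x \<in> K \<Longrightarrow> norm x \<le> r" using compact_imp_bounded bounded_iff by metis
    obtain L where L: "L \<ge> 0" "\<And>x y. norm x \<le> r \<Longrightarrow> norm y \<le> r \<Longrightarrow> \<bar>g x - g y\<bar> \<le> L * norm (x - y)"
      using C_1_locally_lipschitz[OF 0] by blast
    have "\<bar>g x - g y\<bar> \<le> (L * (2 * r) powr (1 - \<gamma>)) * norm (x - y) powr \<gamma>" if "x \<in> K" "y \<in> K" for x y
    proof -
      have "norm (x - y) \<le> (2 * r) powr (1 - \<gamma>) * norm (x - y) powr \<gamma>"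
        using r[OF that(1)] r[OF that(2)] norm_triangle_ineq4[of x y] assms by (intro le_powr_of_le) auto
      with L(1) have "L * norm (x - y) \<le> L * ((2 * r) powr (1 - \<gamma>) * norm (x - y) powr \<gamma>)"
        by (rule mult_left_mono[rotated])
      with L(2)[OF r[OF that(1)] r[OF that(2)]] show ?thesis by (simp add: mult.assoc)
    qed
    then show "\<exists>C. \<forall>x\<in>K. \<forall>y\<in>K. \<bar>g x - g y\<bar> \<le> C * norm (x - y) powr \<gamma>" by blast
  qed
next
  case (Suc k)
  then show ?case unfolding C_k_holder_loc_Suc_iff C_k_Suc_iff[of _ "Suc k"] by blast
qed

text \<open>Below the top order one more continuous derivative exists, so the derivatives there are
  locally Lipschitz, hence Hoelder.\<close>

lemma C_k_holder_loc_mono: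
  assumes "0 < \<gamma>" "\<gamma> \<le> 1" "l \<le> k" "g \<in> C_k_holder_loc k \<gamma>"
  shows "g \<in> C_k_holder_loc l \<gamma>"
proof (cases "l = k")
  case False
  with assms have "g \<in> C_k (Suc l)" by (intro C_k_mono[OF C_k_holder_loc_C_k[OF assms(4)]]) auto
  then show ?thesis using assms C_k_Suc_imp_holder by blast
qed (use assms in auto)

subsection \<open>Dominated integrals and integrable powers\<close>

text \<open>Limits at a point of a metric space are tested on sequences, where dominated convergence
  applies. The hypotheses hold only within distance 1 of \<open>t0\<close>, so the first N terms are
  dropped. The set S allows one-sided limits as well.\<close>

lemma tendsto_integral_dominated:
  fixes f :: "'b::metric_space \<Rightarrow> 'a \<Rightarrow> real"
  assumes meas: "\<And>t. t \<in> S \<Longrightarrow> dist t t0 < 1 \<Longrightarrow> f t \<in> borel_measurable M"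
    and bound: "\<And>t x. t \<in> S \<Longrightarrow> dist t t0 < 1 \<Longrightarrow> x \<in> space M \<Longrightarrow> \<bar>f t x\<bar> \<le> g x"
    and g: "integrable M g"
    and lim: "\<And>x. x \<in> space M \<Longrightarrow> ((\<lambda>t. f t x) \<longlongrightarrow> f0 x) (at t0 within S)"
  shows "((\<lambda>t. \<integral>x. f t x \<partial>M) \<longlongrightarrow> (\<integral>x. f0 x \<partial>M)) (at t0 within S)"
  unfolding tendsto_at_iff_sequentially comp_def
proof (intro allI impI)
  fix X assume X: "\<forall>i. X i \<in> S - {t0}" "X \<longlonglongrightarrow> t0"
  obtain N where N: "\<And>n. n \<ge> N \<Longrightarrow> dist (X n) t0 < 1"
    using metric_LIMSEQ_D[OF X(2), of 1] by auto
  have lim': "(\<lambda>n. f (X (n + N)) x) \<longlonglongrightarrow> f0 x" if "x \<in> space M" for x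
    using lim[OF that, unfolded tendsto_at_iff_sequentially comp_def, rule_format, of "\<lambda>n. X (n + N)"]
      X(1) LIMSEQ_ignore_initial_segment[OF X(2), of N] by simp
  have meas': "f (X (n + N)) \<in> borel_measurable M" for n
    using X N[of "n + N"] by (intro meas) auto
  have "(\<lambda>n. \<integral>x. f (X (n + N)) x \<partial>M) \<longlonglongrightarrow> (\<integral>x. f0 x \<partial>M)"
  proof (rule integral_dominated_convergence[where w = g])
    show "f0 \<in> borel_measurable M" by (rule borel_measurable_LIMSEQ_real[OF lim' meas'])
    show "AE x in M. norm (f (X (n + N)) x) \<le> g x" for n
      using X N[of "n + N"] bound by (intro AE_I2) auto
  qed (use meas' g lim' in auto)
  then show "(\<lambda>n. \<integral>x. f (X n) x \<partial>M) \<longlonglongrightarrow> (\<integral>x. f0 x \<partial>M)"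
    by (rule LIMSEQ_offset)
qed

text \<open>The mean value inequality makes g a dominating function for the difference quotients
  too.\<close>

lemma has_real_derivative_integral_dominated:
  fixes f :: "real \<Rightarrow> 'a \<Rightarrow> real"
  assumes int: "\<And>t. \<bar>t - t0\<bar> < 1 \<Longrightarrow> integrable M (f t)"
    and deriv: "\<And>t x. \<bar>t - t0\<bar> < 1 \<Longrightarrow> x \<in> space M \<Longrightarrow> ((\<lambda>t. f t x) has_real_derivative f' t x) (at t)"
    and bound: "\<And>t x. \<bar>t - t0\<bar> < 1 \<Longrightarrow> x \<in> space M \<Longrightarrow> \<bar>f' t x\<bar> \<le> g x"
    and g: "integrable M g"
  shows "((\<lambda>t. \<integral>x. f t x \<partial>M) has_real_derivative (\<integral>x. f' t0 x \<partial>M)) (at t0)"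
proof -
  define q where "q h x = (f (t0 + h) x - f t0 x) / h" for h x
  have "((\<lambda>h. \<integral>x. q h x \<partial>M) \<longlongrightarrow> (\<integral>x. f' t0 x \<partial>M)) (at 0 within ball 0 1)"
  proof (rule tendsto_integral_dominated[where g = g])
    fix h :: real assume h: "h \<in> ball 0 1"
    have h0: "\<bar>t0 - t0\<bar> < 1" by simp
    show "q h \<in> borel_measurable M"
      unfolding q_def[abs_def] using int[of "t0 + h"] int[of t0] h
      by (auto intro!: borel_measurable_divide borel_measurable_diff borel_measurable_integrable)
    fix x assume x: "x \<in> space M"
    have "norm (f (t0 + h) x - f t0 x) \<le> g x * norm (t0 + h - t0)"
    proof (rule field_differentiable_bound[where S = "ball t0 1" and f' = "\<lambda>t. f' t x" and f = "\<lambda>t. f t x"])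
      show "((\<lambda>t. f t x) has_real_derivative f' t x) (at t within ball t0 1)" if "t \<in> ball t0 1" for t
        using that x by (intro has_field_derivative_at_within[OF deriv]) (auto simp: dist_real_def)
    qed (use bound[OF _ x] h in \<open>auto simp: dist_real_def\<close>)
    moreover have "g x \<ge> 0" using bound[OF h0 x] by linarith
    ultimately show "\<bar>q h x\<bar> \<le> g x"
      by (cases "h = 0") (auto simp: q_def divide_simps)
  next
    fix x assume x: "x \<in> space M"
    have "((\<lambda>h. q h x) \<longlongrightarrow> f' t0 x) (at 0)"
      using deriv[of t0 x] x unfolding DERIV_def q_def by simp
    then show "((\<lambda>h. q h x) \<longlongrightarrow> f' t0 x) (at 0 within ball 0 1)"
      by (rule tendsto_within_subset) simp
  qed (rule g)
  moreover have "at (0::real) within ball 0 1 = at 0"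
    by (rule at_within_open) auto
  ultimately have "((\<lambda>h. \<integral>x. q h x \<partial>M) \<longlongrightarrow> (\<integral>x. f' t0 x \<partial>M)) (at 0)" by simp
  moreover have "\<forall>\<^sub>F h in at 0. (\<integral>x. q h x \<partial>M) = ((\<integral>x. f (t0 + h) x \<partial>M) - (\<integral>x. f t0 x \<partial>M)) / h"
    unfolding eventually_at
  proof (intro exI[of _ 1] conjI ballI impI)
    fix h :: real assume "h \<noteq> 0 \<and> dist h 0 < 1"
    then have "integrable M (f (t0 + h))" "integrable M (f t0)" by (auto intro!: int simp: dist_real_def)
    then show "(\<integral>x. q h x \<partial>M) = ((\<integral>x. f (t0 + h) x \<partial>M) - (\<integral>x. f t0 x \<partial>M)) / h"
      unfolding q_def by simp
  qed simp
  ultimately show ?thesis unfolding DERIV_def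
    by (rule Lim_transform_eventually)
qed

text \<open>The dominating function may depend on a bound r for |x|, since differentiation at x only
  involves points within distance 1 of x.\<close>

lemma has_pd_integral_dominated:
  fixes f :: "real^'n \<Rightarrow> 'a \<Rightarrow> real"
  assumes int: "\<And>x. integrable M (f x)"
    and deriv: "\<And>y. y \<in> space M \<Longrightarrow> has_pd i (\<lambda>x. f x y) (\<lambda>x. f' x y)"
    and bound: "\<And>x y r. norm x \<le> r \<Longrightarrow> y \<in> space M \<Longrightarrow> \<bar>f' x y\<bar> \<le> g r y"
    and g: "\<And>r. integrable M (g r)"
  shows "has_pd i (\<lambda>x. \<integral>y. f x y \<partial>M) (\<lambda>x. \<integral>y. f' x y \<partial>M)"
  unfolding has_pd_def
proof
  fix x :: "real^'n"
  have *: "((\<lambda>t. \<integral>y. f (x + t *\<^sub>R axis i 1) y \<partial>M) has_real_derivative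
        (\<integral>y. f' (x + 0 *\<^sub>R axis i 1) y \<partial>M)) (at 0)"
  proof (rule has_real_derivative_integral_dominated[where g = "g (norm x + 1)"])
    fix t :: real and y assume t: "\<bar>t - 0\<bar> < 1" and y: "y \<in> space M"
    show "((\<lambda>t. f (x + t *\<^sub>R axis i 1) y) has_real_derivative f' (x + t *\<^sub>R axis i 1) y) (at t)"
      by (rule has_pd_at[OF deriv[OF y]])
    have "norm (x + t *\<^sub>R axis i 1) \<le> norm x + 1"
      using t norm_triangle_ineq[of x "t *\<^sub>R axis i 1"] by simp
    then show "\<bar>f' (x + t *\<^sub>R axis i 1) y\<bar> \<le> g (norm x + 1) y" using y by (rule bound)
  qed (use int g in auto)
  then show "((\<lambda>t. \<integral>y. f (x + t *\<^sub>R axis i 1) y \<partial>M) has_real_derivative (\<integral>y. f' x y \<partial>M)) (at 0)"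
    by simp
qed

lemma continuous_on_integral_dominated:
  fixes f :: "'b::real_normed_vector \<Rightarrow> 'a \<Rightarrow> real"
  assumes meas: "\<And>x. f x \<in> borel_measurable M"
    and cont: "\<And>y. y \<in> space M \<Longrightarrow> continuous_on UNIV (\<lambda>x. f x y)"
    and bound: "\<And>x y r. norm x \<le> r \<Longrightarrow> y \<in> space M \<Longrightarrow> \<bar>f x y\<bar> \<le> g r y"
    and g: "\<And>r. integrable M (g r)"
  shows "continuous_on UNIV (\<lambda>x. \<integral>y. f x y \<partial>M)"
  unfolding continuous_on_def
proof
  fix x :: 'b
  show "((\<lambda>x. \<integral>y. f x y \<partial>M) \<longlongrightarrow> (\<integral>y. f x y \<partial>M)) (at x)"
  proof (rule tendsto_integral_dominated[where g = "g (norm x + 1)"])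
    fix t y assume t: "dist t x < 1" 
    have "norm t \<le> norm x + 1" using t norm_triangle_sub[of t x] by (simp add: dist_norm)
    then show "\<bar>f t y\<bar> \<le> g (norm x + 1) y" if "y \<in> space M" using that by (rule bound)
    show "f t \<in> borel_measurable M" by (rule meas)
  next
    show "((\<lambda>t. f t y) \<longlongrightarrow> f x y) (at x)" if "y \<in> space M" for y
      using cont[OF that] unfolding continuous_on_def by blast
  qed (rule g)
qed

section \<open>Affine substitutions, and integrability of powers by dyadic decomposition\<close>

lemma integrable_lborel_affine:
  fixes f :: "'a::euclidean_space \<Rightarrow> real"
  assumes [measurable]: "f \<in> borel_measurable borel" and "c \<noteq> 0"
  shows "integrable lborel f \<longleftrightarrow> integrable lborel (\<lambda>x. f (t + c *\<^sub>R x))"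
  using \<open>c \<noteq> 0\<close>
  by (subst lborel_affine[OF \<open>c \<noteq> 0\<close>, of t])
    (simp add: integrable_density integrable_distr_eq)

lemma integral_lborel_affine:
  fixes f :: "'a::euclidean_space \<Rightarrow> real"
  assumes [measurable]: "f \<in> borel_measurable borel" and "c \<noteq> 0"
  shows "(\<integral>x. f x \<partial>lborel) = \<bar>c\<bar> ^ DIM('a) * (\<integral>x. f (t + c *\<^sub>R x) \<partial>lborel)"
  by (subst lborel_affine[OF \<open>c \<noteq> 0\<close>, of t])
    (simp add: integral_density integral_distr)

text \<open>Without polar coordinates: |f| is at most the sum of the functions \<open>c k\<close>
  times the indicator of the ball of radius \<open>r k\<close>. Overlaps only increase this sum, and
  its integral is the given series times the volume of the unit ball.\<close>

lemma integrable_dyadic: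
  fixes f :: "'a::euclidean_space \<Rightarrow> real"
  assumes [measurable]: "f \<in> borel_measurable borel"
    and nonneg: "\<And>k. c k \<ge> 0" "\<And>k. r k \<ge> 0"
    and bound: "\<And>x. f x = 0 \<or> (\<exists>k. \<bar>f x\<bar> \<le> c k \<and> norm x \<le> r k)"
    and sum: "summable (\<lambda>k. c k * r k ^ DIM('a))"
  shows "integrable lborel f"
proof (rule integrableI_bounded)
  define V where "V = unit_ball_vol (DIM('a))"
  have V: "V \<ge> 0" by (simp add: V_def)
  have le: "ennreal (norm (f x)) \<le> (\<Sum>k. ennreal (c k) * indicator (cball 0 (r k)) x)" for x
  proof (cases "f x = 0")
    case False
    with bound obtain k where k: "\<bar>f x\<bar> \<le> c k" "norm x \<le> r k" by blast
    have "ennreal (norm (f x)) \<le> ennreal (c k) * indicator (cball 0 (r k)) x"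
      using k by (simp add: ennreal_leI)
    also have "\<dots> \<le> (\<Sum>k. ennreal (c k) * indicator (cball 0 (r k)) x)"
      using ennreal_suminf_lessD[of "\<lambda>k. ennreal (c k) * indicator (cball 0 (r k)) x" _ k] not_less by blast
    finally show ?thesis .
  qed simp
  have "(\<integral>\<^sup>+x. ennreal (norm (f x)) \<partial>lborel) \<le> (\<integral>\<^sup>+x. (\<Sum>k. ennreal (c k) * indicator (cball (0::'a) (r k)) x) \<partial>lborel)"
    by (rule nn_integral_mono, rule le)
  also have "\<dots> = (\<Sum>k. \<integral>\<^sup>+x. ennreal (c k) * indicator (cball (0::'a) (r k)) x \<partial>lborel)"
    by (rule nn_integral_suminf) (auto intro!: borel_measurable_times_ennreal borel_measurable_indicator)
  also have "\<dots> = (\<Sum>k. ennreal (V * (c k * r k ^ DIM('a))))"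
    using nonneg V by (intro suminf_cong)
      (simp add: nn_integral_cmult_indicator emeasure_cball V_def ennreal_mult' mult_ac)
  also have "\<dots> < \<infinity>"
  proof -
    have "(\<Sum>k. ennreal (V * (c k * r k ^ DIM('a)))) \<noteq> top"
      by (rule ennreal_suminf_neq_top[OF summable_mult[OF sum]]) (use nonneg V in auto)
    then show ?thesis by (simp only: less_top infinity_ennreal_def)
  qed
  finally show "(\<integral>\<^sup>+x. ennreal (norm (f x)) \<partial>lborel) < \<infinity>" .
qed simp

lemma exists_dyadic_scale:
  fixes s :: real
  assumes "0 < s" "s \<le> 1"
  shows "\<exists>k. 2 powr (- real k - 1) < s \<and> s \<le> 2 powr (- real k)"
proof -
  define L where "L = - log 2 s"
  have L: "L \<ge> 0" using assms by (simp add: L_def)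
  define k where "k = nat \<lfloor>L\<rfloor>"
  have k: "real k \<le> L" "L < real k + 1" using L by (auto simp: k_def)
  have s: "s = 2 powr (- L)" using assms by (simp add: L_def)
  show ?thesis using k by (intro exI[of _ k]) (auto simp: s)
qed

lemma summable_powr_2:
  fixes a :: real assumes "a < 0" shows "summable (\<lambda>k. 2 powr (real k * a))"
proof -
  have "summable (\<lambda>k. (2 powr a) ^ k)"
    using assms by (intro summable_geometric) (simp add: powr_less_one)
  then show ?thesis by (simp add: powr_realpow[symmetric] powr_powr mult.commute)
qed

text \<open>On the shell 2^(-k-1) < |y| <= 2^(-k) the power is at most \<open>c k\<close>; the
  series is geometric with ratio 2^(q' - n) < 1.\<close>

lemma integrable_powr_near_0:
  fixes q :: real
  assumes "q < real DIM('a::euclidean_space)"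
  shows "integrable lborel (\<lambda>y::'a. indicator (cball 0 1) y * norm y powr (- q))"
proof -
  \<comment> \<open>For negative q the power would increase with |y|; replacing q by
    \<open>q'\<close> makes it decreasing and only enlarges it on the unit ball.\<close>
  define q' where "q' = max q 0"
  have q': "q' \<ge> 0" "q \<le> q'" "q' < real DIM('a)" using assms by (auto simp: q'_def)
  show ?thesis
  proof (rule integrable_dyadic[where c = "\<lambda>k. 2 powr ((real k + 1) * q')" and r = "\<lambda>k. 2 powr (- real k)"])
    fix y :: 'a
    show "indicator (cball 0 1) y * norm y powr - q = 0 \<or>
      (\<exists>k. \<bar>indicator (cball 0 1) y * norm y powr - q\<bar> \<le> 2 powr ((real k + 1) * q') \<and> norm y \<le> 2 powr - real k)"
    proof (cases "y \<noteq> 0 \<and> norm y \<le> 1")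
      case True
      then obtain k where k: "2 powr (- real k - 1) < norm y" "norm y \<le> 2 powr (- real k)"
        using exists_dyadic_scale[of "norm y"] by auto
      have "norm y powr (- q) \<le> norm y powr (- q')"
        using True q' by (intro powr_mono') auto
      also have "\<dots> \<le> (2 powr (- real k - 1)) powr (- q')"
        using True q' k by (intro powr_mono2') auto
      also have "\<dots> = 2 powr ((real k + 1) * q')"
        by (simp add: powr_powr algebra_simps)
      finally show ?thesis using True k by auto
    qed auto
  next
    have "2 powr ((real k + 1) * q') * (2 powr (- real k)) ^ DIM('a) = 2 powr q' * 2 powr (real k * (q' - DIM('a)))" for k
      by (simp add: powr_realpow[symmetric] powr_powr powr_add[symmetric] algebra_simps)
    then show "summable (\<lambda>k. 2 powr ((real k + 1) * q') * (2 powr (- real k)) ^ DIM('a))"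
      using summable_mult[OF summable_powr_2, of "q' - DIM('a)" "2 powr q'"] q' by simp
    have [measurable]: "cball (0::'a) 1 \<in> sets borel" by simp
    have [measurable]: "(norm :: 'a \<Rightarrow> real) \<in> borel_measurable borel"
      by (intro borel_measurable_continuous_onI continuous_intros)
    have [measurable]: "(\<lambda>y::'a. norm y powr - q) \<in> borel_measurable borel"
      by measurable
    show "(\<lambda>y::'a. indicat_real (cball 0 1) y * norm y powr - q) \<in> borel_measurable borel"
      by measurable
  qed auto
qed

lemma integrable_weight:
  fixes p :: real
  assumes "2 * p > real DIM('a::euclidean_space)"
  shows "integrable lborel (\<lambda>y::'a. (1 + (norm y)\<^sup>2) powr (- p))"
proof (rule integrable_dyadic[where c = "\<lambda>k. 2 powr (2 * p) * 2 powr (real k * (- 2 * p))" and r = "\<lambda>k. 2 powr (real k)"])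
  have p: "p > 0" using assms by (smt (verit) DIM_positive of_nat_0_less_iff)
  fix y :: 'a
  \<comment> \<open>The scale s lies in (0, 1] for every y, so the region near the origin needs no
    separate treatment.\<close>
  define s where "s = 1 / sqrt (1 + (norm y)\<^sup>2)"
  have pos: "1 + (norm y)\<^sup>2 > 0" by (simp add: add_pos_nonneg)
  have s1: "sqrt (1 + (norm y)\<^sup>2) \<ge> 1" by simp
  have s: "0 < s" "s \<le> 1" unfolding s_def using s1 pos by (auto simp del: real_sqrt_ge_1_iff)
  from exists_dyadic_scale[OF s] obtain k where k: "2 powr (- real k - 1) < s" "s \<le> 2 powr (- real k)" by blast
  have "(1 + (norm y)\<^sup>2) = s powr (-2)"
    using pos s1 by (simp add: s_def powr_minus powr_divide divide_simps powr_half_sqrt[symmetric] powr_powr)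
  then have eq: "(1 + (norm y)\<^sup>2) powr (- p) = s powr (2 * p)" by (simp add: powr_powr)
  also have "\<dots> \<le> (2 powr (- real k)) powr (2 * p)"
    using s p k by (intro powr_mono2) auto
  also have "\<dots> = 2 powr (real k * (- 2 * p))" by (simp add: powr_powr algebra_simps)
  \<comment> \<open>The radius bound below needs index k + 1, while the value is controlled at index
    k; the factor 2^(2p) in \<open>c\<close> pays for this shift.\<close>
  finally have 1: "(1 + (norm y)\<^sup>2) powr (- p) \<le> 2 powr (real (Suc k) * (- 2 * p)) * 2 powr (2 * p)"
    by (simp add: powr_add[symmetric] algebra_simps)
  have "norm y \<le> sqrt (1 + (norm y)\<^sup>2)" by (rule real_le_rsqrt) simp
  also have "\<dots> = s powr (-1)" using s1 by (simp add: s_def powr_minus divide_simps)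
  also have "\<dots> \<le> (2 powr (- real k - 1)) powr (-1)" using s k by (intro powr_mono2') auto
  also have "\<dots> = 2 powr (real (Suc k))" by (subst powr_powr) (simp add: algebra_simps)
  finally have 2: "norm y \<le> 2 powr (real (Suc k))" .
  show "(1 + (norm y)\<^sup>2) powr (- p) = 0 \<or> (\<exists>k. \<bar>(1 + (norm y)\<^sup>2) powr (- p)\<bar> \<le> 2 powr (2 * p) * 2 powr (real k * (- 2 * p)) \<and> norm y \<le> 2 powr (real k))"
    using 1 2 by (intro disjI2 exI[of _ "Suc k"]) (auto simp: mult_ac)
next
  have *: "2 powr (2 * p) * 2 powr (real k * (- 2 * p)) * (2 powr (real k)) ^ DIM('a) = 2 powr (2 * p) * 2 powr (real k * (DIM('a) - 2 * p))" for k
    by (simp add: powr_realpow[symmetric] powr_powr powr_add[symmetric] algebra_simps)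
  show "summable (\<lambda>k. 2 powr (2 * p) * 2 powr (real k * (- 2 * p)) * (2 powr (real k)) ^ DIM('a))"
    unfolding * using assms by (intro summable_mult summable_powr_2) simp
qed auto

subsection \<open>Near and far parts of the singular integral\<close>

text \<open>The sign is that of -\<Delta>: integrating half of this against |y|^(-n-\<alpha>) gives
  the singular integral, without the first-order term that prevents absolute convergence.\<close>

definition sdiff :: "(real^'n \<Rightarrow> real) \<Rightarrow> real^'n \<Rightarrow> real^'n \<Rightarrow> real" where
  "sdiff w x y = 2 * w x - w (x + y) - w (x - y)"

text \<open>Second differences vanish to order \<beta> at y = 0, locally uniformly in x. For \<beta>
  > \<alpha> this beats the singularity |y|^(-n-\<alpha>).\<close>

definition sdiff_bounded :: "real \<Rightarrow> (real^'n \<Rightarrow> real) \<Rightarrow> bool" where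
  "sdiff_bounded \<beta> w \<longleftrightarrow> continuous_on UNIV w \<and>
     (\<forall>r. \<exists>C. \<forall>x y. norm x \<le> r \<longrightarrow> norm y \<le> r \<longrightarrow> \<bar>sdiff w x y\<bar> \<le> C * norm y powr \<beta>)"

lemma sdiff_0 [simp]: "sdiff w x 0 = 0" by (simp add: sdiff_def)

lemma holder_0_sdiff_bounded:
  assumes "w \<in> C_k_holder_loc 0 \<gamma>" shows "sdiff_bounded \<gamma> w"
  unfolding sdiff_bounded_def
proof (intro conjI allI)
  show "continuous_on UNIV w" using assms by (simp add: C_k_holder_loc_0_iff)
  fix r
  obtain C where C: "\<And>x y. x \<in> cball 0 (2 * r) \<Longrightarrow> y \<in> cball 0 (2 * r) \<Longrightarrow> \<bar>w x - w y\<bar> \<le> C * norm (x - y) powr \<gamma>"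
    using assms compact_cball unfolding C_k_holder_loc_0_iff by metis
  show "\<exists>C. \<forall>x y. norm x \<le> r \<longrightarrow> norm y \<le> r \<longrightarrow> \<bar>sdiff w x y\<bar> \<le> C * norm y powr \<gamma>"
  proof (intro exI[of _ "2 * C"] allI impI)
    fix x y :: "real^'a" assume xy: "norm x \<le> r" "norm y \<le> r"
    have "norm x \<le> 2 * r" "norm (x + y) \<le> 2 * r" "norm (x - y) \<le> 2 * r"
      using xy norm_triangle_ineq[of x y] norm_triangle_ineq4[of x y] norm_ge_zero[of x] by linarith+
    then have "\<bar>w x - w (x + y)\<bar> \<le> C * norm y powr \<gamma>" "\<bar>w x - w (x - y)\<bar> \<le> C * norm y powr \<gamma>"
      using C[of x "x + y"] C[of x "x - y"] by auto
    then show "\<bar>sdiff w x y\<bar> \<le> 2 * C * norm y powr \<gamma>" by (simp add: sdiff_def)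
  qed
qed

text \<open>The function t -> w(x + ty) + w(x - ty) has as derivative y times a difference of
  gradients. The mean value theorem gives one factor |y|, and the Hoelder bound on the gradient
  gives |y|^\<gamma>.\<close>

lemma holder_1_sdiff_bounded:
  assumes w: "w \<in> C_k_holder_loc (Suc 0) \<gamma>" and \<gamma>: "\<gamma> > 0" shows "sdiff_bounded (1 + \<gamma>) w"
  unfolding sdiff_bounded_def
proof (intro conjI allI)
  define g where "g i = partial_deriv i w" for i
  have g: "\<And>i. has_pd i w (g i)" "\<And>i. g i \<in> C_k_holder_loc 0 \<gamma>"
    using w by (auto simp: C_k_holder_loc_Suc_iff g_def)
  then have gc: "continuous_on UNIV (g i)" for i by (simp add: C_k_holder_loc_0_iff)
  show "continuous_on UNIV w" using w by (simp add: C_k_holder_loc_Suc_iff)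
  fix r
  have "\<forall>i. \<exists>C. \<forall>x\<in>cball 0 (2 * r). \<forall>y\<in>cball 0 (2 * r). \<bar>g i x - g i y\<bar> \<le> C * norm (x - y) powr \<gamma>"
    using g(2) compact_cball unfolding C_k_holder_loc_0_iff by metis
  then obtain C where C: "\<And>i x y. x \<in> cball 0 (2 * r) \<Longrightarrow> y \<in> cball 0 (2 * r) \<Longrightarrow> \<bar>g i x - g i y\<bar> \<le> C i * norm (x - y) powr \<gamma>"
    by metis
  show "\<exists>C. \<forall>x y. norm x \<le> r \<longrightarrow> norm y \<le> r \<longrightarrow> \<bar>sdiff w x y\<bar> \<le> C * norm y powr (1 + \<gamma>)"
  proof (intro exI[of _ "\<Sum>i\<in>UNIV. \<bar>C i\<bar> * 2 powr \<gamma>"] allI impI)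
    fix x y :: "real^'a" assume xy: "norm x \<le> r" "norm y \<le> r"
    define \<phi> where "\<phi> t = w (x + t *\<^sub>R y) + w (x + t *\<^sub>R (- y))" for t
    define \<phi>' where "\<phi>' t = (\<Sum>i\<in>UNIV. y $ i * g i (x + t *\<^sub>R y)) + (\<Sum>i\<in>UNIV. (- y) $ i * g i (x + t *\<^sub>R (- y)))" for t
    have "(\<phi> has_real_derivative \<phi>' t) (at t)" for t
      unfolding \<phi>_def[abs_def] \<phi>'_def by (intro DERIV_add has_real_derivative_along_line g gc)
    then obtain t where t: "0 < t" "t < 1" "\<phi> 1 - \<phi> 0 = (1 - 0) * \<phi>' t"
      using MVT2[of 0 1 \<phi> \<phi>'] by auto
    have sd: "sdiff w x y = - \<phi>' t" using t(3) by (simp add: sdiff_def \<phi>_def)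
    have "norm (t *\<^sub>R y) \<le> norm y" using t by (simp add: mult_left_le_one_le)
    then have nn: "norm (x + t *\<^sub>R y) \<le> 2 * r" "norm (x + t *\<^sub>R (- y)) \<le> 2 * r"
      using xy norm_triangle_ineq[of x "t *\<^sub>R y"] norm_triangle_ineq4[of x "t *\<^sub>R y"] by auto
    have "\<phi>' t = (\<Sum>i\<in>UNIV. y $ i * (g i (x + t *\<^sub>R y) - g i (x + t *\<^sub>R (- y))))"
      by (simp add: \<phi>'_def sum.distrib[symmetric] algebra_simps)
    also have "\<bar>\<dots>\<bar> \<le> (\<Sum>i\<in>UNIV. \<bar>C i\<bar> * 2 powr \<gamma> * norm y powr (1 + \<gamma>))"
    proof (intro sum_abs[THEN order_trans] sum_mono)
      fix i
      \<comment> \<open>The two points are 2ty apart with t < 1, whence the factor 2^\<gamma> in the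
        constant.\<close>
      have "(x + t *\<^sub>R y) - (x + t *\<^sub>R (- y)) = (2 * t) *\<^sub>R y" by (simp add: vec_eq_iff)
      then have "\<bar>g i (x + t *\<^sub>R y) - g i (x + t *\<^sub>R (- y))\<bar> \<le> C i * norm ((2 * t) *\<^sub>R y) powr \<gamma>"
        using C[of "x + t *\<^sub>R y" "x + t *\<^sub>R (- y)" i] nn by simp
      also have "\<dots> \<le> \<bar>C i\<bar> * (2 * norm y) powr \<gamma>"
        using t \<gamma> by (intro mult_mono powr_mono2) (auto intro!: mult_right_mono mult_left_le_one_le)
      also have "\<dots> = \<bar>C i\<bar> * 2 powr \<gamma> * norm y powr \<gamma>" by (simp add: powr_mult)
      finally have "\<bar>y $ i * (g i (x + t *\<^sub>R y) - g i (x + t *\<^sub>R (- y)))\<bar> \<le> norm y * (\<bar>C i\<bar> * 2 powr \<gamma> * norm y powr \<gamma>)"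
        unfolding abs_mult by (intro mult_mono component_le_norm_cart) auto
      also have "\<dots> = \<bar>C i\<bar> * 2 powr \<gamma> * norm y powr (1 + \<gamma>)"
        by (cases "y = 0") (auto simp: powr_add)
      finally show "\<bar>y $ i * (g i (x + t *\<^sub>R y) - g i (x + t *\<^sub>R (- y)))\<bar> \<le> \<bar>C i\<bar> * 2 powr \<gamma> * norm y powr (1 + \<gamma>)" .
    qed
    finally show "\<bar>sdiff w x y\<bar> \<le> (\<Sum>i\<in>UNIV. \<bar>C i\<bar> * 2 powr \<gamma>) * norm y powr (1 + \<gamma>)"
      unfolding sd by (simp add: sum_distrib_right)
  qed
qed

lemma sdiff_boundedE:
  assumes "sdiff_bounded \<beta> w"
  obtains C where "\<And>r. C r \<ge> 0" "\<And>r x y. norm x \<le> r \<Longrightarrow> norm y \<le> r \<Longrightarrow> \<bar>sdiff w x y\<bar> \<le> C r * norm y powr \<beta>"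
proof -
  obtain C where C: "\<And>r x y. norm x \<le> r \<Longrightarrow> norm y \<le> r \<Longrightarrow> \<bar>sdiff w x y\<bar> \<le> C r * norm y powr \<beta>"
    using assms unfolding sdiff_bounded_def by metis
  show thesis
  proof (rule that[of "\<lambda>r. \<bar>C r\<bar>"])
    fix r :: real and x y :: "real^'a" assume "norm x \<le> r" "norm y \<le> r"
    from C[OF this] show "\<bar>sdiff w x y\<bar> \<le> \<bar>C r\<bar> * norm y powr \<beta>"
      by (rule order_trans) (intro mult_right_mono, auto)
  qed simp
qed

lemma sdiff_bounded_continuous: "sdiff_bounded \<beta> w \<Longrightarrow> continuous_on UNIV w"
  by (simp add: sdiff_bounded_def)

lemma continuous_borel_measurable: "continuous_on UNIV w \<Longrightarrow> w \<in> borel_measurable borel"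
  by (rule borel_measurable_continuous_onI)

lemma continuous_sdiff:
  assumes "continuous_on UNIV w"
  shows "continuous_on UNIV (sdiff w x)" "continuous_on UNIV (\<lambda>x. sdiff w x y)"
  unfolding sdiff_def[abs_def]
  by (auto intro!: continuous_intros continuous_on_compose2[OF assms])

text \<open>The origin is exempt because \<open>0 powr a\<close> is 0, so the bound there would
  force \<open>k 0 = 0\<close>. Nothing is lost, as \<open>sdiff w x 0\<close> is 0.\<close>

definition near_kernel :: "real \<Rightarrow> (real^'n \<Rightarrow> real) \<Rightarrow> bool" where
  "near_kernel q k \<longleftrightarrow> k \<in> borel_measurable borel \<and>
     (\<exists>B. \<forall>y. y \<noteq> 0 \<longrightarrow> \<bar>k y\<bar> \<le> B * (indicator (cball 0 1) y * norm y powr (- q)))"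

definition near :: "(real^'n \<Rightarrow> real) \<Rightarrow> (real^'n \<Rightarrow> real) \<Rightarrow> real^'n \<Rightarrow> real" where
  "near k w x = (\<integral>y. sdiff w x y * k y \<partial>lborel)"

text \<open>The order \<beta> of vanishing offsets the order q of the singularity and leaves
  |y|^(\<beta>-q) on the unit ball, integrable since q - \<beta> < n.\<close>

lemma near_dominated:
  assumes w: "sdiff_bounded \<beta> w" and k: "near_kernel q k" and q: "q < real CARD('n) + \<beta>"
  obtains g where "\<And>r. integrable lborel (g r)" "\<And>r x y::real^'n. norm x \<le> r \<Longrightarrow> \<bar>sdiff w x y * k y\<bar> \<le> g r y"
proof -
  obtain C where C: "\<And>r. C r \<ge> 0" "\<And>r x y. norm x \<le> r \<Longrightarrow> norm y \<le> r \<Longrightarrow> \<bar>sdiff w x y\<bar> \<le> C r * norm y powr \<beta>"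
    using sdiff_boundedE[OF w] by blast
  obtain B where B: "\<And>y. y \<noteq> 0 \<Longrightarrow> \<bar>k y\<bar> \<le> B * (indicator (cball 0 1) y * norm y powr (- q))"
    using k unfolding near_kernel_def by blast
  \<comment> \<open>A single constant must cover |x| <= r and |y| <= 1, hence
    \<open>max r 1\<close>.\<close>
  define g where "g r y = C (max r 1) * B * (indicator (cball 0 1) y * norm y powr (- (q - \<beta>)))" for r and y :: "real^'n"
  show thesis
  proof (rule that)
    show "integrable lborel (g r)" for r
      unfolding g_def using q by (intro integrable_mult_right integrable_powr_near_0) auto
    fix r and x y :: "real^'n" assume x: "norm x \<le> r"
    show "\<bar>sdiff w x y * k y\<bar> \<le> g r y"
    proof (cases "y = 0")
      case False
      note By = B[OF False]
      show ?thesis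
      proof (cases "norm y \<le> 1")
        case True
        have "\<bar>sdiff w x y * k y\<bar> \<le> (C (max r 1) * norm y powr \<beta>) * (B * (indicator (cball 0 1) y * norm y powr (- q)))"
          unfolding abs_mult using x True by (intro mult_mono C B False) (auto intro!: C(1) mult_nonneg_nonneg)
        also have "\<dots> = C (max r 1) * B * (indicator (cball 0 1) y * (norm y powr \<beta> * norm y powr (- q)))" by simp
        also have "norm y powr \<beta> * norm y powr (- q) = norm y powr (- (q - \<beta>))"
          by (simp add: powr_add[symmetric])
        finally show ?thesis by (simp add: g_def)
      qed (use By in \<open>auto simp: g_def\<close>)
    qed (simp add: g_def)
  qed
qed

lemma near_integrable:
  assumes w: "sdiff_bounded \<beta> w" and k: "near_kernel q k" and q: "q < real CARD('n) + \<beta>"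
  shows "integrable lborel (\<lambda>y::real^'n. sdiff w x y * k y)"
proof -
  obtain g where g: "\<And>r. integrable lborel (g r)" "\<And>r x y::real^'n. norm x \<le> r \<Longrightarrow> \<bar>sdiff w x y * k y\<bar> \<le> g r y"
    using near_dominated[OF assms] by blast
  have [measurable]: "k \<in> borel_measurable borel" "sdiff w x \<in> borel_measurable borel"
    using k continuous_borel_measurable[OF continuous_sdiff(1)[OF sdiff_bounded_continuous[OF w]]]
    by (auto simp: near_kernel_def)
  show ?thesis
    by (rule Bochner_Integration.integrable_bound[OF g(1)[of "norm x"]])
      (use g(2)[of x "norm x"] in \<open>auto intro!: AE_I2 order_trans[OF _ abs_ge_self]\<close>)
qed

lemma near_continuous:
  assumes w: "sdiff_bounded \<beta> w" and k: "near_kernel q k" and q: "q < real CARD('n) + \<beta>"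
  shows "continuous_on UNIV (near k w :: real^'n \<Rightarrow> real)"
proof -
  obtain g where g: "\<And>r. integrable lborel (g r)" "\<And>r x y::real^'n. norm x \<le> r \<Longrightarrow> \<bar>sdiff w x y * k y\<bar> \<le> g r y"
    using near_dominated[OF assms] by blast
  show ?thesis unfolding near_def[abs_def]
    by (rule continuous_on_integral_dominated[where g = g])
      (use near_integrable[OF assms] continuous_sdiff(2)[OF sdiff_bounded_continuous[OF w]] g in
        \<open>auto intro!: continuous_intros\<close>)
qed

lemma has_pd_sdiff:
  assumes "has_pd i w w'" shows "has_pd i (\<lambda>x. sdiff w x y) (\<lambda>x. sdiff w' x y)"
proof -
  have "has_pd i (\<lambda>x. 2 * w x + ((-1) * w (x + y) + (-1) * w (x + - y)))
     (\<lambda>x. 2 * w' x + ((-1) * w' (x + y) + (-1) * w' (x + - y)))"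
    by (intro has_pd_add has_pd_cmult has_pd_shift assms)
  then show ?thesis by (simp add: sdiff_def algebra_simps)
qed

lemma near_has_pd:
  assumes w: "sdiff_bounded \<beta> w" "sdiff_bounded \<beta> w'" "has_pd i w w'" and k: "near_kernel q k" and q: "q < real CARD('n) + \<beta>"
  shows "has_pd i (near k w :: real^'n \<Rightarrow> real) (near k w')"
proof -
  obtain g where g: "\<And>r. integrable lborel (g r)" "\<And>r x y::real^'n. norm x \<le> r \<Longrightarrow> \<bar>sdiff w' x y * k y\<bar> \<le> g r y"
    using near_dominated[OF w(2) k q] by blast
  show ?thesis unfolding near_def[abs_def]
  proof (rule has_pd_integral_dominated[where g = g])
    fix y
    show "has_pd i (\<lambda>x. sdiff w x y * k y) (\<lambda>x. sdiff w' x y * k y)"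
      using has_pd_cmult[OF has_pd_sdiff[OF w(3), of y], of "k y"] by (simp add: mult.commute)
  qed (use g near_integrable[OF w(1) k q] in auto)
qed

lemma holder_sdiff_bounded:
  assumes "0 < \<gamma>" "\<gamma> \<le> 1" "a \<le> 1" "w \<in> C_k_holder_loc (k + a) \<gamma>"
  shows "sdiff_bounded (real a + \<gamma>) w"
proof -
  have "w \<in> C_k_holder_loc a \<gamma>" using C_k_holder_loc_mono[OF assms(1,2) _ assms(4)] by simp
  moreover have "a = 0 \<or> a = Suc 0" using assms(3) by auto
  ultimately show ?thesis using holder_0_sdiff_bounded holder_1_sdiff_bounded assms(1) by fastforce
qed

text \<open>Second differences commute with partial derivatives. Each of the N derivatives uses up
  one order of w, while a + \<gamma> orders stay in reserve to control the singularity.\<close>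

lemma near_C_k:
  assumes \<gamma>: "0 < \<gamma>" "\<gamma> \<le> 1" and a: "a \<le> 1" and k: "near_kernel q k" and q: "q < real CARD('n) + (real a + \<gamma>)"
  shows "w \<in> C_k_holder_loc (N + a) \<gamma> \<Longrightarrow> (near k w :: real^'n \<Rightarrow> real) \<in> C_k N"
proof (induction N arbitrary: w)
  case 0
  then show ?case using near_continuous[OF holder_sdiff_bounded[OF \<gamma> a 0] k q] by (simp add: C_k_0_iff)
next
  case (Suc N)
  have pd: "has_pd i w (partial_deriv i w)" "partial_deriv i w \<in> C_k_holder_loc (N + a) \<gamma>" for i
    using Suc.prems by (auto simp: C_k_holder_loc_Suc_iff)
  have sw: "sdiff_bounded (real a + \<gamma>) w" using holder_sdiff_bounded[OF \<gamma> a Suc.prems] .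
  show ?case
  proof (rule C_k_SucI)
    show "continuous_on UNIV (near k w)" by (rule near_continuous[OF sw k q])
    show "has_pd i (near k w) (near k (partial_deriv i w))" for i
      by (rule near_has_pd[OF sw holder_sdiff_bounded[OF \<gamma> a pd(2)] pd(1) k q])
    show "near k (partial_deriv i w) \<in> C_k N" for i by (rule Suc.IH[OF pd(2)])
  qed
qed

section \<open>Kernels with decaying derivatives, and a C^N extension of the power kernel\<close>

definition decay_0 :: "real \<Rightarrow> (real^'n \<Rightarrow> real) \<Rightarrow> bool" where
  "decay_0 q k \<longleftrightarrow> continuous_on UNIV k \<and> (\<exists>C\<ge>0. \<forall>y. \<bar>k y\<bar> \<le> C * (1 + (norm y)\<^sup>2) powr (- q))"

text \<open>No faster decay is asked of derivatives: the common rate q is what dominated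
  differentiation of a convolution uses. As the weight is in terms of |y|^2, the exponent q means
  order 2q in |y|.\<close>

primrec decay :: "nat \<Rightarrow> real \<Rightarrow> (real^'n \<Rightarrow> real) \<Rightarrow> bool" where
  "decay 0 q k \<longleftrightarrow> decay_0 q k"
| "decay (Suc N) q k \<longleftrightarrow> decay_0 q k \<and> (\<forall>i. \<exists>k'. has_pd i k k' \<and> decay N q k')"

lemma decay_imp_decay_0: "decay N q k \<Longrightarrow> decay_0 q k"
  by (cases N) auto

lemma decay_Suc_imp: "decay (Suc N) q k \<Longrightarrow> decay N q k"
proof (induction N arbitrary: k)
  case (Suc N)
  then show ?case by (subst decay.simps) (metis decay.simps(2))
qed simp

lemma decay_0_mono:
  assumes "decay_0 q k" "r \<le> q" shows "decay_0 r k"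
proof -
  obtain C where C: "C \<ge> 0" "\<And>y. \<bar>k y\<bar> \<le> C * (1 + (norm y)\<^sup>2) powr (- q)"
    using assms by (auto simp: decay_0_def)
  have "\<bar>k y\<bar> \<le> C * (1 + (norm y)\<^sup>2) powr (- r)" for y
    using C(1) assms(2) by (intro order_trans[OF C(2)] mult_left_mono powr_mono) auto
  with C(1) assms(1) show ?thesis by (auto simp: decay_0_def)
qed

lemma decay_mono: "decay N q k \<Longrightarrow> r \<le> q \<Longrightarrow> decay N r k"
  by (induction N arbitrary: k) (auto intro: decay_0_mono, blast intro: decay_0_mono)

lemma decay_0_add:
  assumes "decay_0 q k" "decay_0 q l" shows "decay_0 q (\<lambda>y. k y + l y)"
proof -
  obtain C where C: "C \<ge> 0" "\<And>y. \<bar>k y\<bar> \<le> C * (1 + (norm y)\<^sup>2) powr (- q)"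
    using assms by (auto simp: decay_0_def)
  obtain D where D: "D \<ge> 0" "\<And>y. \<bar>l y\<bar> \<le> D * (1 + (norm y)\<^sup>2) powr (- q)"
    using assms by (auto simp: decay_0_def)
  have "\<bar>k y + l y\<bar> \<le> (C + D) * (1 + (norm y)\<^sup>2) powr (- q)" for y
    using C(2)[of y] D(2)[of y] by (simp add: distrib_right)
  then show ?thesis using assms C(1) D(1) unfolding decay_0_def
    by (intro conjI exI[of _ "C + D"]) (auto intro!: continuous_intros)
qed

lemma decay_0_cmult:
  assumes "decay_0 q k" shows "decay_0 q (\<lambda>y. c * k y)"
proof -
  obtain C where C: "C \<ge> 0" "\<And>y. \<bar>k y\<bar> \<le> C * (1 + (norm y)\<^sup>2) powr (- q)"
    using assms by (auto simp: decay_0_def)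
  have "\<bar>c * k y\<bar> \<le> (\<bar>c\<bar> * C) * (1 + (norm y)\<^sup>2) powr (- q)" for y
    using mult_left_mono[OF C(2)[of y] abs_ge_zero[of c]] by (simp add: abs_mult mult.assoc)
  then show ?thesis using assms C(1) unfolding decay_0_def
    by (intro conjI exI[of _ "\<bar>c\<bar> * C"]) (auto intro!: continuous_intros)
qed

text \<open>A coordinate is at most (1 + |y|^2)^(1/2), which costs 1/2 in the exponent.\<close>

lemma decay_0_coord:
  assumes "decay_0 q k" shows "decay_0 (q - 1/2) (\<lambda>y. y $ i * k y)"
proof -
  obtain C where C: "C \<ge> 0" "\<And>y. \<bar>k y\<bar> \<le> C * (1 + (norm y)\<^sup>2) powr (- q)"
    using assms by (auto simp: decay_0_def)
  have "\<bar>y $ i * k y\<bar> \<le> C * (1 + (norm y)\<^sup>2) powr (- (q - 1/2))" for y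
  proof -
    have "\<bar>y $ i\<bar> \<le> sqrt (1 + (norm y)\<^sup>2)"
      by (rule order_trans[OF component_le_norm_cart]) (rule real_le_rsqrt, simp)
    also have "\<dots> = (1 + (norm y)\<^sup>2) powr (1/2)" by (simp add: powr_half_sqrt)
    finally have "\<bar>y $ i * k y\<bar> \<le> (1 + (norm y)\<^sup>2) powr (1/2) * (C * (1 + (norm y)\<^sup>2) powr (- q))"
      unfolding abs_mult by (intro mult_mono C(2)) auto
    also have "\<dots> = C * ((1 + (norm y)\<^sup>2) powr (1/2) * (1 + (norm y)\<^sup>2) powr (- q))" by simp
    also have "(1 + (norm y)\<^sup>2) powr (1/2) * (1 + (norm y)\<^sup>2) powr (- q) = (1 + (norm y)\<^sup>2) powr (- (q - 1/2))"
      by (simp add: powr_add[symmetric])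
    finally show ?thesis .
  qed
  then show ?thesis using assms C(1) unfolding decay_0_def
    by (intro conjI exI[of _ C]) (auto intro!: continuous_intros)
qed

lemma decay_add: "decay N q k \<Longrightarrow> decay N q l \<Longrightarrow> decay N q (\<lambda>y. k y + l y)"
proof (induction N arbitrary: k l)
  case (Suc N)
  show ?case unfolding decay.simps
  proof (intro conjI allI)
    show "decay_0 q (\<lambda>y. k y + l y)" using Suc.prems by (intro decay_0_add) auto
    fix i
    obtain k' l' where "has_pd i k k'" "decay N q k'" "has_pd i l l'" "decay N q l'"
      using Suc.prems by (meson decay.simps(2))
    then show "\<exists>m. has_pd i (\<lambda>y. k y + l y) m \<and> decay N q m"
      using Suc.IH has_pd_add by blast
  qed
qed (simp add: decay_0_add)

lemma decay_cmult: "decay N q k \<Longrightarrow> decay N q (\<lambda>y. c * k y)"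
proof (induction N arbitrary: k)
  case (Suc N)
  show ?case unfolding decay.simps
  proof (intro conjI allI)
    show "decay_0 q (\<lambda>y. c * k y)" using Suc.prems by (intro decay_0_cmult) auto
    fix i
    obtain k' where "has_pd i k k'" "decay N q k'" using Suc.prems by (meson decay.simps(2))
    then show "\<exists>m. has_pd i (\<lambda>y. c * k y) m \<and> decay N q m"
      using Suc.IH has_pd_cmult by blast
  qed
qed (simp add: decay_0_cmult)

lemma decay_coord: "decay N q k \<Longrightarrow> decay N (q - 1/2) (\<lambda>y. y $ i * k y)"
proof (induction N arbitrary: k)
  case (Suc N)
  show ?case unfolding decay.simps
  proof (intro conjI allI)
    show "decay_0 (q - 1/2) (\<lambda>y. y $ i * k y)" using Suc.prems by (intro decay_0_coord) auto
    fix j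
    obtain k' where k': "has_pd j k k'" "decay N q k'" using Suc.prems by (meson decay.simps(2))
    have "decay N (q - 1/2) (\<lambda>y. (if j = i then 1 else 0) * k y + y $ i * k' y)"
      by (intro decay_add decay_cmult Suc.IH k' decay_mono[OF decay_Suc_imp[OF Suc.prems]]) simp
    with has_pd_mult[OF has_pd_coord k'(1)]
    show "\<exists>m. has_pd j (\<lambda>y. y $ i * k y) m \<and> decay N (q - 1/2) m" by blast
  qed
qed (simp add: decay_0_coord)

text \<open>\<open>s powr (- p)\<close> for \<open>s > 1\<close>, continued to \<open>s \<le> 1\<close> by its Taylor polynomial at \<open>1\<close> with \<open>N\<close> terms;
  evaluated at \<open>(norm y)\<^sup>2\<close> it replaces a smooth cutoff of the kernel, and differentiation stays in
  the family.\<close>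

definition power_profile :: "real \<Rightarrow> nat \<Rightarrow> real \<Rightarrow> real" where
  "power_profile p N s = (if s \<le> 1 then (\<Sum>j<N. ((- p) gchoose j) * (s - 1) ^ j) else s powr (- p))"

text \<open>At s = 1 the polynomial branch is in force; it equals 1 there only if the constant term
  is present, hence \<open>Suc N\<close>.\<close>

lemma power_profile_ge_1:
  assumes "s \<ge> 1" shows "power_profile p (Suc N) s = s powr (- p)"
proof (cases "s = 1")
  case True
  have "(\<Sum>j<Suc N. ((- p) gchoose j) * (0::real) ^ j) = 1"
    by (subst lessThan_Suc_atMost, subst sum.atMost_shift) (simp add: gbinomial_0)
  with True show ?thesis by (simp add: power_profile_def)
qed (use assms in \<open>simp add: power_profile_def\<close>)

lemma continuous_on_power_profile: "continuous_on UNIV (power_profile p (Suc N))"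
proof -
  have "continuous_on UNIV (\<lambda>s. if s \<le> 1 then (\<Sum>j<Suc N. ((- p) gchoose j) * (s - 1) ^ j) else s powr (- p))"
    using power_profile_ge_1[of 1 p N]
    by (intro continuous_on_cases_le[where h = "\<lambda>x. x"]) (auto intro!: continuous_intros simp: power_profile_def)
  then show ?thesis by (simp add: power_profile_def[abs_def])
qed

lemma has_real_derivative_glue:
  fixes f :: "real \<Rightarrow> real"
  assumes "(f has_real_derivative D) (at x within {..x})" "(f has_real_derivative D) (at x within {x..})"
  shows "(f has_real_derivative D) (at x)"
proof -
  have "{..x} \<union> {x..} = UNIV" by auto
  then show ?thesis using assms Lim_Un[of _ D x "{..x}" "{x..}"] unfolding has_field_derivative_iff by simp
qed

text \<open>Absorption, (j + 1) binom(-p, j + 1) = -p binom(-p - 1, j), shows that the derivative of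
  the Taylor polynomial belongs to p + 1 with one term fewer, matching the derivative of the power.
  At s = 1 the one-sided derivatives are glued.\<close>

lemma power_profile_deriv:
  "(power_profile p (Suc (Suc N)) has_real_derivative - p * power_profile (p + 1) (Suc N) s) (at s)"
proof -
  let ?f = "power_profile p (Suc (Suc N))" and ?f' = "\<lambda>s. - p * power_profile (p + 1) (Suc N) s"
  have poly: "((\<lambda>s. \<Sum>j<Suc (Suc N). ((- p) gchoose j) * (s - 1) ^ j) has_real_derivative ?f' s) (at s)"
    if "s \<le> 1" for s
  proof -
    have "((\<lambda>s. \<Sum>j<Suc (Suc N). ((- p) gchoose j) * (s - 1) ^ j) has_real_derivative
        (\<Sum>j<Suc (Suc N). ((- p) gchoose j) * (real j * (s - 1) ^ (j - 1)))) (at s)"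
      by (intro DERIV_sum DERIV_cmult) (auto intro!: derivative_eq_intros)
    also have "(\<Sum>j<Suc (Suc N). ((- p) gchoose j) * (real j * (s - 1) ^ (j - 1))) =
        (\<Sum>j<Suc N. ((- p) gchoose Suc j) * (real (Suc j) * (s - 1) ^ j))"
      by (subst sum.lessThan_Suc_shift) simp
    also have "\<dots> = (\<Sum>j<Suc N. (- p) * (((- (p + 1)) gchoose j) * (s - 1) ^ j))"
    proof (intro sum.cong refl)
      fix j
      have "- (p + 1) = - p - 1" by simp
      then show "((- p) gchoose Suc j) * (real (Suc j) * (s - 1) ^ j) = (- p) * (((- (p + 1)) gchoose j) * (s - 1) ^ j)"
        using gbinomial_absorption[of j "- p"] by (metis mult.assoc mult.commute)
    qed
    also have "\<dots> = ?f' s" using that unfolding power_profile_def by (simp only: sum_distrib_left if_True)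
    finally show ?thesis .
  qed
  have pow: "((\<lambda>s. s powr (- p)) has_real_derivative ?f' s) (at s)" if "s \<ge> 1" for s
  proof -
    have e: "- (p + 1) = - p - 1" by simp
    show ?thesis unfolding power_profile_ge_1[OF that] e
      by (rule has_real_derivative_powr) (use that in simp)
  qed
  consider "s < 1" | "s = 1" | "s > 1" by linarith
  then show ?thesis
  proof cases
    case 1
    show ?thesis
      by (rule has_field_derivative_transform_within_open[OF poly, of s "{..<1}"]) (use 1 in \<open>auto simp: power_profile_def\<close>)
  next
    case 3
    show ?thesis
      by (rule has_field_derivative_transform_within_open[OF pow, of s "{1<..}"]) (use 3 in \<open>auto simp: power_profile_ge_1\<close>)
  next
    case 2
    show ?thesis
    proof (rule has_real_derivative_glue)
      show "(?f has_real_derivative ?f' s) (at s within {..s})"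
        by (rule has_field_derivative_transform_within[OF has_field_derivative_at_within[OF poly], where d = 1])
          (use 2 in \<open>auto simp: power_profile_def\<close>)
      show "(?f has_real_derivative ?f' s) (at s within {s..})"
        by (rule has_field_derivative_transform_within[OF has_field_derivative_at_within[OF pow], where d = 1])
          (use 2 in \<open>auto simp: power_profile_ge_1\<close>)
    qed
  qed
qed

lemma decay_0_power_profile:
  assumes p: "p > 0"
  shows "decay_0 p (\<lambda>y::real^'n. power_profile p (Suc N) ((norm y)\<^sup>2))"
  unfolding decay_0_def
proof (intro conjI)
  show "continuous_on UNIV (\<lambda>y::real^'n. power_profile p (Suc N) ((norm y)\<^sup>2))"
    by (intro continuous_on_compose2[OF continuous_on_power_profile] continuous_intros) auto
  have "compact (power_profile p (Suc N) ` {0..1})"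
    by (intro compact_continuous_image continuous_on_subset[OF continuous_on_power_profile]) auto
  then obtain B where B: "\<And>s. 0 \<le> s \<Longrightarrow> s \<le> 1 \<Longrightarrow> \<bar>power_profile p (Suc N) s\<bar> \<le> B"
    using compact_imp_bounded bounded_iff by (metis atLeastAtMost_iff imageI real_norm_def)
  have B0: "B \<ge> 0" using B[of 0] by simp
  \<comment> \<open>The factor 2^p compares both 1 (for s <= 1) and s (for s > 1) with (1 + s) / 2;
    B + 1 >= 1 serves both ranges.\<close>
  define C where "C = (B + 1) * 2 powr p"
  have "\<bar>power_profile p (Suc N) s\<bar> \<le> C * (1 + s) powr (- p)" if s: "s \<ge> 0" for s
  proof (cases "s \<le> 1")
    case True
    have "\<bar>power_profile p (Suc N) s\<bar> \<le> (B + 1) * 1" using B[OF s True] by simp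
    also have "\<dots> \<le> (B + 1) * (2 / (1 + s)) powr p"
      using s True p B0 by (intro mult_left_mono ge_one_powr_ge_zero) auto
    also have "\<dots> = C * (1 + s) powr (- p)"
      using s by (simp add: C_def powr_divide powr_minus divide_simps)
    finally show ?thesis .
  next
    case False
    have "\<bar>power_profile p (Suc N) s\<bar> = s powr (- p)" using False by (simp add: power_profile_ge_1)
    also have "\<dots> \<le> ((1 + s) / 2) powr (- p)" using False p by (intro powr_mono2') auto
    also have "\<dots> = 1 * 2 powr p * (1 + s) powr (- p)"
      using s by (simp add: powr_divide powr_minus divide_simps)
    also have "\<dots> \<le> C * (1 + s) powr (- p)" unfolding C_def using B0 by (intro mult_right_mono) auto
    finally show ?thesis .
  qed
  moreover have "C \<ge> 0" using B0 by (simp add: C_def)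
  ultimately show "\<exists>C\<ge>0. \<forall>y::real^'n. \<bar>power_profile p (Suc N) ((norm y)\<^sup>2)\<bar> \<le> C * (1 + (norm y)\<^sup>2) powr (- p)"
    by (intro exI[of _ C]) auto
qed

text \<open>Differentiating raises p by 1 and brings in a coordinate, which costs 1/2. The net gain
  of 1/2 is given away to keep the rate p.\<close>

lemma decay_power_profile:
  "p > 0 \<Longrightarrow> decay N p (\<lambda>y::real^'n. power_profile p (Suc N) ((norm y)\<^sup>2))"
proof (induction N arbitrary: p)
  case 0
  then show ?case using decay_0_power_profile[of p 0] by simp
next
  case (Suc N)
  show ?case unfolding decay.simps
  proof (intro conjI allI)
    fix i :: 'n
    let ?k = "\<lambda>y::real^'n. power_profile (p + 1) (Suc N) ((norm y)\<^sup>2)"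
    have "has_pd i (\<lambda>y::real^'n. power_profile p (Suc (Suc N)) ((norm y)\<^sup>2)) (\<lambda>y. - p * ?k y * (2 * y $ i))"
      by (rule has_pd_comp[OF has_pd_norm_square power_profile_deriv])
    also have "(\<lambda>y. - p * ?k y * (2 * y $ i)) = (\<lambda>y. (- 2 * p) * (y $ i * ?k y))"
      by (rule ext) simp
    finally have 1: "has_pd i (\<lambda>y::real^'n. power_profile p (Suc (Suc N)) ((norm y)\<^sup>2)) (\<lambda>y. (- 2 * p) * (y $ i * ?k y))" .
    have "decay N (p + 1) ?k" using Suc.prems by (intro Suc.IH) simp
    then have "decay N (p + 1 - 1/2) (\<lambda>y. (- 2 * p) * (y $ i * ?k y))"
      by (intro decay_cmult decay_coord)
    then have 2: "decay N p (\<lambda>y. (- 2 * p) * (y $ i * ?k y))"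
      by (rule decay_mono) simp
    show "\<exists>m. has_pd i (\<lambda>y::real^'n. power_profile p (Suc (Suc N)) ((norm y)\<^sup>2)) m \<and> decay N p m"
      by (intro exI conjI) (rule 1, rule 2)
  next
    show "decay_0 p (\<lambda>y::real^'n. power_profile p (Suc (Suc N)) ((norm y)\<^sup>2))"
      by (rule decay_0_power_profile[OF Suc.prems])
  qed
qed

lemma weight_shift:
  fixes x z :: "real^'n"
  assumes "p \<ge> 0"
  shows "(1 + (norm (x - z))\<^sup>2) powr (- p) \<le> (2 * (1 + (norm x)\<^sup>2)) powr p * (1 + (norm z)\<^sup>2) powr (- p)"
proof -
  have "norm z \<le> norm x + norm (x - z)" using norm_triangle_ineq4[of x "x - z"] by simp
  then have "(norm z)\<^sup>2 \<le> (norm x + norm (x - z))\<^sup>2" by (intro power_mono) auto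
  also have "\<dots> \<le> 2 * (norm x)\<^sup>2 + 2 * (norm (x - z))\<^sup>2"
    using sum_squares_bound[of "norm x" "norm (x - z)"] by (simp add: power2_sum)
  \<comment> \<open>This is Peetre's inequality; it moves the weight from x - z to z at the cost of
    a factor depending on x.\<close>
  finally have "1 + (norm z)\<^sup>2 \<le> 2 * (1 + (norm x)\<^sup>2) * (1 + (norm (x - z))\<^sup>2)"
    using mult_nonneg_nonneg[of "(norm x)\<^sup>2" "(norm (x - z))\<^sup>2"]
    unfolding distrib_left distrib_right mult_1_left mult_1_right mult.assoc
    by (auto simp del: zero_le_mult_iff mult_nonneg_nonneg)
  moreover have pos: "1 + (norm z)\<^sup>2 > 0" "1 + (norm x)\<^sup>2 > 0" "1 + (norm (x - z))\<^sup>2 > 0"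
    by (auto simp: add_pos_nonneg)
  ultimately have "(1 + (norm z)\<^sup>2) / (2 * (1 + (norm x)\<^sup>2)) \<le> 1 + (norm (x - z))\<^sup>2"
    by (simp add: divide_simps mult_ac)
  then have "(1 + (norm (x - z))\<^sup>2) powr (- p) \<le> ((1 + (norm z)\<^sup>2) / (2 * (1 + (norm x)\<^sup>2))) powr (- p)"
    using pos assms by (intro powr_mono2') auto
  also have "\<dots> = (2 * (1 + (norm x)\<^sup>2)) powr p * (1 + (norm z)\<^sup>2) powr (- p)"
    using pos by (simp add: powr_divide powr_minus divide_simps)
  finally show ?thesis .
qed

text \<open>As x occurs only in the kernel, derivatives fall on k, and w has only to be integrable
  against the weight.\<close>

definition far :: "(real^'n \<Rightarrow> real) \<Rightarrow> (real^'n \<Rightarrow> real) \<Rightarrow> real^'n \<Rightarrow> real" where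
  "far k w x = (\<integral>z. w z * k (x - z) \<partial>lborel)"

lemma far_dominated:
  fixes w k :: "real^'n \<Rightarrow> real"
  assumes p: "p \<ge> 0" and w: "integrable lborel (\<lambda>z. w z * (1 + (norm z)\<^sup>2) powr (- p))" and k: "decay_0 p k"
  obtains g where "\<And>r. integrable lborel (g r)" "\<And>r x z. norm x \<le> r \<Longrightarrow> \<bar>w z * k (x - z)\<bar> \<le> g r z"
proof -
  obtain C where C: "C \<ge> 0" "\<And>y. \<bar>k y\<bar> \<le> C * (1 + (norm y)\<^sup>2) powr (- p)"
    using k by (auto simp: decay_0_def)
  define g where "g r z = C * (2 * (1 + r\<^sup>2)) powr p * \<bar>w z * (1 + (norm z)\<^sup>2) powr (- p)\<bar>" for r z
  show thesis
  proof (rule that)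
    show "integrable lborel (g r)" for r
      unfolding g_def using w by (intro integrable_mult_right integrable_abs)
    fix r and x z :: "real^'n" assume x: "norm x \<le> r"
    have "\<bar>k (x - z)\<bar> \<le> C * ((2 * (1 + (norm x)\<^sup>2)) powr p * (1 + (norm z)\<^sup>2) powr (- p))"
      by (rule order_trans[OF C(2)]) (intro mult_left_mono weight_shift p C)
    also have "\<dots> \<le> C * ((2 * (1 + r\<^sup>2)) powr p * (1 + (norm z)\<^sup>2) powr (- p))"
      using x p C(1) by (intro mult_left_mono mult_right_mono powr_mono2) (auto intro!: power_mono)
    finally have "\<bar>w z * k (x - z)\<bar> \<le> \<bar>w z\<bar> * (C * ((2 * (1 + r\<^sup>2)) powr p * (1 + (norm z)\<^sup>2) powr (- p)))"
      unfolding abs_mult by (rule mult_left_mono) simp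
    also have "\<dots> = g r z" by (simp add: g_def abs_mult)
    finally show "\<bar>w z * k (x - z)\<bar> \<le> g r z" .
  qed
qed

lemma far_integrable:
  fixes w k :: "real^'n \<Rightarrow> real"
  assumes p: "p \<ge> 0" and w: "integrable lborel (\<lambda>z. w z * (1 + (norm z)\<^sup>2) powr (- p))" and k: "decay_0 p k"
    and [measurable]: "w \<in> borel_measurable borel"
  shows "integrable lborel (\<lambda>z. w z * k (x - z))"
proof -
  obtain g where g: "\<And>r. integrable lborel (g r)" "\<And>r x z. norm x \<le> r \<Longrightarrow> \<bar>w z * k (x - z)\<bar> \<le> g r z"
    using far_dominated[OF p w k] by blast
  have [measurable]: "k \<in> borel_measurable borel"
    using k by (auto simp: decay_0_def intro: continuous_borel_measurable)
  show ?thesis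
    by (rule Bochner_Integration.integrable_bound[OF g(1)[of "norm x"]])
      (use g(2)[of x "norm x"] in \<open>auto intro!: AE_I2 order_trans[OF _ abs_ge_self]\<close>)
qed

lemma has_pd_reflect_shift:
  assumes "has_pd i k k'" shows "has_pd i (\<lambda>x. k (x - z)) (\<lambda>x. k' (x - z))"
  using has_pd_shift[OF assms, of "- z"] by simp

lemma far_C_k:
  fixes w k :: "real^'n \<Rightarrow> real"
  assumes p: "p \<ge> 0" and w: "integrable lborel (\<lambda>z. w z * (1 + (norm z)\<^sup>2) powr (- p))"
    and wm: "w \<in> borel_measurable borel"
  shows "decay N p k \<Longrightarrow> far k w \<in> C_k N"
proof (induction N arbitrary: k)
  have cont: "continuous_on UNIV (far k w)" if k: "decay_0 p k" for k
  proof -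
    obtain g where g: "\<And>r. integrable lborel (g r)" "\<And>r x z. norm x \<le> r \<Longrightarrow> \<bar>w z * k (x - z)\<bar> \<le> g r z"
      using far_dominated[OF p w k] by blast
    have "continuous_on UNIV k" using k by (simp add: decay_0_def)
    then show ?thesis unfolding far_def[abs_def]
      by (intro continuous_on_integral_dominated[where g = g])
        (use g far_integrable[OF p w k wm] in \<open>auto intro!: continuous_intros elim: continuous_on_compose2\<close>)
  qed
  {
    case 0
    then show ?case using cont by (simp add: C_k_0_iff)
  next
    case (Suc N)
    then obtain k' where k: "decay_0 p k" and k': "\<And>i. has_pd i k (k' i)" "\<And>i. decay N p (k' i)"
      unfolding decay.simps by metis
    show ?case
    proof (rule C_k_SucI)
      show "continuous_on UNIV (far k w)" by (rule cont[OF k])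
      show "far (k' i) w \<in> C_k N" for i by (rule Suc.IH[OF k'(2)])
      fix i
      obtain g where g: "\<And>r. integrable lborel (g r)" "\<And>r x z. norm x \<le> r \<Longrightarrow> \<bar>w z * k' i (x - z)\<bar> \<le> g r z"
        using far_dominated[OF p w decay_imp_decay_0[OF k'(2)]] by blast
      show "has_pd i (far k w) (far (k' i) w)" unfolding far_def[abs_def]
        by (rule has_pd_integral_dominated[where g = g])
          (use g far_integrable[OF p w k wm] has_pd_cmult[OF has_pd_reflect_shift[OF k'(1)]] in auto)
    qed
  }
qed

subsection \<open>The fractional Laplacian as an integral of second differences\<close>

lemma norm_square_powr: "((norm y)\<^sup>2) powr q = norm y powr (2 * q)"
  using powr_powr[of "norm y" 2 q] by (cases "norm y = 0") auto

text \<open>Throughout, \<open>p = (n + \<alpha>) / 2\<close>.\<close>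

definition frac_kernel :: "real \<Rightarrow> real^'n \<Rightarrow> real" where
  "frac_kernel p y = norm y powr (- (2 * p))"

definition sdiff_integral :: "real \<Rightarrow> (real^'n \<Rightarrow> real) \<Rightarrow> real^'n \<Rightarrow> real" where
  "sdiff_integral p w x = (\<integral>y. sdiff w x y * frac_kernel p y \<partial>lborel)"

text \<open>The first condition is \<alpha> > 0. The order \<beta> > \<alpha> settles convergence at
  the origin, the weighted integrability settles it at infinity.\<close>

definition admissible :: "real \<Rightarrow> (real^'n \<Rightarrow> real) \<Rightarrow> bool" where
  "admissible p w \<longleftrightarrow> real CARD('n) < 2 * p \<and> (\<exists>\<beta>. 2 * p < real CARD('n) + \<beta> \<and> sdiff_bounded \<beta> w) \<and>
     integrable lborel (\<lambda>z. w z * (1 + (norm z)\<^sup>2) powr (- p))"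

lemma admissible_p:
  fixes w :: "real^'n \<Rightarrow> real"
  assumes "admissible p w" shows "real CARD('n) < 2 * p" "p > 0"
proof -
  show 1: "real CARD('n) < 2 * p" using assms by (simp add: admissible_def)
  have "real CARD('n) > 0" by simp
  with 1 show "p > 0" by linarith
qed

lemma admissible_continuous: "admissible p w \<Longrightarrow> continuous_on UNIV w"
  by (auto simp: admissible_def sdiff_bounded_def)

lemma admissible_measurable: "admissible p w \<Longrightarrow> w \<in> borel_measurable borel"
  by (rule continuous_borel_measurable[OF admissible_continuous])

lemma admissible_weight:
  "admissible p w \<Longrightarrow> integrable lborel (\<lambda>z. w z * (1 + (norm z)\<^sup>2) powr (- p))"
  by (simp add: admissible_def)

lemma frac_kernel_measurable [measurable]: "frac_kernel p \<in> borel_measurable borel"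
  unfolding frac_kernel_def[abs_def] by measurable

lemma frac_kernel_nonneg: "frac_kernel p y \<ge> 0" by (simp add: frac_kernel_def)

text \<open>The index N is the number of derivatives that the convolution with this part has to
  admit.\<close>

definition far_part :: "real \<Rightarrow> nat \<Rightarrow> real^'n \<Rightarrow> real" where
  "far_part p N y = power_profile p (Suc N) ((norm y)\<^sup>2)"

lemma far_part_even: "far_part p N (- y) = far_part p N y"
  by (simp add: far_part_def)

lemma decay_far_part: "p > 0 \<Longrightarrow> decay N p (far_part p N)"
  unfolding far_part_def[abs_def] by (rule decay_power_profile)

text \<open>Outside the unit ball the two functions coincide. Inside it, the bounded part is at most
  C <= C |y|^(-2p).\<close>

lemma near_kernel_diff:
  assumes p: "p > 0" shows "near_kernel (2 * p) (\<lambda>y::real^'n. frac_kernel p y - far_part p N y)"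
proof -
  have d: "decay_0 p (far_part p N :: real^'n \<Rightarrow> real)"
    by (rule decay_imp_decay_0[OF decay_far_part[OF p]])
  then obtain C where C: "C \<ge> 0" "\<And>y::real^'n. \<bar>far_part p N y\<bar> \<le> C * (1 + (norm y)\<^sup>2) powr (- p)"
    by (auto simp: decay_0_def)
  have [measurable]: "(far_part p N :: real^'n \<Rightarrow> real) \<in> borel_measurable borel"
    using d by (auto simp: decay_0_def intro: continuous_borel_measurable)
  have "\<bar>frac_kernel p y - far_part p N y\<bar> \<le> (1 + C) * (indicator (cball 0 1) y * norm y powr (- (2 * p)))"
    if "y \<noteq> 0" for y :: "real^'n"
  proof (cases "norm y \<le> 1")
    case True
    have "1 \<le> norm y powr (- (2 * p))"
      using powr_mono2'[of "- (2 * p)" "norm y" 1] True that p by simp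
    moreover have "(1 + (norm y)\<^sup>2) powr (- p) \<le> 1"
      using p powr_mono2'[of "- p" 1 "1 + (norm y)\<^sup>2"] by simp
    ultimately have "\<bar>far_part p N y\<bar> \<le> C * norm y powr (- (2 * p))"
      using C(1) by (intro order_trans[OF C(2)] mult_left_mono) auto
    then show ?thesis
      using True abs_triangle_ineq4[of "frac_kernel p y" "far_part p N y"] by (simp add: frac_kernel_def distrib_right)
  next
    case False
    then have "far_part p N y = ((norm y)\<^sup>2) powr (- p)"
      unfolding far_part_def by (intro power_profile_ge_1) (simp add: one_le_power)
    then have "far_part p N y = frac_kernel p y" by (simp add: norm_square_powr frac_kernel_def)
    then show ?thesis using False by simp
  qed
  then show ?thesis unfolding near_kernel_def by (intro conjI) (measurable, blast)
qed

lemma shift_even_kernel: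
  fixes w k :: "real^'n \<Rightarrow> real"
  assumes [measurable]: "w \<in> borel_measurable borel" "k \<in> borel_measurable borel"
    and even: "\<And>y. k (- y) = k y" and int: "integrable lborel (\<lambda>z. w z * k (x - z))"
  shows "integrable lborel (\<lambda>y. w (x + y) * k y)" "integrable lborel (\<lambda>y. w (x - y) * k y)"
    "(\<integral>y. w (x + y) * k y \<partial>lborel) = far k w x" "(\<integral>y. w (x - y) * k y \<partial>lborel) = far k w x"
  using integrable_lborel_affine[of "\<lambda>z. w z * k (x - z)" 1 x] integrable_lborel_affine[of "\<lambda>z. w z * k (x - z)" "-1" x]
    integral_lborel_affine[of "\<lambda>z. w z * k (x - z)" 1 x] integral_lborel_affine[of "\<lambda>z. w z * k (x - z)" "-1" x] int
  by (simp_all add: far_def even)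

lemma decay_0_weight: "decay_0 p (\<lambda>y. (1 + (norm y)\<^sup>2) powr (- p))"
proof -
  have "1 + (norm y)\<^sup>2 \<noteq> 0" for y :: "real^'a"
    using add_pos_nonneg[of 1 "(norm y)\<^sup>2"] by simp
  then show ?thesis unfolding decay_0_def
    by (intro conjI exI[of _ 1]) (auto intro!: continuous_intros)
qed

lemma decay_0_integrable:
  assumes "2 * p > real CARD('n)" "decay_0 p (k :: real^'n \<Rightarrow> real)"
  shows "integrable lborel k"
proof -
  obtain C where C: "C \<ge> 0" "\<And>y. \<bar>k y\<bar> \<le> C * (1 + (norm y)\<^sup>2) powr (- p)"
    using assms by (auto simp: decay_0_def)
  have [measurable]: "k \<in> borel_measurable borel"
    using assms by (auto simp: decay_0_def intro: continuous_borel_measurable)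
  have "integrable lborel (\<lambda>y::real^'n. C * (1 + (norm y)\<^sup>2) powr (- p))"
    using assms(1) by (intro integrable_mult_right integrable_weight) simp
  then show ?thesis
    by (rule Bochner_Integration.integrable_bound) (use C in \<open>auto intro!: AE_I2\<close>)
qed

text \<open>Without a singularity the three terms of the second difference can be integrated
  separately, and evenness makes the two translates agree.\<close>

lemma sdiff_far_integral:
  fixes w k :: "real^'n \<Rightarrow> real"
  assumes w: "admissible p w" and k: "decay_0 p k" and even: "\<And>y. k (- y) = k y"
  shows "integrable lborel (\<lambda>y. sdiff w x y * k y)"
    "(\<integral>y. sdiff w x y * k y \<partial>lborel) = 2 * w x * integral\<^sup>L lborel k - 2 * far k w x"
proof -
  have [measurable]: "w \<in> borel_measurable borel" by (rule admissible_measurable[OF w])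
  have [measurable]: "k \<in> borel_measurable borel"
    using k by (auto simp: decay_0_def intro: continuous_borel_measurable)
  have int: "integrable lborel (\<lambda>z. w z * k (x - z))"
    using admissible_p[OF w] by (intro far_integrable[OF _ admissible_weight[OF w] k]) auto
  have ik: "integrable lborel k" by (rule decay_0_integrable[OF admissible_p(1)[OF w] k])
  note s = shift_even_kernel[of w k x, OF _ _ even int]
  have eq: "(\<lambda>y. sdiff w x y * k y) = (\<lambda>y. 2 * w x * k y - w (x + y) * k y - w (x - y) * k y)"
    by (simp add: sdiff_def fun_eq_iff algebra_simps)
  show "integrable lborel (\<lambda>y. sdiff w x y * k y)"
    unfolding eq using s ik by (intro Bochner_Integration.integrable_diff integrable_mult_right) auto
  show "(\<integral>y. sdiff w x y * k y \<partial>lborel) = 2 * w x * integral\<^sup>L lborel k - 2 * far k w x"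
    unfolding eq using s ik by simp
qed

lemma sdiff_integral_split:
  fixes w :: "real^'n \<Rightarrow> real"
  assumes w: "admissible p w"
  shows "integrable lborel (\<lambda>y. sdiff w x y * frac_kernel p y)"
    "sdiff_integral p w x = near (\<lambda>y. frac_kernel p y - far_part p N y) w x +
       (2 * w x * integral\<^sup>L lborel (far_part p N :: real^'n \<Rightarrow> real) - 2 * far (far_part p N) w x)"
proof -
  have p: "p > 0" using admissible_p[OF w] by simp
  obtain \<beta> where \<beta>: "2 * p < real CARD('n) + \<beta>" "sdiff_bounded \<beta> w"
    using w by (auto simp: admissible_def)
  have 1: "integrable lborel (\<lambda>y. sdiff w x y * (frac_kernel p y - far_part p N y))" for N
    by (rule near_integrable[OF \<beta>(2) near_kernel_diff[OF p] \<beta>(1)])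
  note 2 = sdiff_far_integral[OF w decay_imp_decay_0[OF decay_far_part[OF p]] far_part_even]
  have eq: "(\<lambda>y. sdiff w x y * frac_kernel p y) =
      (\<lambda>y. sdiff w x y * (frac_kernel p y - far_part p N y) + sdiff w x y * far_part p N y)" for N
    by (simp add: fun_eq_iff algebra_simps)
  show "integrable lborel (\<lambda>y. sdiff w x y * frac_kernel p y)"
    unfolding eq[of 0] by (intro Bochner_Integration.integrable_add 1 2(1))
  show "sdiff_integral p w x = near (\<lambda>y. frac_kernel p y - far_part p N y) w x +
       (2 * w x * integral\<^sup>L lborel (far_part p N :: real^'n \<Rightarrow> real) - 2 * far (far_part p N) w x)"
    unfolding sdiff_integral_def eq[of N] near_def
    by (subst Bochner_Integration.integral_add[OF 1 2(1)]) (simp add: 2(2))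
qed

lemma sdiff_integral_C_k:
  fixes w :: "real^'n \<Rightarrow> real"
  assumes w: "admissible p w" and \<gamma>: "0 < \<gamma>" "\<gamma> \<le> 1" "a \<le> 1" "2 * p < real CARD('n) + (real a + \<gamma>)"
    and reg: "w \<in> C_k_holder_loc (N + a) \<gamma>"
  shows "sdiff_integral p w \<in> C_k N"
proof -
  have p: "p > 0" using admissible_p[OF w] by simp
  have 1: "near (\<lambda>y. frac_kernel p y - far_part p N y) w \<in> C_k N"
    by (rule near_C_k[OF \<gamma>(1-3) near_kernel_diff[OF p] \<gamma>(4) reg])
  have 2: "far (far_part p N) w \<in> C_k N"
    by (rule far_C_k[OF less_imp_le[OF p] admissible_weight[OF w] admissible_measurable[OF w] decay_far_part[OF p]])
  have 3: "w \<in> C_k N" by (rule C_k_mono[OF C_k_holder_loc_C_k[OF reg]]) simp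
  have "(\<lambda>x. near (\<lambda>y. frac_kernel p y - far_part p N y) w x +
      ((2 * integral\<^sup>L lborel (far_part p N :: real^'n \<Rightarrow> real)) * w x + (- 2) * far (far_part p N) w x)) \<in> C_k N"
    by (intro C_k_add C_k_cmult 1 2 3)
  moreover have "sdiff_integral p w = (\<lambda>x. near (\<lambda>y. frac_kernel p y - far_part p N y) w x +
      ((2 * integral\<^sup>L lborel (far_part p N :: real^'n \<Rightarrow> real)) * w x + (- 2) * far (far_part p N) w x))"
    by (rule ext) (simp add: sdiff_integral_split(2)[OF w, of _ N])
  ultimately show ?thesis by simp
qed

text \<open>The constant comes from 1 + |y|^2 <= (1 + 1/\<epsilon>^2) |y|^2, valid for |y| >=
  \<epsilon>.\<close>

lemma frac_kernel_le_weight: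
  fixes y :: "real^'n"
  assumes "\<epsilon> > 0" "norm y \<ge> \<epsilon>" "p > 0"
  shows "frac_kernel p y \<le> (1 + 1 / \<epsilon>\<^sup>2) powr p * (1 + (norm y)\<^sup>2) powr (- p)"
proof -
  have pos: "norm y > 0" "1 + (norm y)\<^sup>2 > 0" using assms by (auto simp: add_pos_nonneg)
  have "\<epsilon>\<^sup>2 \<le> (norm y)\<^sup>2" using assms by (intro power_mono) auto
  then have "1 + (norm y)\<^sup>2 \<le> (1 + 1 / \<epsilon>\<^sup>2) * (norm y)\<^sup>2"
    using assms by (simp add: field_simps)
  then have "(1 + (norm y)\<^sup>2) / (1 + 1 / \<epsilon>\<^sup>2) \<le> (norm y)\<^sup>2"
    by (simp add: divide_le_eq add_pos_nonneg mult.commute)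
  then have "((norm y)\<^sup>2) powr (- p) \<le> ((1 + (norm y)\<^sup>2) / (1 + 1 / \<epsilon>\<^sup>2)) powr (- p)"
    using assms pos by (intro powr_mono2') (auto intro!: divide_pos_pos add_pos_nonneg)
  also have "\<dots> = (1 + 1 / \<epsilon>\<^sup>2) powr p * (1 + (norm y)\<^sup>2) powr (- p)"
    by (simp add: powr_divide powr_minus divide_simps)
  also have "((norm y)\<^sup>2) powr (- p) = frac_kernel p y"
    by (simp add: norm_square_powr frac_kernel_def)
  finally show ?thesis .
qed

lemma truncated_integrable:
  fixes w :: "real^'n \<Rightarrow> real"
  assumes w: "admissible p w" and \<epsilon>: "\<epsilon> > 0"
  shows "integrable lborel (\<lambda>y. w (x + y) * (indicator {y. norm y \<ge> \<epsilon>} y * frac_kernel p y))"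
    "integrable lborel (\<lambda>y::real^'n. indicator {y. norm y \<ge> \<epsilon>} y * frac_kernel p y)"
proof -
  have p: "p > 0" using admissible_p[OF w] by simp
  have [measurable]: "w \<in> borel_measurable borel" by (rule admissible_measurable[OF w])
  let ?k = "\<lambda>y::real^'n. (1 + (norm y)\<^sup>2) powr (- p)"
  let ?t = "\<lambda>y::real^'n. indicator {y. norm y \<ge> \<epsilon>} y * frac_kernel p y"
  have t: "\<bar>?t y\<bar> \<le> (1 + 1 / \<epsilon>\<^sup>2) powr p * ?k y" for y
    using frac_kernel_le_weight[OF \<epsilon> _ p, of y] by (auto simp: indicator_def frac_kernel_nonneg)
  have 1: "integrable lborel (\<lambda>y. w (x + y) * ?k y)"
    by (rule shift_even_kernel(1)) (use far_integrable[OF less_imp_le[OF p] admissible_weight[OF w] decay_0_weight] in auto)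
  have 2: "integrable lborel ?k" using admissible_p[OF w] by (intro integrable_weight) simp
  show "integrable lborel (\<lambda>y. w (x + y) * ?t y)"
  proof (rule Bochner_Integration.integrable_bound[OF integrable_mult_right[OF 1, of "(1 + 1 / \<epsilon>\<^sup>2) powr p"]])
    show "AE y in lborel. norm (w (x + y) * ?t y) \<le> norm ((1 + 1 / \<epsilon>\<^sup>2) powr p * (w (x + y) * ?k y))"
    proof (rule AE_I2)
      fix y
      show "norm (w (x + y) * ?t y) \<le> norm ((1 + 1 / \<epsilon>\<^sup>2) powr p * (w (x + y) * ?k y))"
        using mult_left_mono[OF t[of y], of "\<bar>w (x + y)\<bar>"] by (simp add: abs_mult mult_ac)
    qed
  qed measurable
  show "integrable lborel ?t"
    by (rule Bochner_Integration.integrable_bound[OF integrable_mult_right[OF 2, of "(1 + 1 / \<epsilon>\<^sup>2) powr p"]])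
      (use t in auto)
qed

text \<open>The substitutions x + y and x - y give the same integral, as the truncation is symmetric
  about x; their mean is the right-hand side.\<close>

lemma truncated_integral_eq:
  fixes w :: "real^'n \<Rightarrow> real"
  assumes w: "admissible p w" and \<epsilon>: "\<epsilon> > 0" and p: "2 * p = real CARD('n) + \<alpha>"
  shows "(LINT y:{y. norm (y - x) \<ge> \<epsilon>}|lebesgue. (w x - w y) / norm (x - y) powr (real CARD('n) + \<alpha>)) =
     (\<integral>y. indicator {y. norm y \<ge> \<epsilon>} y * (sdiff w x y * frac_kernel p y) \<partial>lborel) / 2"
proof -
  have [measurable]: "w \<in> borel_measurable borel" by (rule admissible_measurable[OF w])
  define h where "h y = indicator {y. norm (y - x) \<ge> \<epsilon>} y * ((w x - w y) * frac_kernel p (x - y))" for y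
  define g where "g y = (w x - w (x + y)) * (indicator {y. norm y \<ge> \<epsilon>} y * frac_kernel p y)" for y
  have [measurable]: "h \<in> borel_measurable borel" unfolding h_def[abs_def] by measurable
  have "(LINT y:{y. norm (y - x) \<ge> \<epsilon>}|lebesgue. (w x - w y) / norm (x - y) powr (real CARD('n) + \<alpha>)) = integral\<^sup>L lebesgue h"
    unfolding set_lebesgue_integral_def h_def[abs_def] frac_kernel_def p
    by (simp add: powr_minus[symmetric] divide_inverse)
  also have "\<dots> = integral\<^sup>L lborel h" by (rule integral_completion) simp
  finally have 1: "(LINT y:{y. norm (y - x) \<ge> \<epsilon>}|lebesgue. (w x - w y) / norm (x - y) powr (real CARD('n) + \<alpha>)) = integral\<^sup>L lborel h" .
  have 2: "integral\<^sup>L lborel h = integral\<^sup>L lborel g"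
    by (subst integral_lborel_affine[of h 1 x]) (simp_all add: h_def g_def[abs_def] frac_kernel_def mult_ac indicator_def)
  have 3: "integral\<^sup>L lborel h = (\<integral>y. g (- y) \<partial>lborel)"
    by (subst integral_lborel_affine[of h "-1" x]) (simp_all add: h_def g_def[abs_def] frac_kernel_def mult_ac indicator_def)
  have ig: "integrable lborel g"
    using Bochner_Integration.integrable_diff[OF integrable_mult_right[OF truncated_integrable(2)[OF w \<epsilon>], of "w x"] truncated_integrable(1)[OF w \<epsilon>, of x]]
    by (simp add: g_def[abs_def] algebra_simps)
  then have ig': "integrable lborel (\<lambda>y. g (- y))"
    using integrable_lborel_affine[of g "-1" 0] borel_measurable_integrable[OF ig] by simp
  have "2 * integral\<^sup>L lborel h = (\<integral>y. g y + g (- y) \<partial>lborel)"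
    using 2 3 ig ig' by simp
  also have "(\<lambda>y. g y + g (- y)) = (\<lambda>y. indicator {y. norm y \<ge> \<epsilon>} y * (sdiff w x y * frac_kernel p y))"
    by (simp add: fun_eq_iff g_def sdiff_def frac_kernel_def indicator_def algebra_simps)
  finally show ?thesis using 1 by simp
qed

text \<open>After symmetrisation the integrand is absolutely integrable, so dominated convergence
  turns the principal value into an ordinary integral. The factor 1/2 stems from the
  symmetrisation.\<close>

lemma frac_laplacian_eq:
  fixes w :: "real^'n \<Rightarrow> real"
  assumes w: "admissible p w" and p: "2 * p = real CARD('n) + \<alpha>"
  shows "frac_laplacian \<alpha> w x = frac_laplacian_const CARD('n) \<alpha> / 2 * sdiff_integral p w x"
proof -
  have [measurable]: "w \<in> borel_measurable borel" by (rule admissible_measurable[OF w])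
  have [measurable]: "sdiff w x \<in> borel_measurable borel" unfolding sdiff_def[abs_def] by measurable
  have "((\<lambda>\<epsilon>. \<integral>y. indicator {y. norm y \<ge> \<epsilon>} y * (sdiff w x y * frac_kernel p y) \<partial>lborel) \<longlongrightarrow> sdiff_integral p w x) (at_right 0)"
    unfolding sdiff_integral_def
  proof (rule tendsto_integral_dominated[where g = "\<lambda>y. \<bar>sdiff w x y * frac_kernel p y\<bar>"])
    show "integrable lborel (\<lambda>y. \<bar>sdiff w x y * frac_kernel p y\<bar>)"
      by (intro integrable_abs sdiff_integral_split(1)[OF w])
    fix y :: "real^'n"
    show "((\<lambda>\<epsilon>. indicator {y. norm y \<ge> \<epsilon>} y * (sdiff w x y * frac_kernel p y)) \<longlongrightarrow> sdiff w x y * frac_kernel p y) (at_right 0)"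
    proof (cases "y = 0")
      case False
      have "\<forall>\<^sub>F \<epsilon> in at_right 0. sdiff w x y * frac_kernel p y = indicator {y. norm y \<ge> \<epsilon>} y * (sdiff w x y * frac_kernel p y)"
        unfolding eventually_at_right_field using False by (intro exI[of _ "norm y"]) auto
      then show ?thesis by (rule Lim_transform_eventually[OF tendsto_const])
    qed simp
  qed (auto simp: indicator_def)
  then have "((\<lambda>\<epsilon>. (\<integral>y. indicator {y. norm y \<ge> \<epsilon>} y * (sdiff w x y * frac_kernel p y) \<partial>lborel) / 2) \<longlongrightarrow> sdiff_integral p w x / 2) (at_right 0)"
    by (intro tendsto_intros) auto
  moreover have "\<forall>\<^sub>F \<epsilon> in at_right 0. (\<integral>y. indicator {y. norm y \<ge> \<epsilon>} y * (sdiff w x y * frac_kernel p y) \<partial>lborel) / 2 =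
     (LINT y:{y. norm (y - x) \<ge> \<epsilon>}|lebesgue. (w x - w y) / norm (x - y) powr (real CARD('n) + \<alpha>))"
    unfolding eventually_at_right_field by (intro exI[of _ 1]) (auto simp: truncated_integral_eq[OF w _ p])
  ultimately have "((\<lambda>\<epsilon>. LINT y:{y. norm (y - x) \<ge> \<epsilon>}|lebesgue. (w x - w y) / norm (x - y) powr (real CARD('n) + \<alpha>)) \<longlongrightarrow> sdiff_integral p w x / 2) (at_right 0)"
    by (rule Lim_transform_eventually)
  then show ?thesis unfolding frac_laplacian_def
    by (subst tendsto_Lim) (auto simp: trivial_limit_at_right_real)
qed

text \<open>The weights are compared by 1 + |z|^(2p) <= 2 (1 + |z|^2)^p, and Borel measurability of
  u takes the integral from \<open>lebesgue\<close> to \<open>lborel\<close>.\<close>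

lemma L_frac_weight:
  fixes u :: "real^'n \<Rightarrow> real"
  assumes u: "u \<in> L_frac \<alpha>" and [measurable]: "u \<in> borel_measurable borel" and p: "2 * p = real CARD('n) + \<alpha>" and "\<alpha> > 0"
  shows "integrable lborel (\<lambda>z. u z * (1 + (norm z)\<^sup>2) powr (- p))"
proof -
  have p0: "p > 0" using p \<open>\<alpha> > 0\<close> by (smt (verit) of_nat_0_le_iff)
  have "integrable lebesgue (\<lambda>x. \<bar>u x\<bar> / (1 + norm x powr (2 * p)))"
    using u by (simp add: L_frac_def p)
  then have "integrable lborel (\<lambda>x. \<bar>u x\<bar> / (1 + norm x powr (2 * p)))"
    by (subst (asm) integrable_completion) auto
  then have 1: "integrable lborel (\<lambda>x. 2 * (\<bar>u x\<bar> / (1 + norm x powr (2 * p))))" by (rule integrable_mult_right)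
  show ?thesis
  proof (rule Bochner_Integration.integrable_bound[OF 1])
    show "AE z in lborel. norm (u z * (1 + (norm z)\<^sup>2) powr (- p)) \<le> norm (2 * (\<bar>u z\<bar> / (1 + norm z powr (2 * p))))"
    proof (rule AE_I2)
      fix z :: "real^'n"
      have pos: "1 + (norm z)\<^sup>2 > 0" by (simp add: add_pos_nonneg)
      have "norm z powr (2 * p) = ((norm z)\<^sup>2) powr p"
        by (simp add: norm_square_powr)
      also have "\<dots> \<le> (1 + (norm z)\<^sup>2) powr p" using p0 by (intro powr_mono2) auto
      finally have "1 + norm z powr (2 * p) \<le> 2 * (1 + (norm z)\<^sup>2) powr p"
        using ge_one_powr_ge_zero[of "1 + (norm z)\<^sup>2" p] p0 by simp
      moreover have "1 + norm z powr (2 * p) > 0" by (simp add: add_pos_nonneg)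
      ultimately have "(1 + (norm z)\<^sup>2) powr (- p) \<le> 2 / (1 + norm z powr (2 * p))"
        using pos by (simp add: powr_minus divide_simps)
      from mult_left_mono[OF this, of "\<bar>u z\<bar>"] \<open>1 + norm z powr (2 * p) > 0\<close>
      show "norm (u z * (1 + (norm z)\<^sup>2) powr (- p)) \<le> norm (2 * (\<bar>u z\<bar> / (1 + norm z powr (2 * p))))"
        by (simp add: abs_mult mult.commute)
    qed
  qed measurable
qed

subsection \<open>Duality with test functions\<close>

lemma integrable_unit_ball_support:
  fixes f :: "real^'n \<Rightarrow> real"
  assumes "continuous_on UNIV f" and supp: "\<And>x. norm x > 1 \<Longrightarrow> f x = 0"
  shows "integrable lborel f"
proof -
  have "integrable lborel (\<lambda>x. indicator (cball 0 1) x *\<^sub>R f x)"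
    using borel_integrable_compact[of "cball 0 1" f] continuous_on_subset[OF assms(1)] by simp
  also have "(\<lambda>x. indicator (cball 0 1) x *\<^sub>R f x) = f"
    using supp by (auto simp: fun_eq_iff indicator_def not_le)
  finally show ?thesis .
qed

lemma frac_kernel_far_le:
  fixes y :: "real^'n"
  assumes "p > 0" "norm y \<ge> 1"
  shows "frac_kernel p y \<le> 2 powr p * (1 + (norm y)\<^sup>2) powr (- p)"
  using frac_kernel_le_weight[of 1 y p] assms by simp

lemma continuous_bounded_on_cball:
  fixes f :: "real^'n \<Rightarrow> real"
  assumes "continuous_on UNIV f"
  obtains B where "B \<ge> 0" "\<And>x. norm x \<le> r \<Longrightarrow> \<bar>f x\<bar> \<le> B"
proof -
  have "compact (f ` cball 0 r)"
    by (intro compact_continuous_image continuous_on_subset[OF assms]) auto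
  then obtain B where B: "\<And>x. norm x \<le> r \<Longrightarrow> \<bar>f x\<bar> \<le> B"
    using compact_imp_bounded bounded_iff by (metis imageI mem_cball_0 real_norm_def)
  show thesis by (rule that[of "\<bar>B\<bar>"]) (auto intro: order_trans[OF B abs_ge_self])
qed

lemma abs_far_weight:
  fixes w :: "real^'n \<Rightarrow> real"
  assumes w: "admissible p w"
  shows "integrable lborel (\<lambda>y. \<bar>w (x + y)\<bar> * (1 + (norm y)\<^sup>2) powr (- p))"
    "integrable lborel (\<lambda>y. \<bar>w (x - y)\<bar> * (1 + (norm y)\<^sup>2) powr (- p))"
    "(\<integral>y. \<bar>w (x + y)\<bar> * (1 + (norm y)\<^sup>2) powr (- p) \<partial>lborel) = far (\<lambda>y. (1 + (norm y)\<^sup>2) powr (- p)) (\<lambda>x. \<bar>w x\<bar>) x"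
    "(\<integral>y. \<bar>w (x - y)\<bar> * (1 + (norm y)\<^sup>2) powr (- p) \<partial>lborel) = far (\<lambda>y. (1 + (norm y)\<^sup>2) powr (- p)) (\<lambda>x. \<bar>w x\<bar>) x"
    "continuous_on UNIV (far (\<lambda>y. (1 + (norm y)\<^sup>2) powr (- p)) (\<lambda>x. \<bar>w x\<bar>))"
proof -
  have p: "p \<ge> 0" using admissible_p[OF w] by simp
  have [measurable]: "w \<in> borel_measurable borel" by (rule admissible_measurable[OF w])
  have wi: "integrable lborel (\<lambda>z. \<bar>w z\<bar> * (1 + (norm z)\<^sup>2) powr (- p))"
    using integrable_abs[OF admissible_weight[OF w]] by (simp add: abs_mult)
  have m: "(\<lambda>x. \<bar>w x\<bar>) \<in> borel_measurable borel" by measurable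
  have int: "integrable lborel (\<lambda>z. \<bar>w z\<bar> * (1 + (norm (x - z))\<^sup>2) powr (- p))"
    by (rule far_integrable[OF p wi decay_0_weight m])
  have km: "(\<lambda>y::real^'n. (1 + (norm y)\<^sup>2) powr (- p)) \<in> borel_measurable borel" by measurable
  note s = shift_even_kernel[OF m km _ int]
  show "integrable lborel (\<lambda>y. \<bar>w (x + y)\<bar> * (1 + (norm y)\<^sup>2) powr (- p))" by (rule s(1)) simp
  show "integrable lborel (\<lambda>y. \<bar>w (x - y)\<bar> * (1 + (norm y)\<^sup>2) powr (- p))" by (rule s(2)) simp
  show "(\<integral>y. \<bar>w (x + y)\<bar> * (1 + (norm y)\<^sup>2) powr (- p) \<partial>lborel) = far (\<lambda>y. (1 + (norm y)\<^sup>2) powr (- p)) (\<lambda>x. \<bar>w x\<bar>) x" by (rule s(3)) simp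
  show "(\<integral>y. \<bar>w (x - y)\<bar> * (1 + (norm y)\<^sup>2) powr (- p) \<partial>lborel) = far (\<lambda>y. (1 + (norm y)\<^sup>2) powr (- p)) (\<lambda>x. \<bar>w x\<bar>) x" by (rule s(4)) simp
  have "far (\<lambda>y::real^'n. (1 + (norm y)\<^sup>2) powr (- p)) (\<lambda>x. \<bar>w x\<bar>) \<in> C_k 0"
    by (rule far_C_k[OF p wi m]) (simp add: decay_0_weight)
  then show "continuous_on UNIV (far (\<lambda>y::real^'n. (1 + (norm y)\<^sup>2) powr (- p)) (\<lambda>x. \<bar>w x\<bar>))"
    by (simp add: C_k_0_iff)
qed

lemma abs_sdiff_integrable:
  assumes "admissible p w"
  shows "integrable lborel (\<lambda>y. \<bar>sdiff w x y\<bar> * frac_kernel p y)"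
  using integrable_abs[OF sdiff_integral_split(1)[OF assms, of x]] by (simp add: abs_mult frac_kernel_nonneg)

text \<open>For |y| <= 1 the dominating function of the near part is uniform in x. For |y| > 1 the
  three terms are bounded one by one, which leaves a continuous function of x. The uniformity
  provides the integrability that Fubini requires.\<close>

lemma abs_sdiff_integral_bounded:
  fixes w :: "real^'n \<Rightarrow> real"
  assumes w: "admissible p w"
  obtains C where "C \<ge> 0" "\<And>x. norm x \<le> r \<Longrightarrow> (\<integral>y. \<bar>sdiff w x y\<bar> * frac_kernel p y \<partial>lborel) \<le> C"
proof -
  have p: "p > 0" using admissible_p[OF w] by simp
  obtain \<beta> where \<beta>: "2 * p < real CARD('n) + \<beta>" "sdiff_bounded \<beta> w"
    using w by (auto simp: admissible_def)
  let ?k = "\<lambda>y::real^'n. indicator (cball 0 1) y * frac_kernel p y"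
  let ?W = "\<lambda>y::real^'n. (1 + (norm y)\<^sup>2) powr (- p)"
  have [measurable]: "cball (0::real^'n) 1 \<in> sets borel" by simp
  have k: "near_kernel (2 * p) ?k"
    unfolding near_kernel_def by (intro conjI exI[of _ 1]) (measurable, simp add: frac_kernel_def abs_mult)
  obtain g where g: "\<And>r. integrable lborel (g r)" "\<And>r x y::real^'n. norm x \<le> r \<Longrightarrow> \<bar>sdiff w x y * ?k y\<bar> \<le> g r y"
    using near_dominated[OF \<beta>(2) k \<beta>(1)] by blast
  have iW: "integrable lborel ?W" using admissible_p[OF w] by (intro integrable_weight) simp
  define G where "G x = 2 powr p * (2 * \<bar>w x\<bar> * integral\<^sup>L lborel ?W + 2 * far ?W (\<lambda>x. \<bar>w x\<bar>) x)" for x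
  have Gc: "continuous_on UNIV G" unfolding G_def[abs_def]
    by (intro continuous_intros abs_far_weight(5)[OF w] admissible_continuous[OF w])
  obtain B where B: "B \<ge> 0" "\<And>x. norm x \<le> r \<Longrightarrow> \<bar>G x\<bar> \<le> B"
    using continuous_bounded_on_cball[OF Gc, where r = r] by blast
  have "(\<integral>y. \<bar>sdiff w x y\<bar> * frac_kernel p y \<partial>lborel) \<le> \<bar>integral\<^sup>L lborel (g r)\<bar> + B" if x: "norm x \<le> r" for x
  proof -
    define h where "h y = 2 * \<bar>w x\<bar> * ?W y + (\<bar>w (x + y)\<bar> * ?W y + \<bar>w (x - y)\<bar> * ?W y)" for y
    have ih: "integrable lborel h" unfolding h_def[abs_def]
      by (intro Bochner_Integration.integrable_add integrable_mult_right iW abs_far_weight(1,2)[OF w])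
    have h: "2 powr p * integral\<^sup>L lborel h = G x"
      unfolding h_def[abs_def] G_def
      using iW abs_far_weight(1-4)[OF w, of x] by simp
    have "(\<integral>y. \<bar>sdiff w x y\<bar> * frac_kernel p y \<partial>lborel) \<le> (\<integral>y. g r y + 2 powr p * h y \<partial>lborel)"
    proof (rule integral_mono)
      fix y
      have g0: "0 \<le> g r y" using g(2)[OF x, of y] by linarith
      have h0: "0 \<le> h y" unfolding h_def by (intro add_nonneg_nonneg mult_nonneg_nonneg) auto
      show "\<bar>sdiff w x y\<bar> * frac_kernel p y \<le> g r y + 2 powr p * h y"
      proof (cases "norm y \<le> 1")
        case True
        then have "\<bar>sdiff w x y\<bar> * frac_kernel p y \<le> g r y"
          using g(2)[OF x, of y] by (simp add: abs_mult frac_kernel_nonneg)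
        moreover have "0 \<le> 2 powr p * h y" using h0 by simp
        ultimately show ?thesis by linarith
      next
        case False
        have "\<bar>sdiff w x y\<bar> * frac_kernel p y \<le> (2 * \<bar>w x\<bar> + (\<bar>w (x + y)\<bar> + \<bar>w (x - y)\<bar>)) * (2 powr p * ?W y)"
          using False p by (intro mult_mono frac_kernel_far_le) (auto simp: sdiff_def frac_kernel_nonneg)
        also have "\<dots> = 2 powr p * h y" by (simp add: h_def algebra_simps)
        finally show ?thesis using g0 by linarith
      qed
    qed (intro abs_sdiff_integrable[OF w] Bochner_Integration.integrable_add g ih integrable_mult_right)+
    also have "\<dots> = integral\<^sup>L lborel (g r) + G x" using g(1)[of r] ih h by simp
    also have "\<dots> \<le> \<bar>integral\<^sup>L lborel (g r)\<bar> + B" using B(2)[OF x] by linarith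
    finally show ?thesis .
  qed
  then show thesis using B(1) by (intro that[of "\<bar>integral\<^sup>L lborel (g r)\<bar> + B"]) auto
qed

definition test_function :: "(real^'n \<Rightarrow> real) \<Rightarrow> bool" where
  "test_function \<phi> \<longleftrightarrow> \<phi> \<in> C_k 2 \<and> (\<forall>x. norm x > 1 \<longrightarrow> \<phi> x = 0)"

lemma test_function_admissible:
  fixes \<phi> :: "real^'n \<Rightarrow> real"
  assumes "test_function \<phi>" "real CARD('n) < 2 * p" "2 * p < real CARD('n) + 2"
  shows "admissible p \<phi>"
proof -
  have "\<phi> \<in> C_k (Suc (Suc 0))" using assms(1) by (simp add: test_function_def numeral_2_eq_2)
  then have "\<phi> \<in> C_k_holder_loc (Suc 0) 1" by (intro C_k_Suc_imp_holder) auto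
  then have sb: "sdiff_bounded (1 + 1) \<phi>" by (rule holder_1_sdiff_bounded) simp
  have c: "continuous_on UNIV \<phi>" by (rule sdiff_bounded_continuous[OF sb])
  have nz: "1 + (norm z)\<^sup>2 \<noteq> 0" for z :: "real^'n" using add_pos_nonneg[of 1 "(norm z)\<^sup>2"] by simp
  have "integrable lborel (\<lambda>z. \<phi> z * (1 + (norm z)\<^sup>2) powr (- p))"
    by (rule integrable_unit_ball_support)
      (use assms(1) nz in \<open>auto intro!: continuous_intros c simp: test_function_def\<close>)
  with sb assms show ?thesis unfolding admissible_def by (intro conjI exI[of _ 2]) auto
qed

text \<open>For |x| > 2 and |y| <= 1 both x + y and x - y miss the support, so only the non-singular
  range of the kernel contributes, and there the weight can be moved to x. For |x| <= 2 local
  boundedness is enough.\<close>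

lemma test_function_sdiff_decay:
  fixes \<phi> :: "real^'n \<Rightarrow> real"
  assumes \<phi>: "test_function \<phi>" and p: "real CARD('n) < 2 * p" "2 * p < real CARD('n) + 2"
  obtains C where "C \<ge> 0" "\<And>x. (\<integral>y. \<bar>sdiff \<phi> x y\<bar> * frac_kernel p y \<partial>lborel) \<le> C * (1 + (norm x)\<^sup>2) powr (- p)"
proof -
  let ?W = "\<lambda>y::real^'n. (1 + (norm y)\<^sup>2) powr (- p)"
  have adm: "admissible p \<phi>" by (rule test_function_admissible[OF assms])
  have p0: "p > 0" using admissible_p[OF adm] by simp
  have supp: "\<phi> x = 0" if "norm x > 1" for x using \<phi> that by (simp add: test_function_def)
  obtain C1 where C1: "C1 \<ge> 0" "\<And>x. norm x \<le> 2 \<Longrightarrow> (\<integral>y. \<bar>sdiff \<phi> x y\<bar> * frac_kernel p y \<partial>lborel) \<le> C1"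
    using abs_sdiff_integral_bounded[OF adm, where r = 2] by blast
  define J where "J = (\<integral>z. \<bar>\<phi> z\<bar> \<partial>lborel)"
  have J: "J \<ge> 0" by (simp add: J_def)
  have iphi: "integrable lborel (\<lambda>z. \<bar>\<phi> z\<bar>)"
    by (rule integrable_unit_ball_support) (auto intro!: continuous_intros admissible_continuous[OF adm] simp: supp)
  \<comment> \<open>Here 5 = 1 + 2^2 bounds 1 + |x|^2 for |x| <= 2, and 4 = 2 (1 + 1^2) comes from
    \<open>weight_shift\<close> with |z| <= 1. The factor 2 counts the two translates, and 2^p stems
    from \<open>frac_kernel_far_le\<close>.\<close>
  define C where "C = C1 * 5 powr p + 2 powr p * (2 * (4 powr p * J))"
  show thesis
  proof (rule that[of C])
    show "C \<ge> 0" using C1 J by (simp add: C_def)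
    fix x :: "real^'n"
    show "(\<integral>y. \<bar>sdiff \<phi> x y\<bar> * frac_kernel p y \<partial>lborel) \<le> C * ?W x"
    proof (cases "norm x \<le> 2")
      case True
      then have "(norm x)\<^sup>2 \<le> 2\<^sup>2" by (intro power_mono) auto
      then have "5 powr (- p) \<le> ?W x" using p0 by (intro powr_mono2') (auto simp: add_pos_nonneg)
      then have "1 \<le> 5 powr p * ?W x" by (simp add: powr_minus field_simps)
      then have "C1 * 1 \<le> C1 * (5 powr p * ?W x)" using C1(1) by (rule mult_left_mono)
      also have "\<dots> \<le> C * ?W x" using J by (simp add: C_def distrib_right)
      finally show ?thesis using C1(2)[OF True] by linarith
    next
      case False
      have "(\<integral>y. \<bar>sdiff \<phi> x y\<bar> * frac_kernel p y \<partial>lborel) \<le> (\<integral>y. 2 powr p * (\<bar>\<phi> (x + y)\<bar> * ?W y + \<bar>\<phi> (x - y)\<bar> * ?W y) \<partial>lborel)"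
      proof (rule integral_mono)
        fix y
        show "\<bar>sdiff \<phi> x y\<bar> * frac_kernel p y \<le> 2 powr p * (\<bar>\<phi> (x + y)\<bar> * ?W y + \<bar>\<phi> (x - y)\<bar> * ?W y)"
        proof (cases "norm y \<le> 1")
          case True
          have "norm (x + y) > 1" "norm (x - y) > 1"
            using False True norm_diff_ineq[of x y] norm_triangle_ineq2[of x y] by auto
          then have "sdiff \<phi> x y = 0" using False by (simp add: sdiff_def supp)
          then show ?thesis by (simp add: add_nonneg_nonneg)
        next
          case F: False
          have "\<bar>sdiff \<phi> x y\<bar> * frac_kernel p y \<le> (\<bar>\<phi> (x + y)\<bar> + \<bar>\<phi> (x - y)\<bar>) * (2 powr p * ?W y)"
            using False F p0 by (intro mult_mono frac_kernel_far_le) (auto simp: sdiff_def supp frac_kernel_nonneg)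
          then show ?thesis by (simp add: algebra_simps)
        qed
      qed (intro abs_sdiff_integrable[OF adm] Bochner_Integration.integrable_add integrable_mult_right abs_far_weight(1,2)[OF adm])+
      also have "\<dots> = 2 powr p * (2 * far ?W (\<lambda>x. \<bar>\<phi> x\<bar>) x)"
        using abs_far_weight(1-4)[OF adm, of x] by simp
      also have "\<dots> \<le> 2 powr p * (2 * (4 powr p * J * ?W x))"
      proof (intro mult_left_mono)
        have "far ?W (\<lambda>x. \<bar>\<phi> x\<bar>) x \<le> (\<integral>z. \<bar>\<phi> z\<bar> * (4 powr p * ?W x) \<partial>lborel)"
          unfolding far_def
        proof (rule integral_mono)
          have "integrable lborel (\<lambda>z. \<bar>\<phi> z\<bar> * ?W z)"
            using integrable_abs[OF admissible_weight[OF adm]] by (simp add: abs_mult)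
          then show "integrable lborel (\<lambda>z. \<bar>\<phi> z\<bar> * (1 + (norm (x - z))\<^sup>2) powr (- p))"
            using p0 admissible_measurable[OF adm] by (intro far_integrable[OF _ _ decay_0_weight]) auto
          fix z
          show "\<bar>\<phi> z\<bar> * (1 + (norm (x - z))\<^sup>2) powr (- p) \<le> \<bar>\<phi> z\<bar> * (4 powr p * ?W x)"
          proof (cases "norm z \<le> 1")
            case True
            then have "(norm z)\<^sup>2 \<le> 1\<^sup>2" by (intro power_mono) auto
            have "(1 + (norm (x - z))\<^sup>2) powr (- p) \<le> (2 * (1 + (norm z)\<^sup>2)) powr p * ?W x"
              using weight_shift[of p z x] p0 by (simp add: norm_minus_commute)
            also have "\<dots> \<le> 4 powr p * ?W x"
              using \<open>(norm z)\<^sup>2 \<le> 1\<^sup>2\<close> p0 by (intro mult_right_mono powr_mono2) auto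
            finally show ?thesis by (intro mult_left_mono) auto
          qed (simp add: supp)
        qed (use iphi in auto)
        also have "\<dots> = 4 powr p * J * ?W x" by (simp add: J_def)
        finally show "far ?W (\<lambda>x. \<bar>\<phi> x\<bar>) x \<le> 4 powr p * J * ?W x" .
      qed auto
      also have "\<dots> \<le> C * ?W x" using C1 by (simp add: C_def distrib_right)
      finally show ?thesis .
    qed
  qed
qed

lemma sdiff_measurable_pair:
  assumes [measurable]: "w \<in> borel_measurable borel"
  shows "(\<lambda>z. sdiff w (fst z) (snd z)) \<in> borel_measurable (lborel \<Otimes>\<^sub>M lborel)"
  unfolding sdiff_def by measurable

text \<open>For fixed y the second difference is a combination of translations by 0, y and -y;
  translation invariance moves each to the other factor, exchanging y and -y.\<close>

lemma sdiff_symmetric: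
  fixes \<phi> w :: "real^'n \<Rightarrow> real"
  assumes c: "continuous_on UNIV \<phi>" "continuous_on UNIV w" and supp: "\<And>x. norm x > 1 \<Longrightarrow> \<phi> x = 0"
  shows "(\<integral>x. \<phi> x * sdiff w x y \<partial>lborel) = (\<integral>x. w x * sdiff \<phi> x y \<partial>lborel)"
proof -
  have [measurable]: "\<phi> \<in> borel_measurable borel" "w \<in> borel_measurable borel"
    using c by (auto intro: continuous_borel_measurable)
  have int: "integrable lborel (\<lambda>x. \<phi> x * w (x + y))" for y
    by (rule integrable_unit_ball_support)
      (auto simp: supp intro!: continuous_intros c continuous_on_compose2[OF c(2)])
  have int': "integrable lborel (\<lambda>x. \<phi> (x - y) * w x)" for y
    using integrable_lborel_affine[of "\<lambda>x. \<phi> (x - y) * w x" 1 y] int[of y] by (simp add: add.commute)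
  have sh: "(\<integral>x. \<phi> (x - y) * w x \<partial>lborel) = (\<integral>x. \<phi> x * w (x + y) \<partial>lborel)" for y
    using integral_lborel_affine[of "\<lambda>x. \<phi> (x - y) * w x" 1 y] by (simp add: add.commute)
  \<comment> \<open>The zero shift is written out so that the identity \<open>sh\<close> rewrites
    all three terms alike.\<close>
  have "(\<integral>x. \<phi> x * sdiff w x y \<partial>lborel) = (\<integral>x. 2 * (\<phi> x * w (x + 0)) - \<phi> x * w (x + y) - \<phi> x * w (x + - y) \<partial>lborel)"
    by (intro Bochner_Integration.integral_cong) (auto simp: sdiff_def algebra_simps)
  also have "\<dots> = 2 * (\<integral>x. \<phi> x * w (x + 0) \<partial>lborel) - (\<integral>x. \<phi> x * w (x + y) \<partial>lborel) - (\<integral>x. \<phi> x * w (x + - y) \<partial>lborel)"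
    by (simp only: Bochner_Integration.integral_diff Bochner_Integration.integrable_diff integrable_mult_right int integral_mult_right_zero)
  also have "\<dots> = 2 * (\<integral>x. \<phi> (x - 0) * w x \<partial>lborel) - (\<integral>x. \<phi> (x - y) * w x \<partial>lborel) - (\<integral>x. \<phi> (x - - y) * w x \<partial>lborel)"
    by (simp only: sh)
  also have "\<dots> = (\<integral>x. 2 * (\<phi> (x - 0) * w x) - \<phi> (x - y) * w x - \<phi> (x - - y) * w x \<partial>lborel)"
    by (simp only: Bochner_Integration.integral_diff Bochner_Integration.integrable_diff integrable_mult_right int' integral_mult_right_zero)
  also have "\<dots> = (\<integral>x. w x * sdiff \<phi> x y \<partial>lborel)"
    by (intro Bochner_Integration.integral_cong) (auto simp: sdiff_def algebra_simps)
  finally show ?thesis .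
qed

text \<open>Fubini brings the x-integral inside, the symmetry for fixed y moves the second
  difference to the test function, and Fubini returns to the original order. That C is chosen before
  w matters: it is later applied to all rescalings of u.\<close>

lemma test_function_adjoint_bound:
  fixes \<phi> :: "real^'n \<Rightarrow> real"
  assumes \<phi>: "test_function \<phi>" and p: "real CARD('n) < 2 * p" "2 * p < real CARD('n) + 2"
  obtains C where "C \<ge> 0"
    "\<And>w. admissible p w \<Longrightarrow> \<bar>\<integral>x. \<phi> x * sdiff_integral p w x \<partial>lborel\<bar> \<le> C * (\<integral>x. \<bar>w x\<bar> * (1 + (norm x)\<^sup>2) powr (- p) \<partial>lborel)"
proof -
  have adm: "admissible p \<phi>" by (rule test_function_admissible[OF assms])
  have supp: "\<phi> x = 0" if "norm x > 1" for x using \<phi> that by (simp add: test_function_def)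
  have [measurable]: "\<phi> \<in> borel_measurable borel" by (rule admissible_measurable[OF adm])
  obtain C where C: "C \<ge> 0" "\<And>x. (\<integral>y. \<bar>sdiff \<phi> x y\<bar> * frac_kernel p y \<partial>lborel) \<le> C * (1 + (norm x)\<^sup>2) powr (- p)"
    using test_function_sdiff_decay[OF assms] by blast
  show thesis
  proof (rule that[OF C(1)])
    fix w :: "real^'n \<Rightarrow> real" assume w: "admissible p w"
    have [measurable]: "w \<in> borel_measurable borel" by (rule admissible_measurable[OF w])
    note [measurable] = sdiff_measurable_pair[of w] sdiff_measurable_pair[of \<phi>]
    define F1 where "F1 x y = \<phi> x * (sdiff w x y * frac_kernel p y)" for x y
    define F2 where "F2 x y = w x * (sdiff \<phi> x y * frac_kernel p y)" for x y
    have m1: "case_prod F1 \<in> borel_measurable (lborel \<Otimes>\<^sub>M lborel)"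
      unfolding F1_def[abs_def] case_prod_beta by measurable
    have m2: "case_prod F2 \<in> borel_measurable (lborel \<Otimes>\<^sub>M lborel)"
      unfolding F2_def[abs_def] case_prod_beta by measurable
    have n1: "(\<integral>y. norm (F1 x y) \<partial>lborel) = \<bar>\<phi> x\<bar> * (\<integral>y. \<bar>sdiff w x y\<bar> * frac_kernel p y \<partial>lborel)" for x
      by (simp add: F1_def abs_mult frac_kernel_nonneg)
    have n2: "(\<integral>y. norm (F2 x y) \<partial>lborel) = \<bar>w x\<bar> * (\<integral>y. \<bar>sdiff \<phi> x y\<bar> * frac_kernel p y \<partial>lborel)" for x
      by (simp add: F2_def abs_mult frac_kernel_nonneg)
    have mm: "(\<lambda>x. \<integral>y. norm (F1 x y) \<partial>lborel) \<in> borel_measurable lborel" "(\<lambda>x. \<integral>y. norm (F2 x y) \<partial>lborel) \<in> borel_measurable lborel"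
      using m1 m2 by measurable
    \<comment> \<open>The test function confines x to the unit ball, where the inner integral is
      bounded.\<close>
    have i1: "integrable (lborel \<Otimes>\<^sub>M lborel) (case_prod F1)"
    proof (rule lborel_pair.Fubini_integrable[OF m1])
      obtain H where H: "H \<ge> 0" "\<And>x. norm x \<le> 1 \<Longrightarrow> (\<integral>y. \<bar>sdiff w x y\<bar> * frac_kernel p y \<partial>lborel) \<le> H"
        using abs_sdiff_integral_bounded[OF w, where r = 1] by blast
      have "integrable lborel (\<lambda>x. \<bar>\<phi> x\<bar> * H)"
        by (rule integrable_unit_ball_support)
          (auto simp: supp intro!: continuous_intros admissible_continuous[OF adm])
      then have "integrable lborel (\<lambda>x. \<integral>y. norm (F1 x y) \<partial>lborel)"
      proof (rule Bochner_Integration.integrable_bound[OF _ mm(1)])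
        show "AE x in lborel. norm (\<integral>y. norm (F1 x y) \<partial>lborel) \<le> norm (\<bar>\<phi> x\<bar> * H)"
        proof (rule AE_I2)
          fix x
          have "\<bar>\<phi> x\<bar> * (\<integral>y. \<bar>sdiff w x y\<bar> * frac_kernel p y \<partial>lborel) \<le> \<bar>\<phi> x\<bar> * H"
            using H(2)[of x] by (cases "norm x \<le> 1") (auto simp: supp intro!: mult_left_mono)
          moreover have "0 \<le> (\<integral>y. norm (F1 x y) \<partial>lborel)" by simp
          ultimately show "norm (\<integral>y. norm (F1 x y) \<partial>lborel) \<le> norm (\<bar>\<phi> x\<bar> * H)"
            using H(1) unfolding n1 by (simp add: abs_mult)
        qed
      qed
      then show "integrable lborel (\<lambda>x. \<integral>y. norm (case_prod F1 (x, y)) \<partial>lborel)" by simp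
      show "AE x in lborel. integrable lborel (\<lambda>y. case_prod F1 (x, y))"
        unfolding F1_def[abs_def] prod.case
        by (intro AE_I2 integrable_mult_right sdiff_integral_split(1)[OF w])
    qed
    \<comment> \<open>Here x is unrestricted; the decay of the inner integral matches the weight
      against which w is integrable.\<close>
    have i2: "integrable (lborel \<Otimes>\<^sub>M lborel) (case_prod F2)" and b2: "integrable lborel (\<lambda>x. \<integral>y. norm (F2 x y) \<partial>lborel)"
    proof -
      have "integrable lborel (\<lambda>x. C * (\<bar>w x\<bar> * (1 + (norm x)\<^sup>2) powr (- p)))"
        using integrable_abs[OF admissible_weight[OF w]] by (intro integrable_mult_right) (simp add: abs_mult)
      then show b2: "integrable lborel (\<lambda>x. \<integral>y. norm (F2 x y) \<partial>lborel)"
      proof (rule Bochner_Integration.integrable_bound[OF _ mm(2)])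
        show "AE x in lborel. norm (\<integral>y. norm (F2 x y) \<partial>lborel) \<le> norm (C * (\<bar>w x\<bar> * (1 + (norm x)\<^sup>2) powr (- p)))"
        proof (rule AE_I2)
          fix x
          have "\<bar>w x\<bar> * (\<integral>y. \<bar>sdiff \<phi> x y\<bar> * frac_kernel p y \<partial>lborel) \<le> \<bar>w x\<bar> * (C * (1 + (norm x)\<^sup>2) powr (- p))"
            by (intro mult_left_mono C) auto
          moreover have "0 \<le> (\<integral>y. norm (F2 x y) \<partial>lborel)" by simp
          ultimately show "norm (\<integral>y. norm (F2 x y) \<partial>lborel) \<le> norm (C * (\<bar>w x\<bar> * (1 + (norm x)\<^sup>2) powr (- p)))"
            using C(1) unfolding n2 by (simp add: abs_mult mult_ac)
        qed
      qed
      show "integrable (lborel \<Otimes>\<^sub>M lborel) (case_prod F2)"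
      proof (rule lborel_pair.Fubini_integrable[OF m2])
        show "integrable lborel (\<lambda>x. \<integral>y. norm (case_prod F2 (x, y)) \<partial>lborel)" using b2 by simp
        show "AE x in lborel. integrable lborel (\<lambda>y. case_prod F2 (x, y))"
          unfolding F2_def[abs_def] prod.case
          by (intro AE_I2 integrable_mult_right sdiff_integral_split(1)[OF adm])
      qed
    qed
    have "(\<integral>x. \<phi> x * sdiff_integral p w x \<partial>lborel) = (\<integral>x. \<integral>y. F1 x y \<partial>lborel \<partial>lborel)"
      by (simp add: sdiff_integral_def F1_def)
    also have "\<dots> = (\<integral>y. \<integral>x. F1 x y \<partial>lborel \<partial>lborel)"
      by (rule lborel_pair.Fubini_integral[OF i1, symmetric])
    also have "\<dots> = (\<integral>y. \<integral>x. F2 x y \<partial>lborel \<partial>lborel)"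
    proof (rule Bochner_Integration.integral_cong[OF refl])
      fix y
      have "(\<integral>x. F1 x y \<partial>lborel) = (\<integral>x. frac_kernel p y * (\<phi> x * sdiff w x y) \<partial>lborel)"
        by (simp add: F1_def mult_ac)
      also have "\<dots> = frac_kernel p y * (\<integral>x. w x * sdiff \<phi> x y \<partial>lborel)"
        by (simp add: sdiff_symmetric[OF admissible_continuous[OF adm] admissible_continuous[OF w] supp])
      also have "\<dots> = (\<integral>x. frac_kernel p y * (w x * sdiff \<phi> x y) \<partial>lborel)" by simp
      also have "\<dots> = (\<integral>x. F2 x y \<partial>lborel)" by (simp add: F2_def mult_ac)
      finally show "(\<integral>x. F1 x y \<partial>lborel) = (\<integral>x. F2 x y \<partial>lborel)" .
    qed
    also have "\<dots> = (\<integral>x. \<integral>y. F2 x y \<partial>lborel \<partial>lborel)"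
      by (rule lborel_pair.Fubini_integral[OF i2])
    finally have "\<bar>\<integral>x. \<phi> x * sdiff_integral p w x \<partial>lborel\<bar> \<le> (\<integral>x. norm (\<integral>y. F2 x y \<partial>lborel) \<partial>lborel)"
      using integral_norm_bound[of lborel "\<lambda>x. \<integral>y. F2 x y \<partial>lborel"] by simp
    also have "\<dots> \<le> (\<integral>x. C * (\<bar>w x\<bar> * (1 + (norm x)\<^sup>2) powr (- p)) \<partial>lborel)"
    proof (rule integral_mono)
      show "integrable lborel (\<lambda>x. norm (\<integral>y. F2 x y \<partial>lborel))"
        using lborel_pair.integrable_fst'[OF i2] by (intro integrable_norm) simp
      show "integrable lborel (\<lambda>x. C * (\<bar>w x\<bar> * (1 + (norm x)\<^sup>2) powr (- p)))"
        using integrable_abs[OF admissible_weight[OF w]] by (intro integrable_mult_right) (simp add: abs_mult)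
      fix x
      have "norm (\<integral>y. F2 x y \<partial>lborel) \<le> (\<integral>y. norm (F2 x y) \<partial>lborel)" by (rule integral_norm_bound)
      also have "\<dots> \<le> \<bar>w x\<bar> * (C * (1 + (norm x)\<^sup>2) powr (- p))"
        unfolding n2 by (intro mult_left_mono C) auto
      finally show "norm (\<integral>y. F2 x y \<partial>lborel) \<le> C * (\<bar>w x\<bar> * (1 + (norm x)\<^sup>2) powr (- p))" by (simp add: mult_ac)
    qed
    also have "\<dots> = C * (\<integral>x. \<bar>w x\<bar> * (1 + (norm x)\<^sup>2) powr (- p) \<partial>lborel)" by simp
    finally show "\<bar>\<integral>x. \<phi> x * sdiff_integral p w x \<partial>lborel\<bar> \<le> C * (\<integral>x. \<bar>w x\<bar> * (1 + (norm x)\<^sup>2) powr (- p) \<partial>lborel)" .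
  qed
qed

subsection \<open>Averages against bumps\<close>

definition bump :: "nat \<Rightarrow> real^'n \<Rightarrow> real" where
  "bump N x = (max 0 (1 - (norm x)\<^sup>2)) ^ N"

lemma max_0_power_deriv:
  "((\<lambda>s::real. (max 0 s) ^ Suc (Suc N)) has_real_derivative real (Suc (Suc N)) * (max 0 s) ^ Suc N) (at s)"
proof -
  have pos: "((\<lambda>s::real. s ^ Suc (Suc N)) has_real_derivative real (Suc (Suc N)) * s ^ Suc N) (at s)" for s
    using DERIV_pow[of "Suc (Suc N)" s] by simp
  consider "s < 0" | "s = 0" | "s > 0" by linarith
  then show ?thesis
  proof cases
    case 1
    show ?thesis
      by (rule has_field_derivative_transform_within_open[of "\<lambda>s. 0" _ _ "{..<0}"]) (use 1 in auto)
  next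
    case 3
    have "((\<lambda>s::real. s ^ Suc (Suc N)) has_real_derivative real (Suc (Suc N)) * (max 0 s) ^ Suc N) (at s)"
      using pos[of s] 3 by simp
    then show ?thesis
      by (rule has_field_derivative_transform_within_open[of _ _ _ "{0<..}"]) (use 3 in auto)
  next
    case 2
    show ?thesis unfolding 2
    proof (rule has_real_derivative_glue)
      show "((\<lambda>s::real. (max 0 s) ^ Suc (Suc N)) has_real_derivative real (Suc (Suc N)) * (max 0 0) ^ Suc N) (at 0 within {..0})"
        by (rule has_field_derivative_transform_within[of "\<lambda>s. 0" _ _ _ 1]) auto
      have "((\<lambda>s::real. s ^ Suc (Suc N)) has_real_derivative real (Suc (Suc N)) * (max 0 0) ^ Suc N) (at 0 within {0..})"
        using has_field_derivative_at_within[OF pos[of 0]] by simp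
      then show "((\<lambda>s::real. (max 0 s) ^ Suc (Suc N)) has_real_derivative real (Suc (Suc N)) * (max 0 0) ^ Suc N) (at 0 within {0..})"
        by (rule has_field_derivative_transform_within[where d = 1]) auto
    qed
  qed
qed

lemma has_pd_bump:
  fixes i :: "'n::finite"
  shows "has_pd i (bump (Suc (Suc N))) (\<lambda>x. - 2 * real (Suc (Suc N)) * (x $ i * bump (Suc N) x))"
proof -
  have "has_pd i (\<lambda>x::real^'n. 1 + (-1) * (norm x)\<^sup>2) (\<lambda>x. 0 + (-1) * (2 * x $ i))"
    by (intro has_pd_add has_pd_const has_pd_cmult has_pd_norm_square)
  note has_pd_comp[OF this max_0_power_deriv[of N]]
  also have "(\<lambda>x::real^'n. (max 0 (1 + (-1) * (norm x)\<^sup>2)) ^ Suc (Suc N)) = bump (Suc (Suc N))"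
    by (simp add: bump_def fun_eq_iff)
  also have "(\<lambda>x::real^'n. real (Suc (Suc N)) * (max 0 (1 + (-1) * (norm x)\<^sup>2)) ^ Suc N * (0 + (-1) * (2 * x $ i))) =
      (\<lambda>x. - 2 * real (Suc (Suc N)) * (x $ i * bump (Suc N) x))"
    by (simp add: bump_def fun_eq_iff del: power_Suc of_nat_Suc)
  finally show ?thesis .
qed

lemma continuous_bump: "continuous_on UNIV (bump N)"
  unfolding bump_def[abs_def] by (intro continuous_intros)

lemma bump_nonneg: "bump N x \<ge> 0" by (simp add: bump_def)

lemma bump_outside: "norm x > 1 \<Longrightarrow> N > 0 \<Longrightarrow> bump N x = 0"
  using one_less_power[of "norm x" 2] by (simp add: bump_def)

lemma bump_C_k: "bump (Suc k) \<in> C_k k"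
proof (induction k)
  case 0
  show ?case by (simp add: C_k_0_iff continuous_bump)
next
  case (Suc k)
  show ?case
    by (rule C_k_SucI[OF continuous_bump has_pd_bump]) (intro C_k_cmult C_k_mult C_k_coord Suc.IH)
qed

text \<open>The bump with exponent k + 1 is of class C^k, so C^2 requires exponent 3.\<close>

lemma test_function_bump:
  assumes "N \<ge> 3" shows "test_function (bump N)"
proof -
  have "bump (Suc (N - 1)) \<in> C_k 2" by (rule C_k_mono[OF bump_C_k]) (use assms in simp)
  then show ?thesis using assms by (simp add: test_function_def bump_outside)
qed

lemma integral_bump_pos: "N > 0 \<Longrightarrow> integral\<^sup>L lborel (bump N :: real^'n \<Rightarrow> real) > 0"
proof -
  assume N: "N > 0"
  have fin: "emeasure lborel (cball (0::real^'n) (1/2)) < \<infinity>" by (rule emeasure_lborel_cball_finite)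
  \<comment> \<open>On the ball of radius 1/2 the base 1 - |x|^2 is at least 3/4.\<close>
  have "0 < (3/4::real) ^ N * measure lborel (cball (0::real^'n) (1/2))"
    using content_cball_gt_0_iff[of "0::real^'n" "1/2"] by simp
  also have "\<dots> = (\<integral>x. (3/4::real) ^ N * indicator (cball (0::real^'n) (1/2)) x \<partial>lborel)"
    using fin by simp
  also have "\<dots> \<le> integral\<^sup>L lborel (bump N :: real^'n \<Rightarrow> real)"
  proof (rule integral_mono)
    show "integrable lborel (\<lambda>x. (3/4::real) ^ N * indicator (cball (0::real^'n) (1/2)) x)"
      using fin by (intro integrable_mult_right integrable_real_indicator) auto
    show "integrable lborel (bump N :: real^'n \<Rightarrow> real)"
      by (rule integrable_unit_ball_support[OF continuous_bump bump_outside[OF _ N]])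
    fix x :: "real^'n"
    show "(3/4::real) ^ N * indicator (cball 0 (1/2)) x \<le> bump N x"
    proof (cases "norm x \<le> 1/2")
      case True
      then have "(norm x)\<^sup>2 \<le> (1/2)\<^sup>2" by (intro power_mono) auto
      then have "(3/4::real) ^ N \<le> bump N x" unfolding bump_def by (intro power_mono) (auto simp: power2_eq_square)
      then show ?thesis using True by simp
    qed (simp add: bump_nonneg)
  qed
  finally show ?thesis .
qed

text \<open>The integral of a translate of \<open>F\<close> does not depend on the translation; differentiating it gives
  the integral of \<open>F'\<close>, without Fubini.\<close>

lemma integral_pd_unit_ball_support:
  fixes F :: "real^'n \<Rightarrow> real"
  assumes pd: "has_pd i F F'" and c: "continuous_on UNIV F" "continuous_on UNIV F'"
    and supp: "\<And>x. norm x > 1 \<Longrightarrow> F x = 0" "\<And>x. norm x > 1 \<Longrightarrow> F' x = 0"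
  shows "integral\<^sup>L lborel F' = 0"
proof -
  have [measurable]: "F \<in> borel_measurable borel" using c by (auto intro: continuous_borel_measurable)
  obtain B where B: "B \<ge> 0" "\<And>x. norm x \<le> 1 \<Longrightarrow> \<bar>F' x\<bar> \<le> B"
    using continuous_bounded_on_cball[OF c(2), where r = 1] by blast
  have "has_pd i (\<lambda>x. \<integral>y. F (x + y) \<partial>lborel) (\<lambda>x. \<integral>y. F' (x + y) \<partial>lborel)"
  \<comment> \<open>If x + y lies in the unit ball and |x| <= r, then |y| <= r + 1.\<close>
  proof (rule has_pd_integral_dominated[where g = "\<lambda>r y. B * indicator (cball 0 (r + 1)) y"])
    show "integrable lborel (\<lambda>y. F (x + y))" for x
      using integrable_lborel_affine[of F 1 x] integrable_unit_ball_support[OF c(1) supp(1)] by simp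
    show "integrable lborel (\<lambda>y::real^'n. B * indicator (cball 0 (r + 1)) y)" for r
      using emeasure_lborel_cball_finite[of "0::real^'n" "r + 1"] by (intro integrable_mult_right integrable_real_indicator) auto
    show "has_pd i (\<lambda>x. F (x + y)) (\<lambda>x. F' (x + y))" for y by (rule has_pd_shift[OF pd])
    fix x y :: "real^'n" and r assume x: "norm x \<le> r"
    show "\<bar>F' (x + y)\<bar> \<le> B * indicator (cball 0 (r + 1)) y"
    proof (cases "norm (x + y) \<le> 1")
      case True
      have "norm y \<le> r + 1" using norm_triangle_ineq4[of "x + y" x] True x by simp
      then show ?thesis using B(2)[OF True] by simp
    qed (use B in \<open>simp add: supp\<close>)
  qed
  moreover have "(\<lambda>x. \<integral>y. F (x + y) \<partial>lborel) = (\<lambda>x. integral\<^sup>L lborel F)"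
    using integral_lborel_affine[of F 1] by (simp add: fun_eq_iff)
  ultimately have "has_pd i (\<lambda>x. integral\<^sup>L lborel F) (\<lambda>x. \<integral>y. F' (x + y) \<partial>lborel)" by simp
  then have "((\<lambda>t. integral\<^sup>L lborel F) has_real_derivative (\<integral>y. F' (0 + y) \<partial>lborel)) (at (0::real))"
    unfolding has_pd_def by blast
  from DERIV_unique[OF this DERIV_const] show ?thesis by simp
qed

text \<open>The variable is rescaled to the unit ball, so R enters only through g. No normalisation
  is made; the total mass of the bump appears explicitly instead.\<close>

definition average :: "nat \<Rightarrow> (real^'n \<Rightarrow> real) \<Rightarrow> real^'n \<Rightarrow> real \<Rightarrow> real" where
  "average N g z R = (\<integral>x. g (z + R *\<^sub>R x) * bump N x \<partial>lborel)"

text \<open>Since \<open>x * bump N x\<close> is, up to a constant, the gradient of \<open>bump (Suc N)\<close>, the derivative in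
  \<open>R\<close> is again an average, of the Laplacian.\<close>

lemma average_deriv:
  fixes g :: "real^'n \<Rightarrow> real"
  assumes g: "g \<in> C_k 2" and N: "N > 0"
  shows "(average N g z has_real_derivative
     - R / (2 * real (Suc N)) * average (Suc N) (neg_laplacian g) z R) (at R)"
proof -
  define g1 where "g1 i = partial_deriv i g" for i
  define g2 where "g2 i = partial_deriv i (partial_deriv i g)" for i
  have pd: "\<And>i. has_pd i g (g1 i)" "\<And>i. has_pd i (g1 i) (g2 i)"
    and c: "continuous_on UNIV g" "\<And>i. continuous_on UNIV (g1 i)" "\<And>i. continuous_on UNIV (g2 i)"
    using g by (auto simp: numeral_2_eq_2 C_k_Suc_iff C_k_0_iff g1_def g2_def)
  obtain M where M: "N = Suc M" using N by (cases N) auto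
  have cc: "continuous_on UNIV (\<lambda>x. h (z + t *\<^sub>R x))" if "continuous_on UNIV h" for h :: "real^'n \<Rightarrow> real" and t
    by (intro continuous_on_compose2[OF that] continuous_intros) auto
  have int: "integrable lborel (\<lambda>x. h (z + t *\<^sub>R x) * bump (Suc K) x)" if "continuous_on UNIV h" for h :: "real^'n \<Rightarrow> real" and t K
    by (rule integrable_unit_ball_support) (auto simp: bump_outside intro!: continuous_intros cc that continuous_bump)
  have int1: "integrable lborel (\<lambda>x. x $ i * g1 i (z + R *\<^sub>R x) * bump N x)" for i
    by (rule integrable_unit_ball_support) (auto simp: bump_outside N intro!: continuous_intros cc c continuous_bump)
  \<comment> \<open>The points z + t x with |x| <= 1 and |t - R| < 1 lie in this ball.\<close>
  have "\<forall>i. \<exists>B\<ge>0. \<forall>x. norm x \<le> norm z + \<bar>R\<bar> + 1 \<longrightarrow> \<bar>g1 i x\<bar> \<le> B"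
    using continuous_bounded_on_cball[OF c(2)] by metis
  then obtain B where B: "\<And>i. B i \<ge> 0" "\<And>i x. norm x \<le> norm z + \<bar>R\<bar> + 1 \<Longrightarrow> \<bar>g1 i x\<bar> \<le> B i" by metis
  have 1: "(average N g z has_real_derivative (\<integral>x. (\<Sum>i\<in>UNIV. x $ i * g1 i (z + R *\<^sub>R x)) * bump N x \<partial>lborel)) (at R)"
    unfolding average_def[abs_def]
  proof (rule has_real_derivative_integral_dominated[where g = "\<lambda>x. (\<Sum>i\<in>UNIV. B i) * bump N x"])
    show "integrable lborel (\<lambda>x. g (z + t *\<^sub>R x) * bump N x)" for t unfolding M by (rule int[OF c(1)])
    show "integrable lborel (\<lambda>x::real^'n. (\<Sum>i\<in>UNIV. B i) * bump N x)"
      by (intro integrable_mult_right integrable_unit_ball_support[OF continuous_bump bump_outside[OF _ N]])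
    fix t and x :: "real^'n" assume t: "\<bar>t - R\<bar> < 1"
    show "((\<lambda>t. g (z + t *\<^sub>R x) * bump N x) has_real_derivative (\<Sum>i\<in>UNIV. x $ i * g1 i (z + t *\<^sub>R x)) * bump N x) (at t)"
      by (intro DERIV_cmult_right has_real_derivative_along_line pd c)
    show "\<bar>(\<Sum>i\<in>UNIV. x $ i * g1 i (z + t *\<^sub>R x)) * bump N x\<bar> \<le> (\<Sum>i\<in>UNIV. B i) * bump N x"
    proof (cases "norm x \<le> 1")
      case True
      have "norm (t *\<^sub>R x) \<le> (\<bar>R\<bar> + 1) * 1" unfolding norm_scaleR using t True by (intro mult_mono) auto
      then have nz: "norm (z + t *\<^sub>R x) \<le> norm z + \<bar>R\<bar> + 1" using norm_triangle_ineq[of z "t *\<^sub>R x"] by simp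
      have "\<bar>\<Sum>i\<in>UNIV. x $ i * g1 i (z + t *\<^sub>R x)\<bar> \<le> (\<Sum>i\<in>UNIV. 1 * B i)"
      proof (intro sum_abs[THEN order_trans] sum_mono)
        fix i
        have "\<bar>x $ i\<bar> \<le> 1" using component_le_norm_cart[of x i] True by linarith
        then show "\<bar>x $ i * g1 i (z + t *\<^sub>R x)\<bar> \<le> 1 * B i"
          unfolding abs_mult by (intro mult_mono B(2)[OF nz]) auto
      qed
      then show ?thesis by (simp add: abs_mult bump_nonneg mult_right_mono)
    qed (simp add: bump_outside N)
  qed
  have 2: "(\<integral>x. x $ i * g1 i (z + R *\<^sub>R x) * bump N x \<partial>lborel) = R / (2 * real (Suc N)) * (\<integral>x. g2 i (z + R *\<^sub>R x) * bump (Suc N) x \<partial>lborel)" for i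
  proof -
    \<comment> \<open>Integration by parts: the integral of the i-th derivative of F vanishes, and
      its two product-rule terms are the two sides to be compared.\<close>
    define F where "F x = g1 i (z + R *\<^sub>R x) * bump (Suc N) x" for x
    define F' where "F' x = R * g2 i (z + R *\<^sub>R x) * bump (Suc N) x + g1 i (z + R *\<^sub>R x) * (- 2 * real (Suc N) * (x $ i * bump N x))" for x
    have "integral\<^sup>L lborel F' = 0"
    proof (rule integral_pd_unit_ball_support)
      show "has_pd i F F'" unfolding F_def[abs_def] F'_def[abs_def] M
        by (rule has_pd_mult[OF has_pd_scale[OF pd(2)] has_pd_bump])
    qed (auto simp: F_def[abs_def] F'_def[abs_def] bump_outside N intro!: continuous_intros cc c continuous_bump)
    moreover have "F' = (\<lambda>x. R * (g2 i (z + R *\<^sub>R x) * bump (Suc N) x) - 2 * real (Suc N) * (x $ i * g1 i (z + R *\<^sub>R x) * bump N x))"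
      by (simp add: F'_def fun_eq_iff mult_ac del: of_nat_Suc)
    ultimately have "R * (\<integral>x. g2 i (z + R *\<^sub>R x) * bump (Suc N) x \<partial>lborel) - 2 * real (Suc N) * (\<integral>x. x $ i * g1 i (z + R *\<^sub>R x) * bump N x \<partial>lborel) = 0"
      using int[OF c(3)[of i], of R N] int1[of i]
      by (simp only: Bochner_Integration.integral_diff integrable_mult_right integral_mult_right_zero)
    then show ?thesis by (simp add: field_simps del: of_nat_Suc)
  qed
  have "(\<integral>x. (\<Sum>i\<in>UNIV. x $ i * g1 i (z + R *\<^sub>R x)) * bump N x \<partial>lborel) = (\<Sum>i\<in>UNIV. \<integral>x. x $ i * g1 i (z + R *\<^sub>R x) * bump N x \<partial>lborel)"
    unfolding sum_distrib_right by (rule Bochner_Integration.integral_sum) (rule int1)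
  also have "\<dots> = R / (2 * real (Suc N)) * (\<Sum>i\<in>UNIV. \<integral>x. g2 i (z + R *\<^sub>R x) * bump (Suc N) x \<partial>lborel)"
    by (simp only: 2 sum_distrib_left)
  also have "(\<Sum>i\<in>UNIV. \<integral>x. g2 i (z + R *\<^sub>R x) * bump (Suc N) x \<partial>lborel) = (\<integral>x. (\<Sum>i\<in>UNIV. g2 i (z + R *\<^sub>R x)) * bump (Suc N) x \<partial>lborel)"
    unfolding sum_distrib_right by (rule Bochner_Integration.integral_sum[symmetric]) (rule int[OF c(3)])
  also have "\<dots> = - average (Suc N) (neg_laplacian g) z R"
    by (simp add: average_def neg_laplacian_def g2_def)
  finally show ?thesis using 1 by simp
qed

lemma average_tendsto_0_not_bounded_below:
  assumes "((\<lambda>R. average N g z R) \<longlongrightarrow> 0) at_top" "c > 0" "\<forall>\<^sub>F R in at_top. \<bar>average N g z R\<bar> \<ge> c"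
  shows False
proof -
  have "\<forall>\<^sub>F R in at_top. \<bar>average N g z R\<bar> < c"
    using tendstoD[OF assms(1,2)] by (simp add: dist_real_def)
  with assms(3) have "\<forall>\<^sub>F R::real in at_top. False" by eventually_elim simp
  then show False by simp
qed

text \<open>F grows at least linearly, hence passes every level; the value 1 is as good as any
  positive constant for the next step of the descent.\<close>

lemma eventually_ge_of_deriv_ge:
  fixes F :: "real \<Rightarrow> real"
  assumes d: "d > 0" and F: "\<And>R. (F has_real_derivative F' R) (at R)" and F': "\<forall>\<^sub>F R in at_top. F' R \<ge> d"
  shows "\<forall>\<^sub>F R in at_top. F R \<ge> 1"
proof -
  obtain R0 where R0: "\<And>R. R \<ge> R0 \<Longrightarrow> F' R \<ge> d" using F' unfolding eventually_at_top_linorder by blast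
  have le: "F R0 + d * (R - R0) \<le> F R" if "R \<ge> R0" for R
  proof -
    have "(\<lambda>R. F R - d * R) R0 \<le> (\<lambda>R. F R - d * R) R"
    proof (rule DERIV_nonneg_imp_nondecreasing[OF that])
      fix x assume "R0 \<le> x" "x \<le> R"
      then show "\<exists>y. ((\<lambda>R. F R - d * R) has_real_derivative y) (at x) \<and> 0 \<le> y"
        using R0[of x] by (intro exI[of _ "F' x - d"]) (auto intro!: derivative_eq_intros F)
    qed
    then show ?thesis by (simp add: algebra_simps)
  qed
  have "F R \<ge> 1" if "R \<ge> R0 + (1 + \<bar>F R0\<bar>) / d" for R
  proof -
    have "(1 + \<bar>F R0\<bar>) / d \<le> R - R0" using that by simp
    then have "1 + \<bar>F R0\<bar> \<le> d * (R - R0)" using d by (simp add: divide_le_eq mult.commute)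
    moreover have "R \<ge> R0" using that d by (smt (verit) abs_ge_zero divide_nonneg_pos)
    ultimately show ?thesis using le[of R] by linarith
  qed
  then show ?thesis unfolding eventually_at_top_linorder by blast
qed

text \<open>The sign alternates from one level to the next because \<open>v (Suc i)\<close> is the negative Laplacian
  of \<open>v i\<close>.\<close>

lemma average_descent:
  fixes v :: "nat \<Rightarrow> real^'n \<Rightarrow> real"
  assumes v: "\<And>j. j < i \<Longrightarrow> v j \<in> C_k 2 \<and> v (Suc j) = neg_laplacian (v j)"
    and N: "N > 0" and s: "\<bar>s\<bar> = 1" and c: "c > 0" "\<forall>\<^sub>F R in at_top. s * average (N + i) (v i) z R \<ge> c"
  shows "\<exists>c>0. \<forall>\<^sub>F R in at_top. \<bar>average N (v 0) z R\<bar> \<ge> c"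
  using v s c
proof (induction i arbitrary: s c)
  case 0
  from 0(4) have "\<forall>\<^sub>F R in at_top. \<bar>average N (v 0) z R\<bar> \<ge> c"
  proof eventually_elim
    case (elim R)
    have "s * average (N + 0) (v 0) z R \<le> \<bar>s * average N (v 0) z R\<bar>" by simp
    also have "\<dots> = \<bar>average N (v 0) z R\<bar>" using 0(2) by (simp add: abs_mult)
    finally show ?case using elim by simp
  qed
  with 0(3) show ?case by blast
next
  case (Suc i)
  define F where "F R = - s * average (N + i) (v i) z R" for R
  define F' where "F' R = R / (2 * real (Suc (N + i))) * (s * average (Suc (N + i)) (v (Suc i)) z R)" for R
  \<comment> \<open>For R >= 1 the factor R in the derivative of the average is bounded below by 1,
    which leaves this constant.\<close>
  define d where "d = c / (2 * real (Suc (N + i)))"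
  have d: "d > 0" using Suc.prems(3) by (simp add: d_def)
  have vi: "v i \<in> C_k 2" "v (Suc i) = neg_laplacian (v i)" using Suc.prems(1)[of i] by auto
  have F: "(F has_real_derivative F' R) (at R)" for R
    unfolding F_def[abs_def]
    using DERIV_cmult[OF average_deriv[OF vi(1), of "N + i" z R], of "- s"] N by (simp add: F'_def vi(2) mult_ac)
  have "\<forall>\<^sub>F R in at_top. F' R \<ge> d"
    using Suc.prems(4) eventually_ge_at_top[of 1]
  proof eventually_elim
    case (elim R)
    have "c \<le> s * average (Suc (N + i)) (v (Suc i)) z R" using elim by simp
    then have "1 / (2 * real (Suc (N + i))) * c \<le> R / (2 * real (Suc (N + i))) * (s * average (Suc (N + i)) (v (Suc i)) z R)"
      using elim Suc.prems(3) by (intro mult_mono divide_right_mono) auto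
    then show ?case by (simp add: d_def F'_def)
  qed
  from eventually_ge_of_deriv_ge[OF d F this] have "\<forall>\<^sub>F R in at_top. (- s) * average (N + i) (v i) z R \<ge> 1"
    by (simp add: F_def)
  from Suc.IH[OF Suc.prems(1) _ _ this] Suc.prems(2) show ?case by simp
qed

text \<open>At R = 0 the average is the value at the centre times the mass of the bump, and the sign
  of the Laplacian makes it nondecreasing in R.\<close>

lemma average_lower_bound:
  fixes g :: "real^'n \<Rightarrow> real"
  assumes g: "g \<in> C_k 2" and N: "N > 0" and le: "\<And>x. neg_laplacian g x \<le> 0" and R: "R \<ge> 0"
  shows "g z * integral\<^sup>L lborel (bump N :: real^'n \<Rightarrow> real) \<le> average N g z R"
proof -
  have "average N g z 0 \<le> average N g z R"
  proof (rule DERIV_nonneg_imp_nondecreasing[OF R])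
    fix x :: real assume x: "0 \<le> x"
    have "0 \<le> (\<integral>y. - (neg_laplacian g (z + x *\<^sub>R y) * bump (Suc N) y) \<partial>lborel)"
      by (rule integral_nonneg_AE) (auto intro!: AE_I2 mult_nonpos_nonneg le bump_nonneg)
    then have "average (Suc N) (neg_laplacian g) z x \<le> 0" by (simp add: average_def)
    then have "0 \<le> x / (2 * real (Suc N)) * (- average (Suc N) (neg_laplacian g) z x)"
      using x by (intro mult_nonneg_nonneg divide_nonneg_nonneg) auto
    then have "0 \<le> - x / (2 * real (Suc N)) * average (Suc N) (neg_laplacian g) z x" by simp
    then show "\<exists>y. (average N g z has_real_derivative y) (at x) \<and> 0 \<le> y"
      using average_deriv[OF g N] by blast
  qed
  moreover have "average N g z 0 = g z * integral\<^sup>L lborel (bump N :: real^'n \<Rightarrow> real)"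
    by (simp add: average_def)
  ultimately show ?thesis by simp
qed

lemma super_polyharmonic_step:
  fixes v :: "nat \<Rightarrow> real^'n \<Rightarrow> real"
  assumes v: "\<And>j. j \<le> i \<Longrightarrow> v j \<in> C_k 2 \<and> v (Suc j) = neg_laplacian (v j)"
    and le: "\<And>x. v (Suc i) x \<le> 0" and N: "N > 0"
    and lim: "\<And>z. ((\<lambda>R. average N (v 0) z R) \<longlongrightarrow> 0) at_top"
  shows "v i z \<le> 0"
proof (rule ccontr)
  assume "\<not> v i z \<le> 0"
  \<comment> \<open>Exponent N + i at level i becomes exponent N at level 0, since each step of the
    descent lowers it by one.\<close>
  define c where "c = v i z * integral\<^sup>L lborel (bump (N + i) :: real^'n \<Rightarrow> real)"
  have c: "c > 0" using \<open>\<not> v i z \<le> 0\<close> N by (simp add: c_def integral_bump_pos)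
  have ev: "\<forall>\<^sub>F R in at_top. 1 * average (N + i) (v i) z R \<ge> c"
    using eventually_ge_at_top[of 0]
  proof eventually_elim
    case (elim R)
    then show ?case unfolding c_def using v[of i] le N average_lower_bound[of "v i" "N + i" R z] by auto
  qed
  have "v j \<in> C_k 2 \<and> v (Suc j) = neg_laplacian (v j)" if "j < i" for j using v[of j] that by simp
  then obtain c' where "c' > 0" "\<forall>\<^sub>F R in at_top. \<bar>average N (v 0) z R\<bar> \<ge> c'"
    using average_descent[of i v N 1 c z] N c ev by auto
  with average_tendsto_0_not_bounded_below[OF lim] show False by blast
qed

section \<open>Rescaling, and the limit of the averages at level 0\<close>

lemma weight_scaled_integrable:
  fixes u :: "real^'n \<Rightarrow> real"
  assumes u: "admissible p u" and R: "R \<ge> 1"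
  shows "integrable lborel (\<lambda>y. \<bar>u y\<bar> * (R\<^sup>2 + (norm (z - y))\<^sup>2) powr (- p))"
proof -
  have p: "p > 0" using admissible_p[OF u] by simp
  have [measurable]: "u \<in> borel_measurable borel" by (rule admissible_measurable[OF u])
  have "integrable lborel (\<lambda>y. u y * (1 + (norm (z - y))\<^sup>2) powr (- p))"
    using p by (intro far_integrable[OF _ admissible_weight[OF u] decay_0_weight]) auto
  then show ?thesis
  proof (rule Bochner_Integration.integrable_bound)
    show "AE y in lborel. norm (\<bar>u y\<bar> * (R\<^sup>2 + (norm (z - y))\<^sup>2) powr (- p)) \<le> norm (u y * (1 + (norm (z - y))\<^sup>2) powr (- p))"
      using R p by (auto intro!: AE_I2 mult_left_mono powr_mono2' simp: abs_mult add_pos_nonneg one_le_power)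
  qed measurable
qed

lemma scaled_weight_eq:
  fixes x z :: "real^'n"
  assumes "R > 0"
  shows "(R\<^sup>2 + (norm (z - (z + R *\<^sub>R x)))\<^sup>2) powr (- p) = R powr (- (2 * p)) * (1 + (norm x)\<^sup>2) powr (- p)"
proof -
  have "R\<^sup>2 + (norm (z - (z + R *\<^sub>R x)))\<^sup>2 = R\<^sup>2 * (1 + (norm x)\<^sup>2)"
    using assms by (simp add: power_mult_distrib algebra_simps)
  moreover have "(R\<^sup>2) powr (- p) = R powr (- (2 * p))"
    using norm_square_powr[of R "- p"] assms by simp
  ultimately show ?thesis by (simp add: powr_mult)
qed

lemma scaled_weight_integral:
  fixes u :: "real^'n \<Rightarrow> real"
  assumes u: "admissible p u" and R: "R \<ge> 1"
  shows "integrable lborel (\<lambda>x. \<bar>u (z + R *\<^sub>R x)\<bar> * (1 + (norm x)\<^sup>2) powr (- p))"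
    "R powr (real CARD('n) - 2 * p) * (\<integral>x. \<bar>u (z + R *\<^sub>R x)\<bar> * (1 + (norm x)\<^sup>2) powr (- p) \<partial>lborel) =
      (\<integral>y. \<bar>u y\<bar> * (R\<^sup>2 + (norm (z - y))\<^sup>2) powr (- p) \<partial>lborel)"
proof -
  have R0: "R > 0" using R by simp
  have [measurable]: "u \<in> borel_measurable borel" by (rule admissible_measurable[OF u])
  let ?f = "\<lambda>y. \<bar>u y\<bar> * (R\<^sup>2 + (norm (z - y))\<^sup>2) powr (- p)"
  let ?g = "\<lambda>x. \<bar>u (z + R *\<^sub>R x)\<bar> * (1 + (norm x)\<^sup>2) powr (- p)"
  have eq: "(\<lambda>x. ?f (z + R *\<^sub>R x)) = (\<lambda>x. R powr (- (2 * p)) * ?g x)"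
    by (simp only: scaled_weight_eq[OF R0] mult_ac)
  have "integrable lborel (\<lambda>x. ?f (z + R *\<^sub>R x))"
    using integrable_lborel_affine[of ?f R z] weight_scaled_integrable[OF u R] R0 by simp
  then have "integrable lborel (\<lambda>x. R powr (2 * p) * (R powr (- (2 * p)) * ?g x))"
    unfolding eq by (rule integrable_mult_right)
  moreover have "R powr (2 * p) * (R powr (- (2 * p)) * a) = a" for a
    using R0 by (simp add: powr_add[symmetric] mult.assoc[symmetric])
  ultimately show "integrable lborel ?g" by simp
  have "integral\<^sup>L lborel ?f = \<bar>R\<bar> ^ DIM(real^'n) * (\<integral>x. ?f (z + R *\<^sub>R x) \<partial>lborel)"
    by (rule integral_lborel_affine) (use R0 in auto)
  also have "\<dots> = R powr real CARD('n) * (R powr (- (2 * p)) * integral\<^sup>L lborel ?g)"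
    unfolding eq using R0 by (simp add: powr_realpow)
  also have "\<dots> = R powr (real CARD('n) - 2 * p) * integral\<^sup>L lborel ?g"
    using powr_add[of R "real CARD('n)" "- (2 * p)"] by (simp add: mult.assoc)
  finally show "R powr (real CARD('n) - 2 * p) * integral\<^sup>L lborel ?g = integral\<^sup>L lborel ?f" by simp
qed

lemma sdiff_scale: "sdiff (\<lambda>x. u (z + R *\<^sub>R x)) x y = sdiff u (z + R *\<^sub>R x) (R *\<^sub>R y)"
  by (simp add: sdiff_def algebra_simps)

lemma admissible_scale:
  fixes u :: "real^'n \<Rightarrow> real"
  assumes u: "admissible p u" and R: "R \<ge> 1"
  shows "admissible p (\<lambda>x. u (z + R *\<^sub>R x))"
proof -
  have [measurable]: "u \<in> borel_measurable borel" by (rule admissible_measurable[OF u])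
  obtain \<beta> where \<beta>: "2 * p < real CARD('n) + \<beta>" "sdiff_bounded \<beta> u"
    using u by (auto simp: admissible_def)
  obtain C where C: "\<And>r. C r \<ge> 0" "\<And>r x y. norm x \<le> r \<Longrightarrow> norm y \<le> r \<Longrightarrow> \<bar>sdiff u x y\<bar> \<le> C r * norm y powr \<beta>"
    using sdiff_boundedE[OF \<beta>(2)] by blast
  have "sdiff_bounded \<beta> (\<lambda>x. u (z + R *\<^sub>R x))"
    unfolding sdiff_bounded_def
  proof (intro conjI allI)
    show "continuous_on UNIV (\<lambda>x. u (z + R *\<^sub>R x))"
      by (intro continuous_on_compose2[OF admissible_continuous[OF u]] continuous_intros) auto
    fix r
    show "\<exists>C. \<forall>x y. norm x \<le> r \<longrightarrow> norm y \<le> r \<longrightarrow> \<bar>sdiff (\<lambda>x. u (z + R *\<^sub>R x)) x y\<bar> \<le> C * norm y powr \<beta>"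
    \<comment> \<open>The map x -> z + R x sends the ball of radius r into that of radius |z| + R r,
      and rescaling y brings out R^\<beta>.\<close>
    proof (intro exI[of _ "C (norm z + R * r) * R powr \<beta>"] allI impI)
      fix x y :: "real^'n" assume xy: "norm x \<le> r" "norm y \<le> r"
      have "norm (z + R *\<^sub>R x) \<le> norm z + R * norm x"
        using norm_triangle_ineq[of z "R *\<^sub>R x"] R by simp
      also have "\<dots> \<le> norm z + R * r" using xy R by simp
      finally have 1: "norm (z + R *\<^sub>R x) \<le> norm z + R * r" .
      have "norm (R *\<^sub>R y) \<le> R * r" using xy R by simp
      then have 2: "norm (R *\<^sub>R y) \<le> norm z + R * r" using norm_ge_zero[of z] by linarith
      from C(2)[OF 1 2] show "\<bar>sdiff (\<lambda>x. u (z + R *\<^sub>R x)) x y\<bar> \<le> C (norm z + R * r) * R powr \<beta> * norm y powr \<beta>"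
        using R by (simp add: sdiff_scale powr_mult mult.assoc)
    qed
  qed
  moreover have "integrable lborel (\<lambda>x. u (z + R *\<^sub>R x) * (1 + (norm x)\<^sup>2) powr (- p))"
    by (rule Bochner_Integration.integrable_bound[OF scaled_weight_integral(1)[OF u R, of z]]) (auto simp: abs_mult)
  ultimately show ?thesis using \<beta> admissible_p(1)[OF u] unfolding admissible_def by blast
qed

text \<open>The Jacobian contributes R^n and the kernel R^(-2p); together they are R^(-\<alpha>),
  the homogeneity of the operator.\<close>

lemma sdiff_integral_scale:
  fixes u :: "real^'n \<Rightarrow> real"
  assumes u: "u \<in> borel_measurable borel" and R: "R > 0"
  shows "sdiff_integral p u (z + R *\<^sub>R x) = R powr (real CARD('n) - 2 * p) * sdiff_integral p (\<lambda>x. u (z + R *\<^sub>R x)) x"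
proof -
  have [measurable]: "u \<in> borel_measurable borel" by (rule u)
  let ?f = "\<lambda>y. sdiff u (z + R *\<^sub>R x) y * frac_kernel p y"
  have [measurable]: "?f \<in> borel_measurable borel" unfolding sdiff_def by measurable
  have eq: "?f (0 + R *\<^sub>R y) = R powr (- (2 * p)) * (sdiff (\<lambda>x. u (z + R *\<^sub>R x)) x y * frac_kernel p y)" for y
    using R by (simp add: sdiff_scale frac_kernel_def powr_mult)
  have "sdiff_integral p u (z + R *\<^sub>R x) = \<bar>R\<bar> ^ DIM(real^'n) * (\<integral>y. ?f (0 + R *\<^sub>R y) \<partial>lborel)"
    unfolding sdiff_integral_def by (rule integral_lborel_affine) (use R in auto)
  also have "\<dots> = R powr real CARD('n) * (R powr (- (2 * p)) * sdiff_integral p (\<lambda>x. u (z + R *\<^sub>R x)) x)"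
    unfolding eq sdiff_integral_def using R by (simp add: powr_realpow)
  also have "\<dots> = R powr (real CARD('n) - 2 * p) * sdiff_integral p (\<lambda>x. u (z + R *\<^sub>R x)) x"
    using powr_add[of R "real CARD('n)" "- (2 * p)"] by (simp add: mult.assoc)
  finally show ?thesis .
qed

lemma scaled_weight_tendsto_0:
  fixes u :: "real^'n \<Rightarrow> real"
  assumes u: "admissible p u"
  shows "((\<lambda>R. \<integral>y. \<bar>u y\<bar> * (R\<^sup>2 + (norm (z - y))\<^sup>2) powr (- p) \<partial>lborel) \<longlongrightarrow> 0) at_top"
proof -
  have p: "p > 0" using admissible_p[OF u] by simp
  have [measurable]: "u \<in> borel_measurable borel" by (rule admissible_measurable[OF u])
  have "((\<lambda>R. \<integral>y. \<bar>u y\<bar> * (R\<^sup>2 + (norm (z - y))\<^sup>2) powr (- p) \<partial>lborel) \<longlongrightarrow> integral\<^sup>L lborel (\<lambda>y::real^'n. 0::real)) at_top"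
  \<comment> \<open>The integrand decreases in R, so its value at R = 1 dominates.\<close>
  proof (rule integral_dominated_convergence_at_top[where w = "\<lambda>y. \<bar>u y\<bar> * (1\<^sup>2 + (norm (z - y))\<^sup>2) powr (- p)"])
    show "integrable lborel (\<lambda>y. \<bar>u y\<bar> * (1\<^sup>2 + (norm (z - y))\<^sup>2) powr (- p))"
      by (rule weight_scaled_integrable[OF u]) simp
    show "AE y in lborel. ((\<lambda>R. \<bar>u y\<bar> * (R\<^sup>2 + (norm (z - y))\<^sup>2) powr (- p)) \<longlongrightarrow> 0) at_top"
    proof (rule AE_I2)
      fix y
      have "filterlim (\<lambda>R::real. (norm (z - y))\<^sup>2 + R\<^sup>2) at_top at_top"
        by (intro filterlim_tendsto_add_at_top[OF tendsto_const] filterlim_pow_at_top filterlim_ident) simp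
      then have "filterlim (\<lambda>R::real. R\<^sup>2 + (norm (z - y))\<^sup>2) at_top at_top" by (simp add: add.commute)
      then have "((\<lambda>R::real. (R\<^sup>2 + (norm (z - y))\<^sup>2) powr (- p)) \<longlongrightarrow> 0) at_top"
        using p by (intro tendsto_neg_powr) auto
      then show "((\<lambda>R. \<bar>u y\<bar> * (R\<^sup>2 + (norm (z - y))\<^sup>2) powr (- p)) \<longlongrightarrow> 0) at_top"
        by (rule tendsto_mult_right_zero)
    qed
    show "\<forall>\<^sub>F R in at_top. AE y in lborel. norm (\<bar>u y\<bar> * (R\<^sup>2 + (norm (z - y))\<^sup>2) powr (- p)) \<le> \<bar>u y\<bar> * (1\<^sup>2 + (norm (z - y))\<^sup>2) powr (- p)"
      using eventually_ge_at_top[of 1]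
    proof eventually_elim
      case (elim R)
      then show ?case using p
        by (auto intro!: AE_I2 mult_left_mono powr_mono2' simp: add_pos_nonneg one_le_power)
    qed
  qed measurable
  then show ?thesis by simp
qed

text \<open>Apply the adjoint bound to u(z + R x). The factor R^(n - 2p) from the operator is the
  one needed to turn the weighted integral of the rescaled function back into an integral of
  |u|.\<close>

lemma average_sdiff_integral_tendsto_0:
  fixes u :: "real^'n \<Rightarrow> real"
  assumes u: "admissible p u" and p: "2 * p < real CARD('n) + 2" and N: "N \<ge> 3"
  shows "((\<lambda>R. average N (sdiff_integral p u) z R) \<longlongrightarrow> 0) at_top"
proof -
  obtain C where C: "C \<ge> 0"
    "\<And>w :: real^'n \<Rightarrow> real. admissible p w \<Longrightarrow> \<bar>\<integral>x. bump N x * sdiff_integral p w x \<partial>lborel\<bar> \<le> C * (\<integral>x. \<bar>w x\<bar> * (1 + (norm x)\<^sup>2) powr (- p) \<partial>lborel)"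
    using test_function_adjoint_bound[OF test_function_bump[OF N] admissible_p(1)[OF u] p] by blast
  let ?I = "\<lambda>R. \<integral>y. \<bar>u y\<bar> * (R\<^sup>2 + (norm (z - y))\<^sup>2) powr (- p) \<partial>lborel"
  have bound: "\<bar>average N (sdiff_integral p u) z R\<bar> \<le> C * ?I R" if R: "R \<ge> 1" for R
  proof -
    let ?w = "\<lambda>x. u (z + R *\<^sub>R x)" and ?s = "R powr (real CARD('n) - 2 * p)"
    have R0: "R > 0" using R by simp
    have "average N (sdiff_integral p u) z R = ?s * (\<integral>x. bump N x * sdiff_integral p ?w x \<partial>lborel)"
      unfolding average_def sdiff_integral_scale[OF admissible_measurable[OF u] R0]
      by (simp add: mult_ac flip: integral_mult_right_zero)
    then have "\<bar>average N (sdiff_integral p u) z R\<bar> = ?s * \<bar>\<integral>x. bump N x * sdiff_integral p ?w x \<partial>lborel\<bar>"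
      by (simp add: abs_mult)
    also have "\<dots> \<le> ?s * (C * (\<integral>x. \<bar>?w x\<bar> * (1 + (norm x)\<^sup>2) powr (- p) \<partial>lborel))"
      by (intro mult_left_mono C(2) admissible_scale[OF u R]) simp
    also have "\<dots> = C * ?I R" using scaled_weight_integral(2)[OF u R, of z] by (simp add: mult_ac)
    finally show ?thesis .
  qed
  have "((\<lambda>R. C * ?I R) \<longlongrightarrow> 0) at_top"
    by (rule tendsto_mult_right_zero[OF scaled_weight_tendsto_0[OF u]])
  then show ?thesis
    by (rule Lim_null_comparison[rotated])
      (use bound in \<open>auto simp: eventually_at_top_linorder intro!: exI[of _ 1]\<close>)
qed

lemma average_cmult: "average N (\<lambda>x. c * g x) z R = c * average N g z R"
  by (simp add: average_def mult.assoc)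

theorem theorem1p2:
  fixes u :: "real^'n \<Rightarrow> real"
    and f :: "real^'n \<Rightarrow> ('n list \<Rightarrow> real) \<Rightarrow> real"
    and m :: nat and \<alpha> :: real
  assumes "CARD('n) \<ge> 2" and "m \<ge> 1" and "0 < \<alpha>" and "\<alpha> < 2"
    and f_cont: "continuous_on UNIV (\<lambda>x. f x (jet (2 * m + nat \<lfloor>\<alpha>\<rfloor>) u x))"
    and f_nonpos: "\<And>x. f x (jet (2 * m + nat \<lfloor>\<alpha>\<rfloor>) u x) \<le> 0"
    and u_reg: "\<exists>\<epsilon>>0. frac \<alpha> + \<epsilon> \<le> 1 \<and> u \<in> C_k_holder_loc (2 * m + nat \<lfloor>\<alpha>\<rfloor>) (frac \<alpha> + \<epsilon>)"
    and u_L: "u \<in> L_frac \<alpha>"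
    and u_nonneg: "\<And>x. u x \<ge> 0"
    and eqn: "\<And>x. higher_frac_laplacian m \<alpha> u x = f x (jet (2 * m + nat \<lfloor>\<alpha>\<rfloor>) u x)"
  shows "\<forall>i\<in>{0..m-1}. \<forall>x. higher_frac_laplacian i \<alpha> u x \<le> 0"
proof -
  obtain \<epsilon> where \<epsilon>: "\<epsilon> > 0" "frac \<alpha> + \<epsilon> \<le> 1" "u \<in> C_k_holder_loc (2 * m + nat \<lfloor>\<alpha>\<rfloor>) (frac \<alpha> + \<epsilon>)"
    using u_reg by blast
  define a where "a = nat \<lfloor>\<alpha>\<rfloor>"
  define \<gamma> where "\<gamma> = frac \<alpha> + \<epsilon>"
  define p where "p = (real CARD('n) + \<alpha>) / 2"
  have reg: "u \<in> C_k_holder_loc (2 * m + a) \<gamma>" using \<epsilon> by (simp add: a_def \<gamma>_def)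
  have \<gamma>: "0 < \<gamma>" "\<gamma> \<le> 1"
    using \<epsilon> add_nonneg_pos[OF frac_ge_0[of \<alpha>], of \<epsilon>] by (auto simp: \<gamma>_def)
  have a: "a \<le> 1" using \<open>\<alpha> < 2\<close> by (simp add: a_def) linarith
  have "real a = of_int \<lfloor>\<alpha>\<rfloor>" using \<open>0 < \<alpha>\<close> by (simp add: a_def)
  \<comment> \<open>Integer part plus Hoelder exponent exceeds \<alpha> by \<epsilon>, so \<beta> =
    a + \<gamma> meets the requirement in \<open>admissible\<close>.\<close>
  then have a\<gamma>: "real a + \<gamma> = \<alpha> + \<epsilon>" by (simp add: \<gamma>_def frac_def)
  have p: "2 * p = real CARD('n) + \<alpha>" by (simp add: p_def)
  have sb: "sdiff_bounded (real a + \<gamma>) u" by (rule holder_sdiff_bounded[OF \<gamma> a reg])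
  have um: "u \<in> borel_measurable borel"
    by (rule continuous_borel_measurable[OF sdiff_bounded_continuous[OF sb]])
  have adm: "admissible p u"
    unfolding admissible_def
  proof (intro conjI exI[of _ "real a + \<gamma>"] sb)
    show "integrable lborel (\<lambda>z. u z * (1 + (norm z)\<^sup>2) powr - p)"
      by (rule L_frac_weight[OF u_L um p \<open>0 < \<alpha>\<close>])
  qed (use p a\<gamma> \<epsilon> \<open>0 < \<alpha>\<close> in auto)
  define v where "v i = higher_frac_laplacian i \<alpha> u" for i
  define c where "c = frac_laplacian_const CARD('n) \<alpha> / 2"
  have v0: "v 0 = (\<lambda>x. c * sdiff_integral p u x)"
    by (simp add: v_def higher_frac_laplacian_def fun_eq_iff c_def frac_laplacian_eq[OF adm p])
  have "sdiff_integral p u \<in> C_k (2 * m)"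
    by (rule sdiff_integral_C_k[OF adm \<gamma> a _ reg]) (use p a\<gamma> \<epsilon> in auto)
  then have v0C: "v 0 \<in> C_k (2 * m)" unfolding v0 by (rule C_k_cmult)
  have vC: "v j \<in> C_k 2 \<and> v (Suc j) = neg_laplacian (v j)" if "j < m" for j
  proof
    \<comment> \<open>Level j spends 2j derivatives and keeps two more; 2j + 2 <= 2m is the reason
      for j < m.\<close>
    have "v 0 \<in> C_k (2 * j + 2)" using that by (intro C_k_mono[OF v0C]) simp
    from iterate_neg_laplacian_C_k[OF this] show "v j \<in> C_k 2"
      by (simp add: v_def higher_frac_laplacian_def)
    show "v (Suc j) = neg_laplacian (v j)" by (simp add: v_def higher_frac_laplacian_def)
  qed
  \<comment> \<open>Exponent 3 is the smallest to which \<open>test_function_bump\<close>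
    applies.\<close>
  have lim: "((\<lambda>R. average 3 (v 0) z R) \<longlongrightarrow> 0) at_top" for z
    unfolding v0 average_cmult
    by (rule tendsto_mult_right_zero[OF average_sdiff_integral_tendsto_0[OF adm]]) (use p \<open>\<alpha> < 2\<close> in auto)
  \<comment> \<open>Level m is included as the starting point of the downward induction.\<close>
  have "\<forall>x. v i x \<le> 0" if "i \<le> m" for i
    using that
  proof (induction rule: inc_induct)
    case base
    show ?case using eqn f_nonpos by (simp add: v_def)
  next
    case (step i)
    then show ?case
      using super_polyharmonic_step[of i v 3] vC lim by auto
  qed
  then show ?thesis by (simp add: v_def)
qed

end
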